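(* The $\mathbb{Q}$-linear map $\mathcal{H}_{\mathrm{Des}} \to \mathrm{QSym}$ defined by $[\pi]_{\mathrm{Des}} \mapsto F_{\mathrm{Comp}(\pi)}$ is an isomorphism of Hopf algebras.
   Context: A permutation is a finite (possibly empty) sequence $\pi = \pi_1 \cdots \pi_n$ of distinct positive integers, called its letters; $|\pi| = n$ is its length. $\mathrm{Des}(\pi) = \{1 \le i \le n-1 : \pi_i > \pi_{i+1}\}$ is the descent set. Write $\pi \sim_{\mathrm{Des}} \sigma$ if $|\pi| = |\sigma|$ and $\mathrm{Des}(\pi) = \mathrm{Des}(\sigma)$; $[\pi]_{\mathrm{Des}}$ is the equivalence class of $\pi$. For permutations with no letters in common, the shuffle set $\pi ⧢ \sigma$ is the set of all $\binom{|\pi|+|\sigma|}{|\pi|}$ permutations of length $|\pi|+|\sigma|$ containing both $\pi$ and $\sigma$ as subsequences. It is known that $\mathrm{Des}$ is shuffle-compatible (for disjoint $\pi,\sigma$ the multiset $\{\mathrm{Des}(\tau):\tau\in\pi⧢\sigma\}$ depends only on the descent sets and lengths of $\pi$ and $\sigma$) and substring-compatible (the descent set and length of $\pi$ determine the descent set of every substring $\pi_i\cdots\pi_j$). $\mathcal{H}_{\mathrm{Des}}$ is the graded connected Hopf algebra over $\mathbb{Q}$ with basis the classes $[\pi]_{\mathrm{Des}}$, graded by length, product $[\pi]_{\mathrm{Des}} \cdot [\sigma]_{\mathrm{Des}} = \sum_{\tau \in \pi ⧢ \sigma} [\tau]_{\mathrm{Des}}$ for disjoint representatives $\pi,\sigma$,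 unit the class of the empty permutation, coproduct $\Delta([\pi]_{\mathrm{Des}}) = \sum_{i=0}^{n} [\pi_1 \cdots \pi_i]_{\mathrm{Des}} \otimes [\pi_{i+1} \cdots \pi_n]_{\mathrm{Des}}$, and counit sending the class of the empty permutation to $1$ and all other classes to $0$ (the antipode exists uniquely because the bialgebra is graded and connected). If $\mathrm{Des}(\pi) = \{d_1 < \cdots < d_k\}$ with $|\pi|=n\ge1$, then $\mathrm{Comp}(\pi) = (d_1, d_2 - d_1, \dots, d_k - d_{k-1}, n - d_k)$ (equal to $(n)$ if there are no descents); $\mathrm{Comp}$ of the empty permutation is the empty composition. $\mathrm{QSym}$ is the Hopf algebra of quasisymmetric functions over $\mathbb{Q}$ with its usual structure, and $\{F_\alpha\}$, indexed by integer compositions, is its fundamental basis: for $\alpha = (\alpha_1,\dots,\alpha_\ell)$ a composition of $n$, $F_\alpha = \sum x_{i_1} \cdots x_{i_n}$ over all $i_1 \le \cdots \le i_n$ with $i_j < i_{j+1}$ whenever $j \in \{\alpha_1, \alpha_1+\alpha_2, \dots, \alpha_1+\cdots+\alpha_{\ell-1}\}$; $F_\varnothing = 1$. *)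

theory Defs
  imports Complex_Main "HOL-Library.Poly_Mapping" "HOL-Library.Sublist"
begin

section \<open>Rational vector spaces\<close>

class rat_vector = ab_group_add +
  fixes scaleQ :: "rat \<Rightarrow> 'a \<Rightarrow> 'a" (infixr \<open>*\<^sub>Q\<close> 75)
  assumes scaleQ_add_right: "a *\<^sub>Q (x + y) = a *\<^sub>Q x + a *\<^sub>Q y"
    and scaleQ_add_left: "(a + b) *\<^sub>Q x = a *\<^sub>Q x + b *\<^sub>Q x"
    and scaleQ_scaleQ: "a *\<^sub>Q b *\<^sub>Q x = (a * b) *\<^sub>Q x"
    and scaleQ_one: "1 *\<^sub>Q x = x"

global_interpretation rat_vector: vector_space "scaleQ :: rat \<Rightarrow> 'a \<Rightarrow> 'a::rat_vector"
  by unfold_locales (fact scaleQ_add_right scaleQ_add_left scaleQ_scaleQ scaleQ_one)+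

abbreviation qlinear :: "('a::rat_vector \<Rightarrow> 'b::rat_vector) \<Rightarrow> bool"
  where "qlinear \<equiv> Vector_Spaces.linear scaleQ scaleQ"

definition qbilinear :: "('a::rat_vector \<Rightarrow> 'b::rat_vector \<Rightarrow> 'c::rat_vector) \<Rightarrow> bool"
  where "qbilinear b \<longleftrightarrow> (\<forall>x. qlinear (b x)) \<and> (\<forall>y. qlinear (\<lambda>x. b x y))"

lemma qlinear_iff:
  "qlinear f \<longleftrightarrow> (\<forall>x y. f (x + y) = f x + f y) \<and> (\<forall>c x. f (c *\<^sub>Q x) = c *\<^sub>Q f x)"
  by (auto simp: Vector_Spaces.linear_def module_hom_def module_hom_axioms_def
        rat_vector.vector_space_axioms rat_vector.module_axioms)

instantiation rat :: rat_vector
begin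
definition scaleQ_rat :: "rat \<Rightarrow> rat \<Rightarrow> rat" where "scaleQ_rat = (*)"
instance by standard (simp_all add: scaleQ_rat_def algebra_simps)
end

instantiation poly_mapping :: (type, rat_vector) rat_vector
begin
lift_definition scaleQ_poly_mapping :: "rat \<Rightarrow> ('a \<Rightarrow>\<^sub>0 'b) \<Rightarrow> 'a \<Rightarrow>\<^sub>0 'b"
  is "\<lambda>c f k. c *\<^sub>Q f k"
  by (erule rev_finite_subset) auto
instance
  by standard
    (transfer; simp add: fun_eq_iff scaleQ_add_right scaleQ_add_left scaleQ_scaleQ scaleQ_one)+
end

text \<open>The type \<open>'a \<Rightarrow>\<^sub>0 rat\<close> is the free vector space with basis \<open>Poly_Mapping.single k 1\<close>.\<close>

definition linear_extension :: "('k \<Rightarrow> 'a::rat_vector) \<Rightarrow> ('k \<Rightarrow>\<^sub>0 rat) \<Rightarrow> 'a"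
  where "linear_extension b v = (\<Sum>k\<in>Poly_Mapping.keys v. Poly_Mapping.lookup v k *\<^sub>Q b k)"

lemma lookup_scaleQ: "Poly_Mapping.lookup (c *\<^sub>Q v) k = c *\<^sub>Q Poly_Mapping.lookup v k"
  by transfer simp

lemma linear_extension_superset:
  assumes "finite K" "Poly_Mapping.keys v \<subseteq> K"
  shows "linear_extension b v = (\<Sum>k\<in>K. Poly_Mapping.lookup v k *\<^sub>Q b k)"
  unfolding linear_extension_def using assms
  by (intro sum.mono_neutral_left) (auto simp: in_keys_iff)

lemma qlinear_linear_extension: "qlinear (linear_extension b)"
  unfolding qlinear_iff
proof (intro conjI allI)
  fix v w :: "'a \<Rightarrow>\<^sub>0 rat" and c
  let ?K = "Poly_Mapping.keys v \<union> Poly_Mapping.keys w"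
  have "Poly_Mapping.keys (v + w) \<subseteq> ?K" by (rule keys_add)
  then have "linear_extension b (v + w) = (\<Sum>k\<in>?K. Poly_Mapping.lookup (v + w) k *\<^sub>Q b k)"
    by (intro linear_extension_superset) auto
  also have "\<dots> = linear_extension b v + linear_extension b w"
    by (simp add: linear_extension_superset[of ?K] lookup_add rat_vector.scale_left_distrib
        sum.distrib)
  finally show "linear_extension b (v + w) = linear_extension b v + linear_extension b w" .
  have "Poly_Mapping.keys (c *\<^sub>Q v) \<subseteq> Poly_Mapping.keys v"
    by (auto simp: in_keys_iff lookup_scaleQ)
  then have "linear_extension b (c *\<^sub>Q v)
      = (\<Sum>k\<in>Poly_Mapping.keys v. Poly_Mapping.lookup (c *\<^sub>Q v) k *\<^sub>Q b k)"
    by (intro linear_extension_superset) auto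
  then show "linear_extension b (c *\<^sub>Q v) = c *\<^sub>Q linear_extension b v"
    by (simp add: linear_extension_def lookup_scaleQ scaleQ_rat_def rat_vector.scale_sum_right)
qed

lemma qlinear_eq_linear_extension:
  assumes "qlinear f"
  shows "f v = linear_extension (\<lambda>k. f (Poly_Mapping.single k 1)) v"
proof -
  interpret f: Vector_Spaces.linear scaleQ scaleQ f by (fact assms)
  have "v = (\<Sum>k\<in>Poly_Mapping.keys v. Poly_Mapping.lookup v k *\<^sub>Q Poly_Mapping.single k 1)"
    by (rule poly_mapping_eqI)
      (auto simp: lookup_sum lookup_scaleQ lookup_single scaleQ_rat_def when_def in_keys_iff
        if_distrib[of "\<lambda>x. _ * x"] cong: if_cong)
  then have "f v
      = f (\<Sum>k\<in>Poly_Mapping.keys v. Poly_Mapping.lookup v k *\<^sub>Q Poly_Mapping.single k 1)"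
    by (rule arg_cong)
  then show ?thesis
    by (simp add: linear_extension_def f.sum f.scale)
qed

lemma linear_extension_single [simp]: "linear_extension b (Poly_Mapping.single k 1) = b k"
  by (simp add: linear_extension_def)

section \<open>Tensor products\<close>

definition tensor_relators :: "(('a::rat_vector \<times> 'b::rat_vector) \<Rightarrow>\<^sub>0 rat) set" where
  "tensor_relators =
     {Poly_Mapping.single (x + x', y) 1 - Poly_Mapping.single (x, y) 1
        - Poly_Mapping.single (x', y) 1 | x x' y. True}
   \<union> {Poly_Mapping.single (x, y + y') 1 - Poly_Mapping.single (x, y) 1
        - Poly_Mapping.single (x, y') 1 | x y y'. True}
   \<union> {Poly_Mapping.single (c *\<^sub>Q x, y) 1 - c *\<^sub>Q Poly_Mapping.single (x, y) 1 | c x y. True}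
   \<union> {Poly_Mapping.single (x, c *\<^sub>Q y) 1 - c *\<^sub>Q Poly_Mapping.single (x, y) 1 | c x y. True}"

definition tensor_equiv ::
    "(('a::rat_vector \<times> 'b::rat_vector) \<Rightarrow>\<^sub>0 rat) \<Rightarrow> (('a \<times> 'b) \<Rightarrow>\<^sub>0 rat) \<Rightarrow> bool"
  where "tensor_equiv s t \<longleftrightarrow> s - t \<in> rat_vector.span tensor_relators"

quotient_type (overloaded) ('a, 'b) tensor =
    "('a::rat_vector \<times> 'b::rat_vector) \<Rightarrow>\<^sub>0 rat" / tensor_equiv
proof (intro equivpI reflpI sympI transpI)
  show "tensor_equiv s s" for s :: "('a \<times> 'b) \<Rightarrow>\<^sub>0 rat"
    by (simp add: tensor_equiv_def rat_vector.span_zero)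
  show "tensor_equiv s t \<Longrightarrow> tensor_equiv t s" for s t :: "('a \<times> 'b) \<Rightarrow>\<^sub>0 rat"
    unfolding tensor_equiv_def by (drule rat_vector.span_neg) simp
  show "tensor_equiv s t \<Longrightarrow> tensor_equiv t u \<Longrightarrow> tensor_equiv s u"
    for s t u :: "('a \<times> 'b) \<Rightarrow>\<^sub>0 rat"
    unfolding tensor_equiv_def by (drule (1) rat_vector.span_add) simp
qed

instantiation tensor :: (rat_vector, rat_vector) rat_vector
begin

lift_definition zero_tensor :: "('a, 'b) tensor" is 0 .

lift_definition plus_tensor :: "('a, 'b) tensor \<Rightarrow> ('a, 'b) tensor \<Rightarrow> ('a, 'b) tensor" is "(+)"
  unfolding tensor_equiv_def by (drule (1) rat_vector.span_add) (simp add: algebra_simps)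

lift_definition uminus_tensor :: "('a, 'b) tensor \<Rightarrow> ('a, 'b) tensor" is uminus
  unfolding tensor_equiv_def by (drule rat_vector.span_neg) simp

lift_definition minus_tensor :: "('a, 'b) tensor \<Rightarrow> ('a, 'b) tensor \<Rightarrow> ('a, 'b) tensor" is "(-)"
  unfolding tensor_equiv_def by (drule (1) rat_vector.span_diff) (simp add: algebra_simps)

lift_definition scaleQ_tensor :: "rat \<Rightarrow> ('a, 'b) tensor \<Rightarrow> ('a, 'b) tensor" is scaleQ
  unfolding tensor_equiv_def
  by (simp flip: rat_vector.scale_right_diff_distrib add: rat_vector.span_scale)

instance
  by standard
    (transfer; simp add: tensor_equiv_def rat_vector.span_zero algebra_simps
      scaleQ_add_right scaleQ_add_left scaleQ_scaleQ scaleQ_one)+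

end

lift_definition pure_tensor :: "'a::rat_vector \<Rightarrow> 'b::rat_vector \<Rightarrow> ('a, 'b) tensor"
    (infixl \<open>\<otimes>\<close> 70)
  is "\<lambda>x y. Poly_Mapping.single (x, y) 1" .

definition tensor_lift ::
    "('a::rat_vector \<Rightarrow> 'b::rat_vector \<Rightarrow> 'c::rat_vector) \<Rightarrow> ('a, 'b) tensor \<Rightarrow> 'c"
  where "tensor_lift b = (THE g. qlinear g \<and> (\<forall>x y. g (x \<otimes> y) = b x y))"

text \<open>The universal property, which makes the description above a proper definition.\<close>

lemma tensor_ex1:
  assumes "qbilinear b"
  shows "\<exists>!g. qlinear g \<and> (\<forall>x y. g (x \<otimes> y) = b x y)"
proof
  define L where "L = linear_extension (\<lambda>(x, y). b x y)"
  have L: "qlinear L" unfolding L_def by (rule qlinear_linear_extension)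
  interpret L: Vector_Spaces.linear scaleQ scaleQ L by (fact L)
  have Ls: "L (Poly_Mapping.single (x, y) 1) = b x y" for x y
    by (simp add: L_def)
  have b: "b (x + x') y = b x y + b x' y" "b x (y + y') = b x y + b x y'"
    "b (c *\<^sub>Q x) y = c *\<^sub>Q b x y" "b x (c *\<^sub>Q y) = c *\<^sub>Q b x y" for x x' y y' c
    using assms unfolding qbilinear_def qlinear_iff by auto
  have ker: "L s = 0" if "s \<in> rat_vector.span tensor_relators" for s
    using that
  proof (induction rule: rat_vector.span_induct)
    case base
    show ?case by (auto simp: rat_vector.subspace_def L.add L.scale)
  next
    case (step s)
    then show ?case
      by (auto simp: tensor_relators_def L.diff L.scale Ls b)
  qed
  have resp: "tensor_equiv s t \<Longrightarrow> L s = L t" for s t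
    using ker[of "s - t"] by (simp add: tensor_equiv_def L.diff)
  define g where "g t = L (rep_tensor t)" for t
  have g_abs: "g (abs_tensor s) = L s" for s
    unfolding g_def
    by (rule resp) (rule Quotient3_rep_abs[OF Quotient3_tensor],
        simp add: tensor_equiv_def rat_vector.span_zero)
  show "qlinear g \<and> (\<forall>x y. g (x \<otimes> y) = b x y)"
  proof (intro conjI allI)
    show "qlinear g" unfolding qlinear_iff
    proof (intro conjI allI)
      fix s t :: "('a, 'b) tensor" and c
      obtain s' t' where st: "s = abs_tensor s'" "t = abs_tensor t'"
        by (metis Quotient3_abs_rep[OF Quotient3_tensor])
      show "g (s + t) = g s + g t" by (simp add: st plus_tensor.abs_eq g_abs L.add)
      show "g (c *\<^sub>Q s) = c *\<^sub>Q g s" by (simp add: st scaleQ_tensor.abs_eq g_abs L.scale)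
    qed
    show "g (x \<otimes> y) = b x y" for x y by (simp add: pure_tensor.abs_eq g_abs Ls)
  qed
  fix h assume h: "qlinear h \<and> (\<forall>x y. h (x \<otimes> y) = b x y)"
  interpret h: Vector_Spaces.linear scaleQ scaleQ h using h by blast
  have "qlinear (\<lambda>s. h (abs_tensor s))"
    unfolding qlinear_iff
    by (simp add: h.add h.scale flip: plus_tensor.abs_eq scaleQ_tensor.abs_eq)
  then have "h (abs_tensor s) = L s" for s
    using h by (subst qlinear_eq_linear_extension[of "\<lambda>s. h (abs_tensor s)"])
      (auto simp: L_def linear_extension_def simp flip: pure_tensor.abs_eq intro!: sum.cong)
  then show "h = g"
    by (metis (no_types) ext g_abs Quotient3_abs_rep[OF Quotient3_tensor])
qed

definition tensor_map ::
    "('a::rat_vector \<Rightarrow> 'c::rat_vector) \<Rightarrow> ('b::rat_vector \<Rightarrow> 'd::rat_vector)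
      \<Rightarrow> ('a, 'b) tensor \<Rightarrow> ('c, 'd) tensor"
  where "tensor_map f g = tensor_lift (\<lambda>x y. f x \<otimes> g y)"

definition tensor_assoc ::
    "(('a::rat_vector, 'b::rat_vector) tensor, 'c::rat_vector) tensor
      \<Rightarrow> ('a, ('b, 'c) tensor) tensor"
  where "tensor_assoc = tensor_lift (\<lambda>t z. tensor_lift (\<lambda>x y. x \<otimes> (y \<otimes> z)) t)"

section \<open>Hopf algebras over the rationals\<close>

record (overloaded) ('a::rat_vector) bialgebra_ops =
  mult :: "'a \<Rightarrow> 'a \<Rightarrow> 'a"
  unit :: 'a
  comult :: "'a \<Rightarrow> ('a, 'a) tensor"
  counit :: "'a \<Rightarrow> rat"

definition tensor_mult ::
    "'a::rat_vector bialgebra_ops \<Rightarrow> ('a, 'a) tensor \<Rightarrow> ('a, 'a) tensor \<Rightarrow> ('a, 'a) tensor"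
  where "tensor_mult A s t =
    tensor_lift (\<lambda>a b. tensor_lift (\<lambda>c d. mult A a c \<otimes> mult A b d) t) s"

locale bialgebra =
  fixes A :: "'a::rat_vector bialgebra_ops"
  assumes mult_bilinear: "qbilinear (mult A)"
    and mult_assoc: "mult A (mult A x y) z = mult A x (mult A y z)"
    and unit_left: "mult A (unit A) x = x"
    and unit_right: "mult A x (unit A) = x"
    and comult_linear: "qlinear (comult A)"
    and counit_linear: "qlinear (counit A)"
    and coassoc: "tensor_assoc (tensor_map (comult A) id (comult A x))
                  = tensor_map id (comult A) (comult A x)"
    and counit_left: "tensor_lift (\<lambda>a b. counit A a *\<^sub>Q b) (comult A x) = x"
    and counit_right: "tensor_lift (\<lambda>a b. counit A b *\<^sub>Q a) (comult A x) = x"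
    and comult_mult: "comult A (mult A x y) = tensor_mult A (comult A x) (comult A y)"
    and comult_unit: "comult A (unit A) = unit A \<otimes> unit A"
    and counit_mult: "counit A (mult A x y) = counit A x * counit A y"
    and counit_unit: "counit A (unit A) = 1"

definition is_antipode :: "'a::rat_vector bialgebra_ops \<Rightarrow> ('a \<Rightarrow> 'a) \<Rightarrow> bool"
  where "is_antipode A S \<longleftrightarrow> qlinear S
    \<and> (\<forall>x. tensor_lift (\<lambda>a b. mult A (S a) b) (comult A x) = counit A x *\<^sub>Q unit A)
    \<and> (\<forall>x. tensor_lift (\<lambda>a b. mult A a (S b)) (comult A x) = counit A x *\<^sub>Q unit A)"

locale hopf_algebra = bialgebra +
  assumes ex_antipode: "\<exists>S. is_antipode A S"

text \<open>In a bialgebra there is at most one antipode.\<close>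

definition antipode :: "'a::rat_vector bialgebra_ops \<Rightarrow> 'a \<Rightarrow> 'a"
  where "antipode A = (THE S. is_antipode A S)"

locale hopf_algebra_hom = A: hopf_algebra A + B: hopf_algebra B
  for A :: "'a::rat_vector bialgebra_ops" and B :: "'b::rat_vector bialgebra_ops" +
  fixes \<phi> :: "'a \<Rightarrow> 'b"
  assumes hom_linear: "qlinear \<phi>"
    and hom_mult: "\<phi> (mult A x y) = mult B (\<phi> x) (\<phi> y)"
    and hom_unit: "\<phi> (unit A) = unit B"
    and hom_comult: "comult B (\<phi> x) = tensor_map \<phi> \<phi> (comult A x)"
    and hom_counit: "counit B (\<phi> x) = counit A x"
    and hom_antipode: "\<phi> (antipode A x) = antipode B (\<phi> x)"

locale hopf_algebra_iso = hopf_algebra_hom +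
  assumes hom_bij: "bij \<phi>"

section \<open>Permutations and the Hopf algebra of descent classes\<close>

typedef permutation = "{xs :: nat list. distinct xs \<and> 0 \<notin> set xs}" morphisms letters Perm
  by (rule exI[of _ "[]"]) simp

setup_lifting type_definition_permutation

lift_definition len :: "permutation \<Rightarrow> nat" is length .

lift_definition empty_perm :: permutation is "[]" by simp

lift_definition prefix_perm :: "nat \<Rightarrow> permutation \<Rightarrow> permutation" is take
  by (auto dest: in_set_takeD)

lift_definition suffix_perm :: "nat \<Rightarrow> permutation \<Rightarrow> permutation" is drop
  by (auto dest: in_set_dropD)

text \<open>Positions are counted from 1, list indices from 0.\<close>

definition Des :: "permutation \<Rightarrow> nat set"
  where "Des \<pi> = {i. 1 \<le> i \<and> i < len \<pi> \<and> letters \<pi> ! (i - 1) > letters \<pi> ! i}"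

definition disjoint_perms :: "permutation \<Rightarrow> permutation \<Rightarrow> bool"
  where "disjoint_perms \<pi> \<sigma> \<longleftrightarrow> set (letters \<pi>) \<inter> set (letters \<sigma>) = {}"

definition shuffle_set :: "permutation \<Rightarrow> permutation \<Rightarrow> permutation set"
  where "shuffle_set \<pi> \<sigma> = {\<tau>. len \<tau> = len \<pi> + len \<sigma>
    \<and> subseq (letters \<pi>) (letters \<tau>) \<and> subseq (letters \<sigma>) (letters \<tau>)}"

definition Des_equiv :: "permutation \<Rightarrow> permutation \<Rightarrow> bool"
  where "Des_equiv \<pi> \<sigma> \<longleftrightarrow> len \<pi> = len \<sigma> \<and> Des \<pi> = Des \<sigma>"

quotient_type des_class = permutation / Des_equiv
  by (auto intro!: equivpI reflpI sympI transpI simp: Des_equiv_def)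

definition Des_basis :: "permutation \<Rightarrow> des_class \<Rightarrow>\<^sub>0 rat" (\<open>[_]\<^sub>D\<^sub>e\<^sub>s\<close>)
  where "[\<pi>]\<^sub>D\<^sub>e\<^sub>s = Poly_Mapping.single (abs_des_class \<pi>) 1"

text \<open>The description is proper because \<^const>\<open>Des\<close> is shuffle-compatible and any two classes
  have disjoint representatives.\<close>

definition des_class_mult :: "des_class \<Rightarrow> des_class \<Rightarrow> des_class \<Rightarrow>\<^sub>0 rat"
  where "des_class_mult c d = (THE v. \<forall>\<pi> \<sigma>. abs_des_class \<pi> = c \<longrightarrow> abs_des_class \<sigma> = d
    \<longrightarrow> disjoint_perms \<pi> \<sigma> \<longrightarrow> v = (\<Sum>\<tau>\<in>shuffle_set \<pi> \<sigma>. [\<tau>]\<^sub>D\<^sub>e\<^sub>s))"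

lemma letters_prefix_perm: "letters (prefix_perm i \<pi>) = take i (letters \<pi>)"
  by transfer simp

lemma letters_suffix_perm: "letters (suffix_perm i \<pi>) = drop i (letters \<pi>)"
  by transfer simp

lemma len_eq: "len \<pi> = length (letters \<pi>)"
  by transfer simp

lemma Des_prefix_perm: "i \<le> len \<pi> \<Longrightarrow> Des (prefix_perm i \<pi>) = {j \<in> Des \<pi>. j < i}"
  by (auto simp: Des_def letters_prefix_perm len_eq)

lemma Des_suffix_perm:
  "i \<le> len \<pi> \<Longrightarrow> Des (suffix_perm i \<pi>) = {j. 1 \<le> j \<and> i + j \<in> Des \<pi>}"
  by (auto simp: Des_def letters_suffix_perm len_eq)

lift_definition des_class_comult ::
    "des_class \<Rightarrow> (des_class \<Rightarrow>\<^sub>0 rat, des_class \<Rightarrow>\<^sub>0 rat) tensor"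
  is "\<lambda>\<pi>. \<Sum>i\<le>len \<pi>. [prefix_perm i \<pi>]\<^sub>D\<^sub>e\<^sub>s \<otimes> [suffix_perm i \<pi>]\<^sub>D\<^sub>e\<^sub>s"
proof -
  fix \<pi> \<sigma> assume eq: "Des_equiv \<pi> \<sigma>"
  have "Des_equiv (prefix_perm i \<pi>) (prefix_perm i \<sigma>)"
    "Des_equiv (suffix_perm i \<pi>) (suffix_perm i \<sigma>)" if "i \<le> len \<pi>" for i
    using eq that Des_prefix_perm[of i \<pi>] Des_prefix_perm[of i \<sigma>]
      Des_suffix_perm[of i \<pi>] Des_suffix_perm[of i \<sigma>]
    by (simp_all add: Des_equiv_def len_eq letters_prefix_perm letters_suffix_perm)
  then have "[prefix_perm i \<pi>]\<^sub>D\<^sub>e\<^sub>s = [prefix_perm i \<sigma>]\<^sub>D\<^sub>e\<^sub>s"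
    "[suffix_perm i \<pi>]\<^sub>D\<^sub>e\<^sub>s = [suffix_perm i \<sigma>]\<^sub>D\<^sub>e\<^sub>s" if "i \<le> len \<pi>" for i
    using that by (metis Des_basis_def des_class.abs_eq_iff)+
  then show "(\<Sum>i\<le>len \<pi>. [prefix_perm i \<pi>]\<^sub>D\<^sub>e\<^sub>s \<otimes> [suffix_perm i \<pi>]\<^sub>D\<^sub>e\<^sub>s)
      = (\<Sum>i\<le>len \<sigma>. [prefix_perm i \<sigma>]\<^sub>D\<^sub>e\<^sub>s \<otimes> [suffix_perm i \<sigma>]\<^sub>D\<^sub>e\<^sub>s)"
    using eq by (intro sum.cong) (simp_all add: Des_equiv_def)
qed

definition H_Des :: "(des_class \<Rightarrow>\<^sub>0 rat) bialgebra_ops"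
  where "H_Des =
    \<lparr> mult = (\<lambda>v w. linear_extension (\<lambda>c. linear_extension (\<lambda>d. des_class_mult c d) w) v),
      unit = [empty_perm]\<^sub>D\<^sub>e\<^sub>s,
      comult = linear_extension des_class_comult,
      counit = linear_extension (\<lambda>c. if c = abs_des_class empty_perm then 1 else 0) \<rparr>"

section \<open>Compositions\<close>

typedef composition = "{\<alpha> :: nat list. \<forall>a\<in>set \<alpha>. 0 < a}" morphisms parts Composition
  by (rule exI[of _ "[]"]) simp

setup_lifting type_definition_composition

lift_definition comp_append :: "composition \<Rightarrow> composition \<Rightarrow> composition" is "(@)"
  by auto

definition Comp_parts :: "permutation \<Rightarrow> nat list"
  where "Comp_parts \<pi> = (if len \<pi> = 0 then []
    else let ds = sorted_list_of_set (Des \<pi>) @ [len \<pi>] in map2 (-) ds (0 # ds))"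

lemma positive_differences:
  "sorted_wrt (<) (d # ds) \<Longrightarrow> a \<in> set (map2 (-) ds (d # ds)) \<Longrightarrow> 0 < (a::nat)"
  by (induction ds arbitrary: d) auto

lift_definition Comp :: "permutation \<Rightarrow> composition" is Comp_parts
proof -
  fix \<pi> a assume a: "a \<in> set (Comp_parts \<pi>)"
  have "Des \<pi> \<subseteq> {1..<len \<pi>}" by (auto simp: Des_def)
  moreover from this have "finite (Des \<pi>)" by (rule finite_subset) simp
  ultimately have "len \<pi> \<noteq> 0 \<Longrightarrow> sorted_wrt (<) (0 # sorted_list_of_set (Des \<pi>) @ [len \<pi>])"
    by (auto simp: sorted_wrt_append)
  moreover have "len \<pi> \<noteq> 0"
    "a \<in> set (map2 (-) (sorted_list_of_set (Des \<pi>) @ [len \<pi>])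
      (0 # sorted_list_of_set (Des \<pi>) @ [len \<pi>]))"
    using a by (simp_all add: Comp_parts_def Let_def del: set_map split: if_splits)
  ultimately show "0 < a" by (blast intro: positive_differences)
qed

section \<open>Quasisymmetric functions\<close>

text \<open>A monomial in the variables \<open>x\<^sub>1, x\<^sub>2, \<dots>\<close> is its exponent vector, of type
  \<open>nat \<Rightarrow>\<^sub>0 nat\<close>; index \<open>i\<close> stands for the variable \<open>x\<^bsub>i+1\<^esub>\<close>. A formal power series is the
  function giving the coefficient of each monomial.\<close>

type_synonym monomial = "nat \<Rightarrow>\<^sub>0 nat"

definition power_monomial :: "nat list \<Rightarrow> nat list \<Rightarrow> monomial"
  where "power_monomial is as = (\<Sum>(i, a)\<leftarrow>zip is as. Poly_Mapping.single i a)"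

definition word_monomial :: "nat list \<Rightarrow> monomial"
  where "word_monomial is = (\<Sum>i\<leftarrow>is. Poly_Mapping.single i 1)"

definition total_degree :: "monomial \<Rightarrow> nat"
  where "total_degree m = (\<Sum>i\<in>Poly_Mapping.keys m. Poly_Mapping.lookup m i)"

definition bounded_degree :: "(monomial \<Rightarrow> rat) \<Rightarrow> bool"
  where "bounded_degree f \<longleftrightarrow> (\<exists>d. \<forall>m. f m \<noteq> 0 \<longrightarrow> total_degree m \<le> d)"

definition quasisymmetric :: "(monomial \<Rightarrow> rat) \<Rightarrow> bool"
  where "quasisymmetric f \<longleftrightarrow> (\<forall>\<alpha> is js.
    sorted_wrt (<) is \<longrightarrow> sorted_wrt (<) js
    \<longrightarrow> length is = length (parts \<alpha>) \<longrightarrow> length js = length (parts \<alpha>)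
    \<longrightarrow> f (power_monomial is (parts \<alpha>)) = f (power_monomial js (parts \<alpha>)))"

lemma quasisymmetricI:
  assumes "\<And>\<alpha> is js. sorted_wrt (<) is \<Longrightarrow> sorted_wrt (<) js
    \<Longrightarrow> length is = length (parts \<alpha>) \<Longrightarrow> length js = length (parts \<alpha>)
    \<Longrightarrow> f (power_monomial is (parts \<alpha>)) = f (power_monomial js (parts \<alpha>))"
  shows "quasisymmetric f"
  unfolding quasisymmetric_def using assms by blast

lemma quasisymmetricD:
  assumes "quasisymmetric f" "sorted_wrt (<) is" "sorted_wrt (<) js"
    "length is = length (parts \<alpha>)" "length js = length (parts \<alpha>)"
  shows "f (power_monomial is (parts \<alpha>)) = f (power_monomial js (parts \<alpha>))"
  using assms unfolding quasisymmetric_def by blast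

typedef qsym = "{f. bounded_degree f \<and> quasisymmetric f}" morphisms coeff_of Abs_qsym
  by (rule exI[of _ "\<lambda>_. 0"]) (simp add: bounded_degree_def quasisymmetric_def)

setup_lifting type_definition_qsym

instantiation qsym :: rat_vector
begin

lift_definition zero_qsym :: qsym is "\<lambda>_. 0"
  by (simp add: bounded_degree_def quasisymmetric_def)

lift_definition plus_qsym :: "qsym \<Rightarrow> qsym \<Rightarrow> qsym" is "\<lambda>f g m. f m + g m"
proof -
  fix f g :: "monomial \<Rightarrow> rat"
  assume f: "bounded_degree f \<and> quasisymmetric f" and g: "bounded_degree g \<and> quasisymmetric g"
  from f g obtain d e where d: "\<And>m. f m \<noteq> 0 \<Longrightarrow> total_degree m \<le> d"
    and e: "\<And>m. g m \<noteq> 0 \<Longrightarrow> total_degree m \<le> e"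
    unfolding bounded_degree_def by blast
  have "total_degree m \<le> max d e" if "f m + g m \<noteq> 0" for m
    using that d[of m] e[of m] by (cases "f m = 0") auto
  then have "bounded_degree (\<lambda>m. f m + g m)"
    unfolding bounded_degree_def by blast
  moreover have "quasisymmetric (\<lambda>m. f m + g m)"
    using f g by (intro quasisymmetricI arg_cong2[where f = "(+)"]) (blast intro: quasisymmetricD)+
  ultimately show "bounded_degree (\<lambda>m. f m + g m) \<and> quasisymmetric (\<lambda>m. f m + g m)" ..
qed

lift_definition uminus_qsym :: "qsym \<Rightarrow> qsym" is "\<lambda>f m. - f m"
  by (auto simp: bounded_degree_def intro!: quasisymmetricI dest: quasisymmetricD)

definition minus_qsym :: "qsym \<Rightarrow> qsym \<Rightarrow> qsym" where "minus_qsym f g = f + (- g)"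

lift_definition scaleQ_qsym :: "rat \<Rightarrow> qsym \<Rightarrow> qsym" is "\<lambda>c f m. c * f m"
  by (auto simp: bounded_degree_def intro!: quasisymmetricI dest: quasisymmetricD)

instance
proof
  show "x - y = x + - y" for x y :: qsym by (rule minus_qsym_def)
qed (transfer; simp add: fun_eq_iff algebra_simps)+

end

definition relabel :: "(nat \<Rightarrow> nat) \<Rightarrow> monomial \<Rightarrow> monomial"
  where "relabel h m = (\<Sum>i\<in>Poly_Mapping.keys m. Poly_Mapping.single (h i) (Poly_Mapping.lookup m i))"

lemma relabel_superset:
  assumes "finite K" "Poly_Mapping.keys m \<subseteq> K"
  shows "relabel h m = (\<Sum>i\<in>K. Poly_Mapping.single (h i) (Poly_Mapping.lookup m i))"
  unfolding relabel_def using assms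
  by (intro sum.mono_neutral_left) (auto simp: in_keys_iff)

lemma keys_plus_monomial:
  "Poly_Mapping.keys (m + m' :: monomial) = Poly_Mapping.keys m \<union> Poly_Mapping.keys m'"
  by (auto simp: in_keys_iff lookup_add)

lemma relabel_zero [simp]: "relabel h 0 = 0"
  by (simp add: relabel_def)

lemma relabel_add: "relabel h (m + m') = relabel h m + relabel h m'"
  by (simp add: relabel_superset[of "Poly_Mapping.keys m \<union> Poly_Mapping.keys m'"]
      keys_plus_monomial lookup_add single_add sum.distrib)

lemma relabel_single [simp]: "relabel h (Poly_Mapping.single i a) = Poly_Mapping.single (h i) a"
  by (simp add: relabel_def)

lemma relabel_sum: "relabel h (\<Sum>x\<in>X. f x) = (\<Sum>x\<in>X. relabel h (f x))"
  by (induction X rule: infinite_finite_induct) (auto simp: relabel_add)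

lemma relabel_word: "relabel h (word_monomial is) = word_monomial (List.map h is)"
  by (induction "is") (auto simp: word_monomial_def relabel_add)

lemma power_monomial_simps [simp]:
  "power_monomial [] as = 0" "power_monomial is [] = 0"
  "power_monomial (i # is) (a # as) = Poly_Mapping.single i a + power_monomial is as"
  by (simp_all add: power_monomial_def)

lemma relabel_power: "relabel h (power_monomial is as) = power_monomial (List.map h is) as"
proof (induction "is" arbitrary: as)
  case (Cons i "is")
  then show ?case by (cases as) (auto simp: relabel_add)
qed simp

lemma sum_single_lookup:
  "(\<Sum>i\<in>Poly_Mapping.keys m. Poly_Mapping.single i (Poly_Mapping.lookup m i)) = (m :: monomial)"
  by (rule poly_mapping_eqI)
    (auto simp: lookup_sum lookup_single when_def in_keys_iff)

lemma relabel_relabel: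
  assumes "\<And>i. i \<in> Poly_Mapping.keys m \<Longrightarrow> g (h i) = i"
  shows "relabel g (relabel h m) = m"
  by (subst (2) relabel_def) (simp add: relabel_sum assms sum_single_lookup)

lemma keys_word_monomial: "Poly_Mapping.keys (word_monomial is) = set is"
  by (induction "is") (auto simp: word_monomial_def keys_plus_monomial)

lemma keys_power_monomial_subset: "Poly_Mapping.keys (power_monomial is as) \<subseteq> set is"
proof (induction "is" arbitrary: as)
  case (Cons i "is")
  then show ?case by (cases as) (fastforce simp: keys_plus_monomial split: if_splits)+
qed simp

lemma keys_power_monomial:
  "length is = length as \<Longrightarrow> \<forall>a\<in>set as. 0 < a \<Longrightarrow> Poly_Mapping.keys (power_monomial is as) = set is"
  by (induction "is" as rule: list_induct2) (auto simp: keys_plus_monomial)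

lemma keys_relabel: "Poly_Mapping.keys (relabel h m) \<subseteq> h ` Poly_Mapping.keys m"
proof
  fix k assume "k \<in> Poly_Mapping.keys (relabel h m)"
  then have "(\<Sum>i\<in>Poly_Mapping.keys m. Poly_Mapping.lookup
      (Poly_Mapping.single (h i) (Poly_Mapping.lookup m i)) k) \<noteq> 0"
    by (simp add: in_keys_iff relabel_def lookup_sum)
  then show "k \<in> h ` Poly_Mapping.keys m"
    by (auto simp: lookup_single when_def split: if_splits)
qed

lemma total_degree_superset:
  assumes "finite K" "Poly_Mapping.keys m \<subseteq> K"
  shows "total_degree m = (\<Sum>i\<in>K. Poly_Mapping.lookup m i)"
  unfolding total_degree_def using assms
  by (intro sum.mono_neutral_left) (auto simp: in_keys_iff)

lemma total_degree_add: "total_degree (m + m') = total_degree m + total_degree m'"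
  by (simp add: total_degree_superset[of "Poly_Mapping.keys m \<union> Poly_Mapping.keys m'"]
      keys_plus_monomial lookup_add sum.distrib)

lemma total_degree_single [simp]: "total_degree (Poly_Mapping.single i a) = a"
  by (simp add: total_degree_def)

lemma total_degree_zero [simp]: "total_degree 0 = 0"
  by (simp add: total_degree_def)

lemma total_degree_word: "total_degree (word_monomial is) = length is"
  by (induction "is") (auto simp: word_monomial_def total_degree_add)

lemma total_degree_power:
  "length is = length as \<Longrightarrow> total_degree (power_monomial is as) = sum_list as"
  by (induction "is" as rule: list_induct2) (auto simp: total_degree_add)

lemma ex_order_bij:
  assumes "sorted_wrt (<) is" "sorted_wrt (<) js" "length is = length js"
  obtains h :: "nat \<Rightarrow> nat" where "strict_mono_on (set is) h" "List.map h is = js"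
proof -
  define h where "h i = the (map_of (zip is js) i)" for i
  have "distinct is" using assms(1) strict_sorted_iff by blast
  then have h: "h (is ! k) = js ! k" if "k < length is" for k
    using that assms(3) by (simp add: h_def map_of_zip_nth)
  have "strict_mono_on (set is) h"
  proof (rule strict_mono_onI)
    fix x y assume "x \<in> set is" "y \<in> set is" "x < y"
    then obtain k l where kl: "k < length is" "l < length is" "is ! k = x" "is ! l = y"
      by (metis in_set_conv_nth)
    have "k < l"
      using kl \<open>x < y\<close> assms(1) by (metis linorder_neqE_nat not_less_iff_gr_or_eq sorted_wrt_nth_less)
    then show "h x < h y"
      using kl h assms by (metis sorted_wrt_nth_less)
  qed
  moreover have "List.map h is = js"
    using h assms(3) by (auto intro: nth_equalityI)
  ultimately show ?thesis using that by blast
qed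

lemma order_inverse:
  fixes h :: "nat \<Rightarrow> nat"
  assumes "strict_mono_on K h"
  obtains g where "strict_mono_on (h ` K) g" "\<And>i. i \<in> K \<Longrightarrow> g (h i) = i"
proof
  have inj: "inj_on h K" using assms by (rule strict_mono_on_imp_inj_on)
  then show g: "inv_into K h (h i) = i" if "i \<in> K" for i using that by simp
  show "strict_mono_on (h ` K) (inv_into K h)"
  proof (rule strict_mono_onI)
    fix x y assume "x \<in> h ` K" "y \<in> h ` K" "x < y"
    then obtain i j where "i \<in> K" "j \<in> K" "x = h i" "y = h j" "h i < h j" by auto
    then show "inv_into K h x < inv_into K h y"
      using assms g by (metis linorder_less_linear not_less_iff_gr_or_eq strict_mono_onD)
  qed
qed

lemma quasisymmetric_relabelI:
  assumes "\<And>m h. strict_mono_on (Poly_Mapping.keys m) h \<Longrightarrow> f m \<le> f (relabel h m)"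
  shows "quasisymmetric f"
proof (rule quasisymmetricI)
  have le: "f (power_monomial is (parts \<alpha>)) \<le> f (power_monomial js (parts \<alpha>))"
    if "sorted_wrt (<) is" "sorted_wrt (<) js"
      "length is = length (parts \<alpha>)" "length js = length (parts \<alpha>)" for \<alpha> "is" js
  proof -
    have "length is = length js" using that by simp
    with that obtain h where h: "strict_mono_on (set is) h" "List.map h is = js"
      by (blast intro: ex_order_bij)
    have "strict_mono_on (Poly_Mapping.keys (power_monomial is (parts \<alpha>))) h"
      using h(1) keys_power_monomial_subset by (rule monotone_on_subset)
    from assms[OF this] show ?thesis
      by (simp add: relabel_power h(2))
  qed
  show "f (power_monomial is (parts \<alpha>)) = f (power_monomial js (parts \<alpha>))"
    if "sorted_wrt (<) is" "sorted_wrt (<) js"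
      "length is = length (parts \<alpha>)" "length js = length (parts \<alpha>)" for \<alpha> "is" js
    using le[of "is" js \<alpha>] le[of js "is" \<alpha>] that by linarith
qed

lemma quasisymmetric_relabelD:
  assumes f: "quasisymmetric f" and h: "strict_mono_on (Poly_Mapping.keys m) h"
  shows "f (relabel h m) = f m"
proof -
  define ks where "ks = sorted_list_of_set (Poly_Mapping.keys m)"
  have ks: "sorted_wrt (<) ks" "set ks = Poly_Mapping.keys m" "distinct ks"
    by (simp_all add: ks_def)
  define \<alpha> where "\<alpha> = Composition (List.map (Poly_Mapping.lookup m) ks)"
  have \<alpha>: "parts \<alpha> = List.map (Poly_Mapping.lookup m) ks"
    unfolding \<alpha>_def by (rule Composition_inverse) (auto simp: ks in_keys_iff)
  have "power_monomial xs (List.map (Poly_Mapping.lookup m) xs)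
      = (\<Sum>i\<leftarrow>xs. Poly_Mapping.single i (Poly_Mapping.lookup m i))" for xs
    by (induction xs) auto
  then have m: "m = power_monomial ks (parts \<alpha>)"
    using ks by (simp add: \<alpha> sum_list_distinct_conv_sum_set sum_single_lookup)
  have "sorted_wrt (<) (List.map h ks)"
    using ks h by (auto simp: sorted_wrt_map strict_mono_on_def intro: sorted_wrt_mono_rel[rotated])
  then show ?thesis
    using quasisymmetricD[OF f, of ks "List.map h ks" \<alpha>] ks
    by (simp add: m relabel_power) (simp add: \<alpha>)
qed

lift_definition qsym_mult :: "qsym \<Rightarrow> qsym \<Rightarrow> qsym"
  is "\<lambda>f g m. \<Sum>(a, b) | a + b = m. f a * g b"
proof -
  fix f g :: "monomial \<Rightarrow> rat"
  assume f: "bounded_degree f \<and> quasisymmetric f" and g: "bounded_degree g \<and> quasisymmetric g"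
  let ?p = "\<lambda>m. \<Sum>(a, b) | a + b = m. f a * g b"
  from f g obtain d e where d: "\<And>m. f m \<noteq> 0 \<Longrightarrow> total_degree m \<le> d"
    and e: "\<And>m. g m \<noteq> 0 \<Longrightarrow> total_degree m \<le> e"
    unfolding bounded_degree_def by blast
  have "total_degree m \<le> d + e" if "?p m \<noteq> 0" for m
  proof -
    from that obtain a b where "a + b = m" "f a * g b \<noteq> 0"
      by (rule sum.not_neutral_contains_not_neutral) auto
    then show ?thesis
      using d[of a] e[of b] by (auto simp: total_degree_add)
  qed
  then have "bounded_degree ?p"
    unfolding bounded_degree_def by blast
  moreover have "quasisymmetric ?p"
  proof (rule quasisymmetric_relabelI)
    fix m :: monomial and h :: "nat \<Rightarrow> nat"
    assume h: "strict_mono_on (Poly_Mapping.keys m) h"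
    then obtain k where k: "\<And>i. i \<in> Poly_Mapping.keys m \<Longrightarrow> k (h i) = i"
      by (blast elim: order_inverse)
    have hk: "h (k j) = j" if "j \<in> Poly_Mapping.keys (relabel h m)" for j
      using that k keys_relabel by fastforce
    have kh: "relabel k (relabel h m) = m"
      by (rule relabel_relabel) (rule k)
    have "?p m = ?p (relabel h m)"
    proof (rule sum.reindex_bij_witness[where i = "map_prod (relabel k) (relabel k)"
            and j = "map_prod (relabel h) (relabel h)"])
      fix x assume "x \<in> {(a, b). a + b = m}"
      then obtain a b where x: "x = (a, b)" "a + b = m" by auto
      then have sub: "Poly_Mapping.keys a \<subseteq> Poly_Mapping.keys m"
        "Poly_Mapping.keys b \<subseteq> Poly_Mapping.keys m"
        by (auto simp: keys_plus_monomial)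
      then show "map_prod (relabel k) (relabel k) (map_prod (relabel h) (relabel h) x) = x"
        using k by (auto simp: x intro!: relabel_relabel)
      show "map_prod (relabel h) (relabel h) x \<in> {(a, b). a + b = relabel h m}"
        using x by (auto simp: relabel_add)
      have "f (relabel h a) = f a" "g (relabel h b) = g b"
        using f g by (auto intro: quasisymmetric_relabelD monotone_on_subset[OF h sub(1)]
            monotone_on_subset[OF h sub(2)])
      then show "(case map_prod (relabel h) (relabel h) x of (a, b) \<Rightarrow> f a * g b)
          = (case x of (a, b) \<Rightarrow> f a * g b)"
        by (simp add: x)
    next
      fix x assume "x \<in> {(a, b). a + b = relabel h m}"
      then obtain a b where x: "x = (a, b)" "a + b = relabel h m" by auto
      then have "Poly_Mapping.keys a \<subseteq> Poly_Mapping.keys (relabel h m)"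
        "Poly_Mapping.keys b \<subseteq> Poly_Mapping.keys (relabel h m)"
        by (auto simp: keys_plus_monomial simp flip: x(2))
      then show "map_prod (relabel h) (relabel h) (map_prod (relabel k) (relabel k) x) = x"
        using hk by (auto simp: x intro!: relabel_relabel)
      show "map_prod (relabel k) (relabel k) x \<in> {(a, b). a + b = m}"
        using kh by (auto simp: x(1) simp flip: relabel_add x(2))
    qed
    then show "?p m \<le> ?p (relabel h m)" by simp
  qed
  ultimately show "bounded_degree ?p \<and> quasisymmetric ?p" ..
qed

lift_definition qsym_one :: qsym is "\<lambda>m. if m = 0 then 1 else 0"
  by (auto simp: bounded_degree_def intro!: quasisymmetric_relabelI)

lift_definition M_qsym :: "composition \<Rightarrow> qsym"
  is "\<lambda>\<alpha> m. if \<exists>is. sorted_wrt (<) is \<and> length is = length (parts \<alpha>)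
        \<and> power_monomial is (parts \<alpha>) = m then 1 else 0"
proof -
  fix \<alpha>
  let ?P = "\<lambda>m is. sorted_wrt (<) is \<and> length is = length (parts \<alpha>)
      \<and> power_monomial is (parts \<alpha>) = m"
  let ?f = "\<lambda>m. if \<exists>is. ?P m is then 1 else 0 :: rat"
  have pos: "\<forall>a\<in>set (parts \<alpha>). 0 < a" using parts by auto
  have "bounded_degree ?f"
    unfolding bounded_degree_def by (auto simp: total_degree_power)
  moreover have "quasisymmetric ?f"
  proof (rule quasisymmetric_relabelI)
    fix m :: monomial and h :: "nat \<Rightarrow> nat"
    assume h: "strict_mono_on (Poly_Mapping.keys m) h"
    have "?P (relabel h m) (List.map h is)" if "?P m is" for "is"
    proof -
      have "Poly_Mapping.keys m = set is" using that pos keys_power_monomial by blast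
      then show ?thesis
        using that h by (auto simp: sorted_wrt_map relabel_power strict_mono_on_def
            intro: sorted_wrt_mono_rel[rotated])
    qed
    then have imp: "(\<exists>is. ?P m is) \<longrightarrow> (\<exists>is. ?P (relabel h m) is)" by blast
    have "(P \<longrightarrow> Q) \<Longrightarrow> (if P then 1 else 0) \<le> (if Q then 1 else 0 :: rat)" for P Q
      by simp
    from this[OF imp] show "?f m \<le> ?f (relabel h m)" .
  qed
  ultimately show "bounded_degree ?f \<and> quasisymmetric ?f" ..
qed

lift_definition F_qsym :: "composition \<Rightarrow> qsym"
  is "\<lambda>\<alpha> m. of_nat (card {is. length is = sum_list (parts \<alpha>) \<and> sorted is
        \<and> (\<forall>j \<in> {sum_list (take k (parts \<alpha>)) | k. 1 \<le> k \<and> k < length (parts \<alpha>)}.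
              is ! (j - 1) < is ! j)
        \<and> word_monomial is = m})"
proof -
  fix \<alpha>
  let ?n = "sum_list (parts \<alpha>)"
  let ?D = "{sum_list (take k (parts \<alpha>)) | k. 1 \<le> k \<and> k < length (parts \<alpha>)}"
  let ?W = "\<lambda>m. {is. length is = ?n \<and> sorted is \<and> (\<forall>j\<in>?D. is ! (j - 1) < is ! j)
      \<and> word_monomial is = m}"
  let ?f = "\<lambda>m. of_nat (card (?W m)) :: rat"
  have D: "j < ?n" if "j \<in> ?D" for j
  proof -
    from that obtain k where k: "k < length (parts \<alpha>)" "j = sum_list (take k (parts \<alpha>))" by auto
    have "0 < parts \<alpha> ! k" using parts[of \<alpha>] k by auto
    moreover have "?n = j + parts \<alpha> ! k + sum_list (drop (Suc k) (parts \<alpha>))"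
      using k by (metis append.assoc id_take_nth_drop sum_list.Cons sum_list.append add.assoc)
    ultimately show ?thesis by simp
  qed
  have fin: "finite (?W m)" for m
    by (rule finite_subset[OF _ finite_lists_length_eq[of "Poly_Mapping.keys m" ?n]])
      (auto simp: keys_word_monomial)
  have "total_degree m \<le> ?n" if "?f m \<noteq> 0" for m
  proof -
    from that have "?W m \<noteq> {}" by (metis card.empty of_nat_0)
    then show ?thesis by (auto simp: total_degree_word)
  qed
  then have "bounded_degree ?f"
    unfolding bounded_degree_def by blast
  moreover have "quasisymmetric ?f"
  proof (rule quasisymmetric_relabelI)
    fix m :: monomial and h :: "nat \<Rightarrow> nat"
    assume h: "strict_mono_on (Poly_Mapping.keys m) h"
    have "List.map h is \<in> ?W (relabel h m)" if "is \<in> ?W m" for "is"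
    proof -
      have m: "Poly_Mapping.keys m = set is" using that keys_word_monomial by blast
      have "sorted (List.map h is)"
        using that h strict_mono_on_imp_mono_on[OF h] unfolding sorted_map m
        by (auto simp: mono_on_def intro: sorted_wrt_mono_rel[rotated])
      moreover have "List.map h is ! (j - 1) < List.map h is ! j" if j: "j \<in> ?D" for j
      proof -
        have "is ! (j - 1) < is ! j" "j < length is" 
          using j D[OF j] \<open>is \<in> ?W m\<close> by (blast, simp)
        then show ?thesis by (simp add: strict_mono_onD[OF h] m)
      qed
      ultimately show ?thesis using that by (simp add: relabel_word[symmetric])
    qed
    moreover have "inj_on (List.map h) (?W m)"
    proof (rule inj_on_subset[OF inj_on_mapI])
      show "inj_on h (\<Union> (set ` ?W m))"
        using strict_mono_on_imp_inj_on[OF h] by (rule inj_on_subset) (auto simp: keys_word_monomial)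
    qed auto
    ultimately have "card (?W m) \<le> card (?W (relabel h m))"
      using fin by (intro card_inj_on_le) auto
    then show "?f m \<le> ?f (relabel h m)" by simp
  qed
  ultimately show "bounded_degree ?f \<and> quasisymmetric ?f" ..
qed

text \<open>On the monomial basis the coproduct \<open>f(x) \<mapsto> f(x, y)\<close> is deconcatenation of compositions; it is
  determined by this, since the monomial quasisymmetric functions form a basis.\<close>

definition qsym_comult :: "qsym \<Rightarrow> (qsym, qsym) tensor"
  where "qsym_comult = (THE \<Delta>. qlinear \<Delta>
    \<and> (\<forall>\<alpha>. \<Delta> (M_qsym \<alpha>) = (\<Sum>(\<beta>, \<gamma>) | comp_append \<beta> \<gamma> = \<alpha>. M_qsym \<beta> \<otimes> M_qsym \<gamma>)))"

definition QSym :: "qsym bialgebra_ops"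
  where "QSym =
    \<lparr> mult = qsym_mult, unit = qsym_one, comult = qsym_comult, counit = (\<lambda>f. coeff_of f 0) \<rparr>"

lift_definition des_class_Comp :: "des_class \<Rightarrow> composition" is Comp
  by (simp add: Des_equiv_def Comp_def Comp_parts_def)

definition Des_to_QSym :: "(des_class \<Rightarrow>\<^sub>0 rat) \<Rightarrow> qsym"
  where "Des_to_QSym = linear_extension (\<lambda>c. F_qsym (des_class_Comp c))"

end

theory Submission
  imports Defs "HOL-Library.Product_Lexorder"
begin

text \<open>
  In the coefficients of its monomials, the coproduct of \<open>QSym\<close> is the substitution
  \<open>f(x) \<mapsto> f(x, y)\<close>, hence multiplicative; the antipode is found by recursion along deconcatenation
  of the monomial basis. So \<open>QSym\<close> is a Hopf algebra, and its structure can be transported along a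
  linear bijection that respects all operations.

  The linear map \<open>[\<pi>] \<mapsto> F\<^bsub>Comp(\<pi>)\<^esub>\<close> is bijective because the fundamental basis is unitriangular over
  the monomial one. It is multiplicative because \<open>F\<^bsub>Comp(\<pi>)\<^esub>\<close> enumerates the lexicographically
  increasing sequences of pairs with second components \<open>\<pi>\<^sub>1, \<dots>, \<pi>\<^sub>n\<close>, and merging two such sequences over
  disjoint permutations shuffles these permutations. Together with injectivity this also yields the
  shuffle-compatibility of \<open>Des\<close>, on which the product of \<open>H_Des\<close> relies.
\<close>

section \<open>Linear maps and tensor products\<close>

text \<open>Two obstacles shape the proof. The product of \<open>H_Des\<close> is a definite
  description, and all Hopf algebra axioms of \<open>H_Des\<close> belong to the claim. Checking
  them on descent classes would presuppose that this product is well defined, so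
  \<open>H_Des\<close> is treated as a bare record of operations and nothing is proved about it
  until the map to \<open>QSym\<close> is known to be bijective and compatible. On the other side,
  tensors form an abstract quotient, and the coproduct of \<open>QSym\<close> is prescribed on the
  monomial basis only. Equality of tensors is therefore tested by the functionals
  \<open>tensor_coeff a b\<close>. They separate tensors and evaluate a coproduct as one coefficient
  of the original series, so that identities of tensors become identities between sums over
  monomials. Fundamental functions are accessed through descent sets rather than refinement of
  compositions: a monomial has exactly one weakly increasing word, and a coefficient is the truth
  value of an inclusion of descent sets.\<close>

lemma qlinearD:
  assumes "qlinear f"
  shows "f (x + y) = f x + f y" "f (c *\<^sub>Q x) = c *\<^sub>Q f x" "f 0 = 0"
    "f (\<Sum>i\<in>I. g i) = (\<Sum>i\<in>I. f (g i))" "f (x - y) = f x - f y"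
proof -
  interpret f: Vector_Spaces.linear scaleQ scaleQ f by (fact assms)
  show "f (x + y) = f x + f y" "f (c *\<^sub>Q x) = c *\<^sub>Q f x" "f 0 = 0"
    "f (\<Sum>i\<in>I. g i) = (\<Sum>i\<in>I. f (g i))" "f (x - y) = f x - f y"
    by (simp_all add: f.add f.scale f.zero f.sum f.diff)
qed

lemma qlinear_id [simp]: "qlinear id" "qlinear (\<lambda>x. x)"
  by (simp_all add: qlinear_iff)

lemma qlinear_comp: "qlinear f \<Longrightarrow> qlinear g \<Longrightarrow> qlinear (\<lambda>x. f (g x))"
  by (simp add: qlinear_iff)

lemma qbilinear_iff:
  "qbilinear b \<longleftrightarrow> (\<forall>x x' y. b (x + x') y = b x y + b x' y) \<and> (\<forall>x y y'. b x (y + y') = b x y + b x y')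
    \<and> (\<forall>c x y. b (c *\<^sub>Q x) y = c *\<^sub>Q b x y) \<and> (\<forall>c x y. b x (c *\<^sub>Q y) = c *\<^sub>Q b x y)"
  unfolding qbilinear_def qlinear_iff by blast

lemma qbilinearD:
  assumes "qbilinear b"
  shows "b (x + x') y = b x y + b x' y" "b x (y + y') = b x y + b x y'"
    "b (c *\<^sub>Q x) y = c *\<^sub>Q b x y" "b x (c *\<^sub>Q y) = c *\<^sub>Q b x y"
  using assms unfolding qbilinear_iff by blast+

lemma qbilinear_comp:
  assumes "qbilinear b" "qlinear f" "qlinear g"
  shows "qbilinear (\<lambda>x y. b (f x) (g y))"
  by (simp add: qbilinear_iff qbilinearD[OF assms(1)] qlinearD[OF assms(2)] qlinearD[OF assms(3)])

lemma qlinear_qbilinear: "qlinear f \<Longrightarrow> qbilinear b \<Longrightarrow> qbilinear (\<lambda>x y. f (b x y))"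
  by (simp add: qbilinear_iff qlinear_iff)

lemma qbilinear_left: "qbilinear b \<Longrightarrow> qlinear (\<lambda>x. b x y)"
  and qbilinear_right: "qbilinear b \<Longrightarrow> qlinear (b x)"
  by (simp_all add: qbilinear_def)

lemma qbilinear_scaleQ: "qbilinear (scaleQ :: rat \<Rightarrow> 'a \<Rightarrow> 'a::rat_vector)"
  by (simp add: qbilinear_iff scaleQ_rat_def scaleQ_add_left scaleQ_add_right scaleQ_scaleQ mult.commute)

lemma qbilinear_swap: "qbilinear b \<Longrightarrow> qbilinear (\<lambda>x y. b y x)"
  by (simp add: qbilinear_iff)

lemma abs_tensor_eqI: "s - t \<in> tensor_relators \<Longrightarrow> abs_tensor s = abs_tensor t"
  by (simp add: tensor.abs_eq_iff tensor_equiv_def rat_vector.span_base)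

lemma qbilinear_pure_tensor: "qbilinear (\<otimes>)"
proof -
  \<comment> \<open>These are the four families of relators; \<open>diff_diff_eq\<close> rewrites a
    difference with a sum into their iterated form.\<close>
  have "abs_tensor (Poly_Mapping.single (x + x', y) 1)
      = abs_tensor (Poly_Mapping.single (x, y) 1 + Poly_Mapping.single (x', y) 1)"
    "abs_tensor (Poly_Mapping.single (x, y + y') 1)
      = abs_tensor (Poly_Mapping.single (x, y) 1 + Poly_Mapping.single (x, y') 1)"
    "abs_tensor (Poly_Mapping.single (c *\<^sub>Q x, y) 1) = abs_tensor (c *\<^sub>Q Poly_Mapping.single (x, y) 1)"
    "abs_tensor (Poly_Mapping.single (x, c *\<^sub>Q y) 1) = abs_tensor (c *\<^sub>Q Poly_Mapping.single (x, y) 1)"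
    for x x' :: 'a and y y' :: 'b and c
    by (rule abs_tensor_eqI; unfold tensor_relators_def diff_diff_eq[symmetric]; blast)+
  then show ?thesis
    by (simp add: qbilinear_iff pure_tensor.abs_eq plus_tensor.abs_eq scaleQ_tensor.abs_eq)
qed

lemma
  assumes "qbilinear b"
  shows qlinear_tensor_lift: "qlinear (tensor_lift b)"
    and tensor_lift_pure: "tensor_lift b (x \<otimes> y) = b x y"
proof -
  have "qlinear (tensor_lift b) \<and> (\<forall>x y. tensor_lift b (x \<otimes> y) = b x y)"
    unfolding tensor_lift_def by (rule theI'[OF tensor_ex1[OF assms]])
  then show "qlinear (tensor_lift b)" "tensor_lift b (x \<otimes> y) = b x y" by simp_all
qed

text \<open>The uniqueness half of the universal property; it replaces any induction over
  representatives.\<close>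

lemma tensor_eqI:
  assumes "qlinear f" "qlinear g" "\<And>x y. f (x \<otimes> y) = g (x \<otimes> y)"
  shows "f t = g t"
proof -
  have "qbilinear (\<lambda>x y. f (x \<otimes> y))"
    using assms(1) qbilinear_pure_tensor by (rule qlinear_qbilinear)
  from tensor_ex1[OF this] assms have "f = g" by metis
  then show ?thesis by simp
qed

lemma
  assumes "qlinear f" "qlinear g"
  shows qlinear_tensor_map: "qlinear (tensor_map f g)"
    and tensor_map_pure: "tensor_map f g (x \<otimes> y) = f x \<otimes> g y"
  using qbilinear_comp[OF qbilinear_pure_tensor assms] unfolding tensor_map_def
  by (simp_all add: qlinear_tensor_lift tensor_lift_pure)

lemma tensor_map_tensor_map:
  assumes "qlinear f" "qlinear g" "qlinear f'" "qlinear g'"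
  shows "tensor_map f' g' (tensor_map f g t) = tensor_map (\<lambda>x. f' (f x)) (\<lambda>x. g' (g x)) t"
proof (rule tensor_eqI[where t = t])
  have *: "qlinear (\<lambda>x. f' (f x))" "qlinear (\<lambda>x. g' (g x))"
    using assms by (auto intro: qlinear_comp)
  then show "qlinear (tensor_map (\<lambda>x. f' (f x)) (\<lambda>x. g' (g x)))"
    by (rule qlinear_tensor_map)
  show "qlinear (\<lambda>t. tensor_map f' g' (tensor_map f g t))"
    by (intro qlinear_comp[OF qlinear_tensor_map qlinear_tensor_map] assms)
  show "tensor_map f' g' (tensor_map f g (x \<otimes> y))
      = tensor_map (\<lambda>x. f' (f x)) (\<lambda>x. g' (g x)) (x \<otimes> y)" for x y
    using assms * by (simp add: tensor_map_pure)
qed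

lemma tensor_map_ident: "tensor_map (\<lambda>x. x) (\<lambda>x. x) t = t"
  by (rule tensor_eqI) (simp_all add: qlinear_tensor_map tensor_map_pure)

lemma tensor_lift_tensor_map:
  assumes "qbilinear b" "qlinear f" "qlinear g"
  shows "tensor_lift b (tensor_map f g t) = tensor_lift (\<lambda>x y. b (f x) (g y)) t"
proof (rule tensor_eqI[where t = t])
  note * = qbilinear_comp[OF assms]
  show "qlinear (tensor_lift (\<lambda>x y. b (f x) (g y)))" using * by (rule qlinear_tensor_lift)
  show "qlinear (\<lambda>t. tensor_lift b (tensor_map f g t))"
    by (intro qlinear_comp[OF qlinear_tensor_lift qlinear_tensor_map] assms)
  show "tensor_lift b (tensor_map f g (x \<otimes> y)) = tensor_lift (\<lambda>x y. b (f x) (g y)) (x \<otimes> y)" for x y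
    using assms * by (simp add: tensor_map_pure tensor_lift_pure)
qed

lemma linear_tensor_lift:
  assumes "qlinear f" "qbilinear b"
  shows "f (tensor_lift b t) = tensor_lift (\<lambda>x y. f (b x y)) t"
proof (rule tensor_eqI[where t = t])
  note * = qlinear_qbilinear[OF assms]
  show "qlinear (tensor_lift (\<lambda>x y. f (b x y)))" using * by (rule qlinear_tensor_lift)
  show "qlinear (\<lambda>t. f (tensor_lift b t))"
    by (intro qlinear_comp[OF _ qlinear_tensor_lift] assms)
  show "f (tensor_lift b (x \<otimes> y)) = tensor_lift (\<lambda>x y. f (b x y)) (x \<otimes> y)" for x y
    using assms * by (simp add: tensor_lift_pure)
qed

lemma tensor_lift_add:
  assumes "qbilinear b" "qbilinear b'"
  shows "tensor_lift (\<lambda>x y. b x y + b' x y) t = tensor_lift b t + tensor_lift b' t"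
proof (rule tensor_eqI[where t = t])
  have *: "qbilinear (\<lambda>x y. b x y + b' x y)"
    using qbilinearD[OF assms(1)] qbilinearD[OF assms(2)]
    by (simp add: qbilinear_iff rat_vector.scale_right_distrib)
  then show "qlinear (tensor_lift (\<lambda>x y. b x y + b' x y))" by (rule qlinear_tensor_lift)
  show "qlinear (\<lambda>t. tensor_lift b t + tensor_lift b' t)"
    using qlinear_tensor_lift[OF assms(1)] qlinear_tensor_lift[OF assms(2)]
    by (simp add: qlinear_iff rat_vector.scale_right_distrib)
  show "tensor_lift (\<lambda>x y. b x y + b' x y) (x \<otimes> y)
      = tensor_lift b (x \<otimes> y) + tensor_lift b' (x \<otimes> y)" for x y
    by (simp add: tensor_lift_pure * assms)
qed

lemma tensor_lift_scaleQ:
  assumes "qbilinear b"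
  shows "tensor_lift (\<lambda>x y. c *\<^sub>Q b x y) t = c *\<^sub>Q tensor_lift b t"
  using qbilinear_scaleQ assms by (intro linear_tensor_lift[symmetric] qbilinear_right)

text \<open>\<open>tensor_lift\<close> is linear in the lifted form as well as in the tensor, so
  linearity in outer parameters passes through it. This is what the nested lifts of
  \<open>tensor_mult\<close> require.\<close>

lemma qbilinear_tensor_lift_param:
  assumes "\<And>x y. qbilinear (b x y)" "\<And>z w. qbilinear (\<lambda>x y. b x y z w)"
  shows "qbilinear (\<lambda>x y. tensor_lift (b x y) t)"
proof -
  have "b (x + x') y = (\<lambda>z w. b x y z w + b x' y z w)" "b x (y + y') = (\<lambda>z w. b x y z w + b x y' z w)"
    "b (c *\<^sub>Q x) y = (\<lambda>z w. c *\<^sub>Q b x y z w)" "b x (c *\<^sub>Q y) = (\<lambda>z w. c *\<^sub>Q b x y z w)" for x x' y y' c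
    by (intro ext; fact qbilinearD[OF assms(2)])+
  then show ?thesis
    by (auto simp: qbilinear_iff intro!: tensor_lift_add tensor_lift_scaleQ assms(1))
qed

lemma qbilinear_tensor_lift_tensor_lift:
  assumes "\<And>x y. qbilinear (b x y)" "\<And>z w. qbilinear (\<lambda>x y. b x y z w)"
  shows "qbilinear (\<lambda>s t. tensor_lift (\<lambda>x y. tensor_lift (b x y) t) s)"
proof -
  note lin = qlinearD[OF qlinear_tensor_lift[OF qbilinear_tensor_lift_param[of b, OF assms]]]
    qlinearD[OF qlinear_tensor_lift[OF assms(1)]]
  show ?thesis
    by (auto simp: qbilinear_iff lin
        intro!: tensor_lift_add tensor_lift_scaleQ qbilinear_tensor_lift_param assms)
qed

lemma qbilinear_tensor_mult:
  assumes "qbilinear (mult A)"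
  shows "qbilinear (tensor_mult A)"
  unfolding tensor_mult_def
proof (rule qbilinear_tensor_lift_tensor_lift)
  show "qbilinear (\<lambda>c d. mult A a c \<otimes> mult A b d)" for a b
    by (rule qbilinear_comp[OF qbilinear_pure_tensor]) (intro qbilinear_right assms)+
  show "qbilinear (\<lambda>a b. mult A a c \<otimes> mult A b d)" for c d
    by (rule qbilinear_comp[OF qbilinear_pure_tensor]) (intro qbilinear_left assms)+
qed

lemma tensor_mult_pure:
  assumes "qbilinear (mult A)"
  shows "tensor_mult A (a \<otimes> b) (c \<otimes> d) = mult A a c \<otimes> mult A b d"
proof -
  have 1: "qbilinear (\<lambda>c d. mult A a c \<otimes> mult A b d)" for a b
    by (rule qbilinear_comp[OF qbilinear_pure_tensor]) (intro qbilinear_right assms)+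
  have 2: "qbilinear (\<lambda>a b. mult A a c \<otimes> mult A b d)" for c d
    by (rule qbilinear_comp[OF qbilinear_pure_tensor]) (intro qbilinear_left assms)+
  show ?thesis
    unfolding tensor_mult_def
    by (subst tensor_lift_pure[OF qbilinear_tensor_lift_param[OF 1 2]]) (rule tensor_lift_pure[OF 1])
qed

lemma tensor_eqI2:
  assumes "qbilinear f" "qbilinear g" "\<And>x y z w. f (x \<otimes> y) (z \<otimes> w) = g (x \<otimes> y) (z \<otimes> w)"
  shows "f s t = g s t"
proof (rule tensor_eqI[where t = s])
  show "f (x \<otimes> y) t = g (x \<otimes> y) t" for x y
    by (rule tensor_eqI[where t = t]) (use assms in \<open>simp_all add: qbilinear_def\<close>)
qed (use assms in \<open>simp_all add: qbilinear_def\<close>)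

lemma
  fixes x :: "'a::rat_vector" and y :: "'b::rat_vector" and z :: "'c::rat_vector"
  shows qlinear_tensor_assoc: "qlinear (tensor_assoc :: (('a, 'b) tensor, 'c) tensor \<Rightarrow> _)"
    and tensor_assoc_pure: "tensor_assoc ((x \<otimes> y) \<otimes> z) = x \<otimes> (y \<otimes> z)"
proof -
  have b: "qbilinear (\<lambda>(x::'a) (y::'b). x \<otimes> (y \<otimes> z))" for z :: 'c
    by (rule qbilinear_comp[OF qbilinear_pure_tensor]) (simp, intro qbilinear_left qbilinear_pure_tensor)
  \<comment> \<open>Linearity in \<open>z\<close> is stated between functions because
    \<open>z\<close> occurs inside the form being lifted.\<close>
  have eq: "(\<lambda>(x::'a) (y::'b). x \<otimes> (y \<otimes> (z + w))) = (\<lambda>x y. x \<otimes> (y \<otimes> z) + x \<otimes> (y \<otimes> w))"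
    "(\<lambda>(x::'a) (y::'b). x \<otimes> (y \<otimes> (c *\<^sub>Q z))) = (\<lambda>x y. c *\<^sub>Q (x \<otimes> (y \<otimes> z)))" for z w :: 'c and c
    by (simp_all add: qbilinearD[OF qbilinear_pure_tensor])
  have "qbilinear (\<lambda>t (z::'c). tensor_lift (\<lambda>(x::'a) (y::'b). x \<otimes> (y \<otimes> z)) t)"
    unfolding qbilinear_iff eq
    by (auto simp: qlinearD[OF qlinear_tensor_lift[OF b]] intro!: tensor_lift_add tensor_lift_scaleQ b)
  then show "qlinear (tensor_assoc :: (('a, 'b) tensor, 'c) tensor \<Rightarrow> _)" "tensor_assoc ((x \<otimes> y) \<otimes> z) = x \<otimes> (y \<otimes> z)"
    unfolding tensor_assoc_def by (simp_all add: qlinear_tensor_lift tensor_lift_pure b)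
qed

lemma tensor_assoc_natural:
  assumes "qlinear f" "qlinear g" "qlinear h"
  shows "tensor_assoc (tensor_map (tensor_map f g) h t) = tensor_map f (tensor_map g h) (tensor_assoc t)"
proof -
  note lin = qlinear_tensor_assoc qlinear_tensor_map assms
  have lin': "qlinear (\<lambda>t. tensor_assoc (tensor_map (tensor_map f g) h t))"
    "qlinear (\<lambda>t. tensor_map f (tensor_map g h) (tensor_assoc t))"
    by (rule qlinear_comp[of tensor_assoc], simp_all add: lin)
      (rule qlinear_comp[of "tensor_map f (tensor_map g h)"], simp_all add: lin)
  have "tensor_assoc (tensor_map (tensor_map f g) h (s \<otimes> z))
      = tensor_map f (tensor_map g h) (tensor_assoc (s \<otimes> z))" for s z
  proof (rule tensor_eqI[where t = s])
    have "qlinear (\<lambda>s. s \<otimes> z)" by (rule qbilinear_left[OF qbilinear_pure_tensor])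
    then show "qlinear (\<lambda>s. tensor_assoc (tensor_map (tensor_map f g) h (s \<otimes> z)))"
      "qlinear (\<lambda>s. tensor_map f (tensor_map g h) (tensor_assoc (s \<otimes> z)))"
      using lin' by (auto intro: qlinear_comp)
  qed (simp add: tensor_map_pure tensor_assoc_pure lin)
  then show ?thesis
    by (rule tensor_eqI[OF lin'])
qed

text \<open>The tensor product of the inverse maps, which are again linear, is a left
  inverse.\<close>

lemma inj_tensor_map:
  assumes "qlinear f" "bij f" "qlinear g" "bij g"
  shows "inj (tensor_map f g)"
proof (rule injI)
  have inv: "qlinear (inv f)" if "qlinear f" "bij f" for f :: "'x::rat_vector \<Rightarrow> 'y::rat_vector"
    unfolding qlinear_iff
    using that by (auto simp: qlinearD bij_is_surj surj_f_inv_f intro!: inv_f_eq[OF bij_is_inj])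
  have "tensor_map (inv f) (inv g) (tensor_map f g t) = t" for t
    using assms by (simp add: tensor_map_tensor_map inv bij_is_inj tensor_map_ident)
  then show "tensor_map f g s = tensor_map f g t \<Longrightarrow> s = t" for s t by metis
qed

section \<open>Antipodes and transport of Hopf algebra structure\<close>

text \<open>In the convolution algebra, a left inverse S and a right inverse T of the identity
  agree: S = S * (id * T) = (S * id) * T = T. This gives uniqueness of the antipode, and it also
  merges two one-sided inverses built separately.\<close>

lemma (in bialgebra) left_right_antipode_eq:
  assumes S: "qlinear S" and T: "qlinear T"
    and left: "\<And>x. tensor_lift (\<lambda>a b. mult A (S a) b) (comult A x) = counit A x *\<^sub>Q unit A"
    and right: "\<And>x. tensor_lift (\<lambda>a b. mult A a (T b)) (comult A x) = counit A x *\<^sub>Q unit A"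
  shows "S = T"
proof
  fix x
  note bil = mult_bilinear
  have bl: "qbilinear (\<lambda>a b. mult A (S a) b)" using bil S by (rule qbilinear_comp) simp
  have br: "qbilinear (\<lambda>a b. mult A a (T b))" by (rule qbilinear_comp[OF bil _ T]) simp
  let ?L = "tensor_lift (\<lambda>a b. mult A (S a) b)" and ?R = "tensor_lift (\<lambda>a b. mult A a (T b))"
  let ?g = "\<lambda>a u. mult A (S a) (?R u)" and ?h = "\<lambda>v c. mult A (?L v) (T c)"
  have bg: "qbilinear ?g" using bil S qlinear_tensor_lift[OF br] by (rule qbilinear_comp)
  have bh: "qbilinear ?h" using bil qlinear_tensor_lift[OF bl] T by (rule qbilinear_comp)
  \<comment> \<open>Associativity of convolution: on a pure triple tensor both sides multiply
    \<open>S a\<close>, \<open>b\<close> and \<open>T c\<close>, with different brackets.\<close>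
  have assoc: "tensor_lift ?g (tensor_assoc u) = tensor_lift ?h u" for u
  proof (rule tensor_eqI[where t = u])
    show lg: "qlinear (\<lambda>u. tensor_lift ?g (tensor_assoc u))"
      by (rule qlinear_comp[OF qlinear_tensor_lift[OF bg] qlinear_tensor_assoc])
    show lh: "qlinear (tensor_lift ?h)" by (rule qlinear_tensor_lift[OF bh])
    show "tensor_lift ?g (tensor_assoc (s \<otimes> c)) = tensor_lift ?h (s \<otimes> c)" for s c
    proof (rule tensor_eqI[where t = s])
      have l: "qlinear (\<lambda>s. s \<otimes> c)" by (rule qbilinear_left[OF qbilinear_pure_tensor])
      from qlinear_comp[OF lg this] show "qlinear (\<lambda>s. tensor_lift ?g (tensor_assoc (s \<otimes> c)))" .
      from qlinear_comp[OF lh l] show "qlinear (\<lambda>s. tensor_lift ?h (s \<otimes> c))" .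
      show "tensor_lift ?g (tensor_assoc ((a \<otimes> b) \<otimes> c)) = tensor_lift ?h ((a \<otimes> b) \<otimes> c)" for a b
        by (simp add: tensor_assoc_pure tensor_lift_pure bg bh bl br mult_assoc)
    qed
  qed
  have bc: "qbilinear (\<lambda>a b. counit A b *\<^sub>Q a)" "qbilinear (\<lambda>a b. counit A a *\<^sub>Q b)"
    by (rule qbilinear_swap[OF qbilinear_comp[OF qbilinear_scaleQ counit_linear qlinear_id(2)]])
      (rule qbilinear_comp[OF qbilinear_scaleQ counit_linear qlinear_id(2)])
  have "S x = S (tensor_lift (\<lambda>a b. counit A b *\<^sub>Q a) (comult A x))"
    by (simp add: counit_right)
  also have "\<dots> = tensor_lift (\<lambda>a b. ?g a (comult A b)) (comult A x)"
    by (simp add: linear_tensor_lift[OF S bc(1)] right qbilinearD[OF bil] unit_right qlinearD(2)[OF S])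
  also have "\<dots> = tensor_lift ?g (tensor_map id (comult A) (comult A x))"
    by (simp add: tensor_lift_tensor_map[OF bg qlinear_id(1) comult_linear])
  also have "\<dots> = tensor_lift ?h (tensor_map (comult A) id (comult A x))"
    by (simp flip: coassoc add: assoc)
  also have "\<dots> = tensor_lift (\<lambda>a b. ?h (comult A a) b) (comult A x)"
    by (simp add: tensor_lift_tensor_map[OF bh comult_linear qlinear_id(1)])
  also have "\<dots> = T (tensor_lift (\<lambda>a b. counit A a *\<^sub>Q b) (comult A x))"
    by (simp add: linear_tensor_lift[OF T bc(2)] left qbilinearD[OF bil] unit_left qlinearD(2)[OF T])
  also have "\<dots> = T x" by (simp add: counit_left)
  finally show "S x = T x" .
qed

lemma (in bialgebra) antipode_eqI:
  assumes "is_antipode A S"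
  shows "antipode A = S"
  unfolding antipode_def
proof (rule the_equality)
  show "is_antipode A T \<Longrightarrow> T = S" for T
    using assms by (intro left_right_antipode_eq) (simp_all add: is_antipode_def)
qed (fact assms)

text \<open>Each axiom of \<open>A\<close> either concerns scalars or can be tested after applying
  \<open>\<phi>\<close>, its tensor square or its threefold analogue, all of which are injective.
  The antipode of \<open>A\<close> is that of \<open>B\<close> conjugated by
  \<open>\<phi>\<close>.\<close>

lemma hopf_algebra_isoI:
  fixes A :: "'a::rat_vector bialgebra_ops" and B :: "'b::rat_vector bialgebra_ops"
  assumes B: "hopf_algebra B" and lin: "qlinear \<phi>" and bij: "bij \<phi>"
    and hmult: "\<And>x y. \<phi> (mult A x y) = mult B (\<phi> x) (\<phi> y)"
    and hunit: "\<phi> (unit A) = unit B"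
    and hcomult: "\<And>x. comult B (\<phi> x) = tensor_map \<phi> \<phi> (comult A x)"
    and hcounit: "\<And>x. counit B (\<phi> x) = counit A x"
  shows "hopf_algebra_iso A B \<phi>"
proof -
  interpret B: hopf_algebra B by (fact B)
  let ?\<phi>\<phi> = "tensor_map \<phi> \<phi>"
  have inj: "\<phi> x = \<phi> y \<longleftrightarrow> x = y" for x y using bij by (simp add: bij_is_inj inj_eq)
  have lin2: "qlinear ?\<phi>\<phi>" using lin lin by (rule qlinear_tensor_map)
  have inj2: "?\<phi>\<phi> s = ?\<phi>\<phi> t \<longleftrightarrow> s = t" for s t using inj_tensor_map[OF lin bij lin bij] by (simp add: inj_eq)
  have surj: "\<phi> (inv \<phi> y) = y" and inv: "inv \<phi> (\<phi> x) = x" for x y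
    using bij by (simp_all add: bij_is_surj bij_is_inj surj_f_inv_f)
  have lin_inv: "qlinear (inv \<phi>)"
    unfolding qlinear_iff by (simp add: surj qlinearD[OF lin] flip: inj)
  \<comment> \<open>Coassociativity is an identity between threefold tensors. The left inverse is
    assembled from \<open>inv \<phi>\<close>, since only injectivity of \<open>?\<phi>\<phi>\<close>
    has been recorded.\<close>
  have inj3: "s = t" if "tensor_map \<phi> ?\<phi>\<phi> s = tensor_map \<phi> ?\<phi>\<phi> t" for s t
  proof -
    let ?i = "tensor_map (inv \<phi>) (inv \<phi>)"
    have "?i (?\<phi>\<phi> u) = u" for u
      by (simp add: tensor_map_tensor_map lin lin_inv inv tensor_map_ident)
    then have "tensor_map (inv \<phi>) ?i (tensor_map \<phi> ?\<phi>\<phi> s) = s" for s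
      by (simp add: tensor_map_tensor_map lin lin_inv lin2 qlinear_tensor_map inv tensor_map_ident)
    then show ?thesis using that by metis
  qed
  have bil: "qbilinear (mult A)"
    unfolding qbilinear_iff
    by (simp add: hmult qlinearD[OF lin] qbilinearD[OF B.mult_bilinear] flip: inj)
  have colin: "qlinear (comult A)"
    unfolding qlinear_iff
    by (simp add: qlinearD[OF lin] qlinearD[OF lin2] qlinearD[OF B.comult_linear] flip: inj2 hcomult)
  have counitlin: "qlinear (counit A)"
    unfolding qlinear_iff
    by (simp add: qlinearD[OF lin] qlinearD[OF B.counit_linear] flip: hcounit)
  have bc: "qbilinear (\<lambda>a b. counit C b *\<^sub>Q a)" "qbilinear (\<lambda>a b. counit C a *\<^sub>Q b)"
    if "qlinear (counit C)" for C :: "'c::rat_vector bialgebra_ops"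
    by (rule qbilinear_swap[OF qbilinear_comp[OF qbilinear_scaleQ that qlinear_id(2)]])
      (rule qbilinear_comp[OF qbilinear_scaleQ that qlinear_id(2)])
  have tm: "?\<phi>\<phi> (tensor_mult A s t) = tensor_mult B (?\<phi>\<phi> s) (?\<phi>\<phi> t)" for s t
  proof (rule tensor_eqI2[where s = s and t = t])
    show "qbilinear (\<lambda>s t. ?\<phi>\<phi> (tensor_mult A s t))"
      by (rule qlinear_qbilinear[OF lin2 qbilinear_tensor_mult[OF bil]])
    show "qbilinear (\<lambda>s t. tensor_mult B (?\<phi>\<phi> s) (?\<phi>\<phi> t))"
      by (rule qbilinear_comp[OF qbilinear_tensor_mult[OF B.mult_bilinear] lin2 lin2])
  qed (simp add: tensor_mult_pure bil B.mult_bilinear tensor_map_pure lin hmult)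
  interpret A: bialgebra A
  proof (rule bialgebra.intro)
    fix x y z
    show "mult A (mult A x y) z = mult A x (mult A y z)"
      by (simp add: hmult B.mult_assoc flip: inj)
    show "mult A (unit A) x = x" "mult A x (unit A) = x"
      by (simp_all add: hmult hunit B.unit_left B.unit_right flip: inj)
    have "tensor_map \<phi> ?\<phi>\<phi> (tensor_assoc (tensor_map (comult A) id (comult A x)))
        = tensor_assoc (tensor_map (\<lambda>x. comult B (\<phi> x)) \<phi> (comult A x))"
      by (simp add: tensor_assoc_natural[symmetric] lin tensor_map_tensor_map colin lin2 hcomult)
    also have "\<dots> = tensor_assoc (tensor_map (comult B) id (comult B (\<phi> x)))"
      by (simp add: hcomult[of x] tensor_map_tensor_map lin B.comult_linear)
    also have "\<dots> = tensor_map id (comult B) (comult B (\<phi> x))"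
      by (rule B.coassoc)
    also have "\<dots> = tensor_map \<phi> (\<lambda>x. comult B (\<phi> x)) (comult A x)"
      by (simp add: hcomult[of x] tensor_map_tensor_map lin B.comult_linear)
    also have "\<dots> = tensor_map \<phi> ?\<phi>\<phi> (tensor_map id (comult A) (comult A x))"
      by (simp add: lin tensor_map_tensor_map colin lin2 hcomult)
    finally show "tensor_assoc (tensor_map (comult A) id (comult A x))
        = tensor_map id (comult A) (comult A x)"
      by (rule inj3)
    have "\<phi> (tensor_lift (\<lambda>a b. counit A a *\<^sub>Q b) (comult A x))
        = tensor_lift (\<lambda>a b. counit B a *\<^sub>Q b) (comult B (\<phi> x))"
      by (simp add: linear_tensor_lift[OF lin bc(2)[OF counitlin]] hcomult
          tensor_lift_tensor_map[OF bc(2)[OF B.counit_linear] lin lin] hcounit qlinearD(2)[OF lin])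
    then show "tensor_lift (\<lambda>a b. counit A a *\<^sub>Q b) (comult A x) = x"
      by (simp add: B.counit_left inj)
    have "\<phi> (tensor_lift (\<lambda>a b. counit A b *\<^sub>Q a) (comult A x))
        = tensor_lift (\<lambda>a b. counit B b *\<^sub>Q a) (comult B (\<phi> x))"
      by (simp add: linear_tensor_lift[OF lin bc(1)[OF counitlin]] hcomult
          tensor_lift_tensor_map[OF bc(1)[OF B.counit_linear] lin lin] hcounit qlinearD(2)[OF lin])
    then show "tensor_lift (\<lambda>a b. counit A b *\<^sub>Q a) (comult A x) = x"
      by (simp add: B.counit_right inj)
    show "comult A (mult A x y) = tensor_mult A (comult A x) (comult A y)"
      by (simp add: tm hmult B.comult_mult flip: inj2 hcomult)
    show "comult A (unit A) = unit A \<otimes> unit A"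
      by (simp add: hunit B.comult_unit tensor_map_pure lin flip: inj2 hcomult)
    show "counit A (mult A x y) = counit A x * counit A y"
      by (simp add: hmult B.counit_mult flip: hcounit)
    show "counit A (unit A) = 1"
      by (simp add: hunit B.counit_unit flip: hcounit)
  qed (fact bil colin counitlin)+
  obtain S where S: "is_antipode B S" using B.ex_antipode by blast
  then have linS: "qlinear S" by (simp add: is_antipode_def)
  define S' where "S' x = inv \<phi> (S (\<phi> x))" for x
  have linS': "qlinear S'"
    using qlinear_comp[OF lin_inv qlinear_comp[OF linS lin]] by (simp add: S'_def[abs_def])
  have bl: "qbilinear (\<lambda>a b. mult C (S a) b)" and br: "qbilinear (\<lambda>a b. mult C a (S b))"
    if "qbilinear (mult C)" "qlinear S" for C :: "'c::rat_vector bialgebra_ops" and S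
    by (rule qbilinear_comp[OF that qlinear_id(2)]) (rule qbilinear_comp[OF that(1) qlinear_id(2) that(2)])
  have "is_antipode A S'"
    unfolding is_antipode_def
  proof (intro conjI allI linS')
    fix x
    have "\<phi> (tensor_lift (\<lambda>a b. mult A (S' a) b) (comult A x))
        = tensor_lift (\<lambda>a b. mult B (S a) b) (comult B (\<phi> x))"
      by (subst linear_tensor_lift[OF lin bl[OF bil linS']]) (simp add: hcomult hmult S'_def surj
          tensor_lift_tensor_map[OF bl[OF B.mult_bilinear linS] lin lin])
    then show "tensor_lift (\<lambda>a b. mult A (S' a) b) (comult A x) = counit A x *\<^sub>Q unit A"
      using S by (simp add: is_antipode_def hcounit qlinearD(2)[OF lin] hunit flip: inj)
    have "\<phi> (tensor_lift (\<lambda>a b. mult A a (S' b)) (comult A x))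
        = tensor_lift (\<lambda>a b. mult B a (S b)) (comult B (\<phi> x))"
      by (subst linear_tensor_lift[OF lin br[OF bil linS']]) (simp add: hcomult hmult S'_def surj
          tensor_lift_tensor_map[OF br[OF B.mult_bilinear linS] lin lin])
    then show "tensor_lift (\<lambda>a b. mult A a (S' b)) (comult A x) = counit A x *\<^sub>Q unit A"
      using S by (simp add: is_antipode_def hcounit qlinearD(2)[OF lin] hunit flip: inj)
  qed
  then have "antipode A = S'" "hopf_algebra A"
    by (rule A.antipode_eqI) (use \<open>is_antipode A S'\<close> in unfold_locales, blast)
  moreover have "antipode B = S" using S by (rule B.antipode_eqI)
  ultimately show ?thesis
    using lin hmult hunit hcomult hcounit bij
    by (simp add: hopf_algebra_iso_def hopf_algebra_iso_axioms_def hopf_algebra_hom_def B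
        hopf_algebra_hom_axioms_def S'_def surj)
qed

section \<open>Free vector spaces\<close>

lemma linear_extension_add: "linear_extension (\<lambda>k. b k + b' k) v = linear_extension b v + linear_extension b' v"
  by (simp add: linear_extension_def scaleQ_add_right sum.distrib)

lemma linear_extension_scaleQ: "linear_extension (\<lambda>k. c *\<^sub>Q b k) v = c *\<^sub>Q linear_extension b v"
  by (simp add: linear_extension_def rat_vector.scale_sum_right scaleQ_scaleQ mult.commute)

lemma qbilinear_linear_extension:
  "qbilinear (\<lambda>v w. linear_extension (\<lambda>c. linear_extension (h c) w) v)"
  by (simp add: qbilinear_iff qlinearD[OF qlinear_linear_extension] linear_extension_add
      linear_extension_scaleQ)

lemma free_linear_eqI:
  fixes v :: "'k \<Rightarrow>\<^sub>0 rat"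
  assumes "qlinear f" "qlinear g" "\<And>k. f (Poly_Mapping.single k 1) = g (Poly_Mapping.single k 1)"
  shows "f v = g v"
  by (subst (1 2) qlinear_eq_linear_extension, fact, fact, simp only: assms(3))

lemma linear_linear_extension:
  "qlinear f \<Longrightarrow> f (linear_extension b v) = linear_extension (\<lambda>k. f (b k)) v"
  by (simp add: linear_extension_def qlinearD(2,4))

section \<open>Monomials and compositions\<close>

text \<open>The nonzero exponents in the order of the variables. It indexes the one monomial
  quasisymmetric function in which \<open>m\<close> occurs.\<close>

definition comp_of :: "monomial \<Rightarrow> composition"
  where "comp_of m
    = Composition (List.map (Poly_Mapping.lookup m) (sorted_list_of_set (Poly_Mapping.keys m)))"

lemma parts_comp_of:
  "parts (comp_of m) = List.map (Poly_Mapping.lookup m) (sorted_list_of_set (Poly_Mapping.keys m))"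
  unfolding comp_of_def by (rule Composition_inverse) (auto simp: in_keys_iff)

lemma parts_pos: "a \<in> set (parts \<alpha>) \<Longrightarrow> 0 < a"
  using parts[of \<alpha>] by auto

lemma power_monomial_comp_of:
  "power_monomial (sorted_list_of_set (Poly_Mapping.keys m)) (parts (comp_of m)) = m"
proof -
  have "power_monomial xs (List.map (Poly_Mapping.lookup m) xs)
      = (\<Sum>i\<leftarrow>xs. Poly_Mapping.single i (Poly_Mapping.lookup m i))" for xs
    by (induction xs) auto
  then show ?thesis
    by (simp add: parts_comp_of sum_list_distinct_conv_sum_set sum_single_lookup)
qed

lemma lookup_power_monomial:
  "distinct is \<Longrightarrow> length is = length as
    \<Longrightarrow> List.map (Poly_Mapping.lookup (power_monomial is as)) is = as"
proof (induction "is" as rule: list_induct2')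
  case (4 i "is" a as)
  have "Poly_Mapping.lookup (power_monomial is as) i = 0"
    using 4(2) keys_power_monomial_subset[of "is" as] by (auto simp: in_keys_iff)
  moreover have "List.map (Poly_Mapping.lookup (power_monomial (i # is) (a # as))) is
      = List.map (Poly_Mapping.lookup (power_monomial is as)) is"
    using 4(2) by (auto simp: lookup_add lookup_single when_def)
  ultimately show ?case using 4 by (simp add: lookup_add[of _ _ i] del: map_eq_conv)
qed simp_all

lemma comp_of_power_monomial:
  assumes "sorted_wrt (<) is" "length is = length (parts \<alpha>)"
  shows "comp_of (power_monomial is (parts \<alpha>)) = \<alpha>"
proof -
  have d: "sorted is" "distinct is" using assms(1) by (simp_all add: strict_sorted_iff)
  have "Poly_Mapping.keys (power_monomial is (parts \<alpha>)) = set is"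
    using assms(2) parts_pos by (simp add: keys_power_monomial)
  then show ?thesis
    using d assms(2)
    by (simp add: comp_of_def sorted_list_of_set.idem_if_sorted_distinct lookup_power_monomial parts_inverse)
qed

text \<open>The packed representative among the monomials with composition \<open>\<alpha>\<close>.
  The coefficient there serves as the coordinate at \<open>M_qsym \<alpha>\<close>.\<close>

definition std_monomial :: "composition \<Rightarrow> monomial"
  where "std_monomial \<alpha> = power_monomial [0..<length (parts \<alpha>)] (parts \<alpha>)"

lemma comp_of_std_monomial [simp]: "comp_of (std_monomial \<alpha>) = \<alpha>"
  unfolding std_monomial_def by (rule comp_of_power_monomial) simp_all

lemma total_degree_comp_of: "total_degree m = sum_list (parts (comp_of m))"
  by (metis length_map parts_comp_of power_monomial_comp_of total_degree_power)

text \<open>The working form of quasisymmetry: a series is determined by its values at packed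
  monomials.\<close>

lemma coeff_of_comp_of: "coeff_of f m = coeff_of f (std_monomial (comp_of m))"
proof -
  have "coeff_of f (power_monomial (sorted_list_of_set (Poly_Mapping.keys m)) (parts (comp_of m)))
    = coeff_of f (std_monomial (comp_of m))"
    unfolding std_monomial_def using coeff_of[of f]
    by (intro quasisymmetricD) (auto simp: parts_comp_of)
  then show ?thesis by (simp add: power_monomial_comp_of)
qed

lemma coeff_of_M_qsym: "coeff_of (M_qsym \<alpha>) m = (if comp_of m = \<alpha> then 1 else 0)"
proof -
  have "(\<exists>is. sorted_wrt (<) is \<and> length is = length (parts \<alpha>) \<and> power_monomial is (parts \<alpha>) = m)
      \<longleftrightarrow> comp_of m = \<alpha>"
    using comp_of_power_monomial power_monomial_comp_of[of m]
    by (auto intro!: exI[of _ "sorted_list_of_set (Poly_Mapping.keys m)"] simp: parts_comp_of)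
  then show ?thesis by (simp add: M_qsym.rep_eq)
qed

lemma comp_of_zero [simp]: "comp_of 0 = Composition []"
  by (simp add: comp_of_def)

lemma parts_eq_Nil_iff: "parts \<alpha> = [] \<longleftrightarrow> \<alpha> = Composition []"
  using Composition_inverse[of "[]"] by (auto simp flip: parts_inject)

lemma comp_of_eq_Nil_iff [simp]: "comp_of m = Composition [] \<longleftrightarrow> m = 0"
  using power_monomial_comp_of[of m] by (metis comp_of_zero parts_eq_Nil_iff power_monomial_simps(2))

section \<open>The vector space of quasisymmetric functions\<close>

lemma qsym_eqI: "(\<And>m. coeff_of f m = coeff_of g m) \<Longrightarrow> f = g"
  by (simp add: coeff_of_inject[symmetric] fun_eq_iff)

lemma qlinear_coeff_of: "qlinear (\<lambda>f. coeff_of f m)"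
  unfolding qlinear_iff by (simp add: plus_qsym.rep_eq scaleQ_qsym.rep_eq scaleQ_rat_def)

lemma coeff_of_simps:
  "coeff_of 0 m = 0" "coeff_of (f + g) m = coeff_of f m + coeff_of g m"
  "coeff_of (c *\<^sub>Q f) m = c * coeff_of f m" "coeff_of (\<Sum>i\<in>I. h i) m = (\<Sum>i\<in>I. coeff_of (h i) m)"
  using qlinearD(3,4)[OF qlinear_coeff_of] by (simp_all add: plus_qsym.rep_eq scaleQ_qsym.rep_eq)

text \<open>Positive parts bound the length by the sum. Bounded degree thereby becomes finite
  support on the monomial basis, and expansions of \<open>F_qsym\<close> become finite sums.\<close>

lemma finite_bounded_compositions: "finite {\<alpha>. sum_list (parts \<alpha>) \<le> d}"
proof (rule finite_subset)
  show "finite (Composition ` {xs. set xs \<subseteq> {..d} \<and> length xs \<le> d})"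
    by (intro finite_imageI finite_lists_length_le) simp
  have len: "length xs \<le> sum_list xs" if "\<forall>a\<in>set xs. 0 < a" for xs :: "nat list"
    using that by (induction xs) auto
  show "{\<alpha>. sum_list (parts \<alpha>) \<le> d} \<subseteq> Composition ` {xs. set xs \<subseteq> {..d} \<and> length xs \<le> d}"
  proof
    fix \<alpha> assume "\<alpha> \<in> {\<alpha>. sum_list (parts \<alpha>) \<le> d}"
    then have "set (parts \<alpha>) \<subseteq> {..d}" "length (parts \<alpha>) \<le> d"
      using member_le_sum_list[of _ "parts \<alpha>"] len[of "parts \<alpha>"] parts_pos[of _ \<alpha>]
      by (auto intro: order_trans)
    then show "\<alpha> \<in> Composition ` {xs. set xs \<subseteq> {..d} \<and> length xs \<le> d}"
      by (intro image_eqI[of _ _ "parts \<alpha>"]) (auto simp: parts_inverse)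
  qed
qed

lift_definition M_coords :: "qsym \<Rightarrow> composition \<Rightarrow>\<^sub>0 rat" is "\<lambda>f \<alpha>. f (std_monomial \<alpha>)"
proof -
  fix f :: "monomial \<Rightarrow> rat" assume "bounded_degree f \<and> quasisymmetric f"
  then obtain d where "\<And>m. f m \<noteq> 0 \<Longrightarrow> total_degree m \<le> d" unfolding bounded_degree_def by blast
  then have "{\<alpha>. f (std_monomial \<alpha>) \<noteq> 0} \<subseteq> {\<alpha>. sum_list (parts \<alpha>) \<le> d}"
    by (force simp: total_degree_comp_of)
  then show "finite {\<alpha>. f (std_monomial \<alpha>) \<noteq> 0}"
    using finite_bounded_compositions by (rule finite_subset)
qed

lemma qlinear_M_coords: "qlinear M_coords"
  unfolding qlinear_iff
  by (auto intro!: poly_mapping_eqI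
      simp: M_coords.rep_eq lookup_add lookup_scaleQ coeff_of_simps scaleQ_rat_def)

lemma M_coords_M_qsym [simp]: "M_coords (M_qsym \<alpha>) = Poly_Mapping.single \<alpha> 1"
  by (rule poly_mapping_eqI) (auto simp: M_coords.rep_eq coeff_of_M_qsym lookup_single when_def)

text \<open>The spanning half of the basis property; \<open>M_coords_M_qsym\<close> supplies
  independence.\<close>

lemma linear_extension_M_coords: "linear_extension M_qsym (M_coords f) = f"
proof (rule qsym_eqI)
  fix m
  have "coeff_of (linear_extension M_qsym (M_coords f)) m
      = linear_extension (\<lambda>\<alpha>. if comp_of m = \<alpha> then 1 else 0) (M_coords f)"
    by (simp add: linear_linear_extension[OF qlinear_coeff_of] coeff_of_M_qsym)
  also have "\<dots> = Poly_Mapping.lookup (M_coords f) (comp_of m)"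
    by (auto simp: linear_extension_def scaleQ_rat_def in_keys_iff if_distrib[of "\<lambda>x. _ * x"] cong: if_cong)
  also have "\<dots> = coeff_of f m"
    using coeff_of_comp_of[of f m] by (simp add: M_coords.rep_eq)
  finally show "coeff_of (linear_extension M_qsym (M_coords f)) m = coeff_of f m" .
qed

lemma qsym_linear_eqI:
  assumes "qlinear f" "qlinear g" "\<And>\<alpha>. f (M_qsym \<alpha>) = g (M_qsym \<alpha>)"
  shows "f x = g x"
proof -
  have "f (linear_extension M_qsym (M_coords x)) = g (linear_extension M_qsym (M_coords x))"
    using assms by (simp add: linear_linear_extension)
  then show ?thesis by (simp add: linear_extension_M_coords)
qed

lemma qsym_bilinear_eqI:
  assumes "qbilinear f" "qbilinear g" "\<And>\<alpha> \<beta>. f (M_qsym \<alpha>) (M_qsym \<beta>) = g (M_qsym \<alpha>) (M_qsym \<beta>)"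
  shows "f x y = g x y"
proof (rule qsym_linear_eqI[where x = x])
  show "f (M_qsym \<alpha>) y = g (M_qsym \<alpha>) y" for \<alpha>
    by (rule qsym_linear_eqI[where x = y]) (use assms in \<open>simp_all add: qbilinear_def\<close>)
qed (use assms in \<open>simp_all add: qbilinear_def\<close>)

definition M_extension :: "(composition \<Rightarrow> 'a::rat_vector) \<Rightarrow> qsym \<Rightarrow> 'a"
  where "M_extension h f = linear_extension h (M_coords f)"

lemma qlinear_M_extension: "qlinear (M_extension h)"
  unfolding M_extension_def[abs_def] by (rule qlinear_comp[OF qlinear_linear_extension qlinear_M_coords])

lemma M_extension_M_qsym [simp]: "M_extension h (M_qsym \<alpha>) = h \<alpha>"
  by (simp add: M_extension_def)

section \<open>The product of quasisymmetric functions\<close>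

text \<open>A sum over an infinite set is 0 by convention, so this is what gives the coefficients of
  \<open>qsym_mult\<close> their intended meaning. Both summands are bounded by \<open>m\<close> at
  every variable.\<close>

lemma finite_monomial_sums: "finite {(a, b). a + b = (m :: monomial)}"
proof -
  \<comment> \<open>A single bound for all exponents, as finiteness of the function set asks for one
    common range.\<close>
  let ?N = "\<Sum>i\<in>Poly_Mapping.keys m. Poly_Mapping.lookup m i"
  let ?F = "{f. \<forall>i. (i \<in> Poly_Mapping.keys m \<longrightarrow> f i \<in> {..?N}) \<and> (i \<notin> Poly_Mapping.keys m \<longrightarrow> f i = (0::nat))}"
  have fin: "finite ?F" by (rule finite_set_of_finite_funs) simp_all
  have sub: "Poly_Mapping.lookup ` {a. \<exists>b. a + b = m} \<subseteq> ?F"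
  proof clarify
    fix a b i assume m: "m = a + b"
    have le: "Poly_Mapping.lookup a i \<le> Poly_Mapping.lookup m i" by (simp add: m lookup_add)
    have "Poly_Mapping.lookup m i \<le> ?N" if "i \<in> Poly_Mapping.keys m"
      using that by (intro member_le_sum) auto
    with le show "(i \<in> Poly_Mapping.keys (a + b) \<longrightarrow> Poly_Mapping.lookup a i
        \<in> {..\<Sum>i\<in>Poly_Mapping.keys (a + b). Poly_Mapping.lookup (a + b) i})
        \<and> (i \<notin> Poly_Mapping.keys (a + b) \<longrightarrow> Poly_Mapping.lookup a i = 0)"
      by (auto simp: m in_keys_iff)
  qed
  have "finite {a. \<exists>b. a + b = m}"
    by (rule finite_imageD[OF finite_subset[OF sub fin]]) (simp add: inj_on_def lookup_inject)
  then have "finite ((\<lambda>a. (a, m - a)) ` {a. \<exists>b. a + b = m})" by simp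
  then show ?thesis by (rule rev_finite_subset) auto
qed

text \<open>Both sides sum over the factorizations of \<open>x\<close> into three factors. It serves
  associativity, with monomials under addition, and coassociativity, with compositions under
  concatenation.\<close>

lemma sum_factor_assoc:
  assumes fin: "\<And>x. finite {(a, b). f a b = x}" and assoc: "\<And>a b c. f (f a b) c = f a (f b c)"
  shows "(\<Sum>(d, c) | f d c = x. \<Sum>(a, b) | f a b = d. h a b c)
    = (\<Sum>(a, d) | f a d = x. \<Sum>(b, c) | f b c = d. h a b c)"
proof -
  have fin': "finite {p. f (fst p) (snd p) = x}" for x
    using fin[of x] by (simp add: case_prod_unfold)
  show ?thesis
    unfolding case_prod_unfold
    by (subst (1 2) sum.Sigma, simp_all add: fin',
        rule sum.reindex_bij_witness[where i = "\<lambda>((a, d), (b, c)). ((f a b, c), (a, b))"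
          and j = "\<lambda>((d, c), (a, b)). ((a, f b c), (b, c))"])
      (auto simp: assoc)
qed

lemma qbilinear_qsym_mult: "qbilinear qsym_mult"
  unfolding qbilinear_iff
  by (auto intro!: qsym_eqI simp: qsym_mult.rep_eq coeff_of_simps algebra_simps case_prod_unfold
      sum.distrib sum_distrib_left)

lemma qsym_mult_assoc: "qsym_mult (qsym_mult f g) h = qsym_mult f (qsym_mult g h)"
proof (rule qsym_eqI)
  fix m
  have "coeff_of (qsym_mult (qsym_mult f g) h) m
      = (\<Sum>(d, c) | d + c = m. \<Sum>(a, b) | a + b = d. coeff_of f a * coeff_of g b * coeff_of h c)"
    by (simp add: qsym_mult.rep_eq sum_distrib_right case_prod_unfold)
  also have "\<dots> = (\<Sum>(a, d) | a + d = m. \<Sum>(b, c) | b + c = d. coeff_of f a * coeff_of g b * coeff_of h c)"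
    by (rule sum_factor_assoc[OF finite_monomial_sums add.assoc])
  also have "\<dots> = coeff_of (qsym_mult f (qsym_mult g h)) m"
    by (simp add: qsym_mult.rep_eq sum_distrib_left case_prod_unfold mult.assoc)
  finally show "coeff_of (qsym_mult (qsym_mult f g) h) m = coeff_of (qsym_mult f (qsym_mult g h)) m" .
qed

lemma qsym_one_eq: "qsym_one = M_qsym (Composition [])"
  by (rule qsym_eqI) (simp add: qsym_one.rep_eq coeff_of_M_qsym)

lemma qsym_mult_commute: "qsym_mult f g = qsym_mult g f"
  by (rule qsym_eqI, unfold qsym_mult.rep_eq,
      rule sum.reindex_bij_witness[where i = "\<lambda>(a, b). (b, a)" and j = "\<lambda>(a, b). (b, a)"])
    (auto simp: add.commute)

lemma qsym_mult_one: "qsym_mult qsym_one f = f"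
proof (rule qsym_eqI)
  fix m
  have "coeff_of (qsym_mult qsym_one f) m
      = (\<Sum>p | fst p + snd p = m. if p = (0, m) then coeff_of f m else 0)"
    by (auto simp: qsym_mult.rep_eq qsym_one.rep_eq intro!: sum.cong)
  then show "coeff_of (qsym_mult qsym_one f) m = coeff_of f m"
    using finite_monomial_sums[of m] by (simp add: case_prod_unfold)
qed

lemma qsym_mult_one_right: "qsym_mult f qsym_one = f"
  using qsym_mult_one qsym_mult_commute by metis

section \<open>The coproduct of quasisymmetric functions\<close>

lemma comp_append_assoc: "comp_append (comp_append \<alpha> \<beta>) \<gamma> = comp_append \<alpha> (comp_append \<beta> \<gamma>)"
  by transfer simp

lemma parts_take_drop:
  "parts (Composition (take i (parts \<alpha>))) = take i (parts \<alpha>)"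
  "parts (Composition (drop i (parts \<alpha>))) = drop i (parts \<alpha>)"
  by (auto intro!: Composition_inverse dest!: in_set_takeD in_set_dropD parts_pos)

text \<open>A factorization is a cut of the list of parts. Indexing by the cut position isolates the
  end terms used for the counit and for the antipode.\<close>

lemma comp_append_factors:
  "{(\<beta>, \<gamma>). comp_append \<beta> \<gamma> = \<alpha>}
    = (\<lambda>i. (Composition (take i (parts \<alpha>)), Composition (drop i (parts \<alpha>)))) ` {..length (parts \<alpha>)}"
proof (intro set_eqI iffI)
  fix p assume "p \<in> {(\<beta>, \<gamma>). comp_append \<beta> \<gamma> = \<alpha>}"
  then obtain \<beta> \<gamma> where p: "p = (\<beta>, \<gamma>)" "comp_append \<beta> \<gamma> = \<alpha>" by auto
  then have "parts \<alpha> = parts \<beta> @ parts \<gamma>" by (simp add: comp_append.rep_eq flip: p(2))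
  then show "p \<in> (\<lambda>i. (Composition (take i (parts \<alpha>)), Composition (drop i (parts \<alpha>)))) ` {..length (parts \<alpha>)}"
    by (intro image_eqI[of _ _ "length (parts \<beta>)"]) (simp_all add: p(1) parts_inverse)
next
  fix p
  assume "p \<in> (\<lambda>i. (Composition (take i (parts \<alpha>)), Composition (drop i (parts \<alpha>)))) ` {..length (parts \<alpha>)}"
  then obtain i where p: "p = (Composition (take i (parts \<alpha>)), Composition (drop i (parts \<alpha>)))" by auto
  have "parts (comp_append (fst p) (snd p)) = parts \<alpha>"
    by (simp add: comp_append.rep_eq p parts_take_drop)
  then show "p \<in> {(\<beta>, \<gamma>). comp_append \<beta> \<gamma> = \<alpha>}"
    by (simp add: parts_inject case_prod_unfold)
qed

lemma finite_comp_append_factors: "finite {(\<beta>, \<gamma>). comp_append \<beta> \<gamma> = \<alpha>}"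
  by (simp add: comp_append_factors)

lemma sum_comp_append:
  "(\<Sum>(\<beta>, \<gamma>) | comp_append \<beta> \<gamma> = \<alpha>. h \<beta> \<gamma>)
    = (\<Sum>i\<le>length (parts \<alpha>). h (Composition (take i (parts \<alpha>))) (Composition (drop i (parts \<alpha>))))"
proof -
  have "inj_on (\<lambda>i. (Composition (take i (parts \<alpha>)), Composition (drop i (parts \<alpha>)))) {..length (parts \<alpha>)}"
  proof (rule inj_onI)
    fix i j assume ij: "i \<in> {..length (parts \<alpha>)}" "j \<in> {..length (parts \<alpha>)}"
      "(Composition (take i (parts \<alpha>)), Composition (drop i (parts \<alpha>)))
        = (Composition (take j (parts \<alpha>)), Composition (drop j (parts \<alpha>)))"
    then have "length (parts (Composition (take i (parts \<alpha>)))) = length (parts (Composition (take j (parts \<alpha>))))"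
      by simp
    with ij(1,2) show "i = j" by (simp add: parts_take_drop)
  qed
  then show ?thesis by (simp add: comp_append_factors sum.reindex)
qed

lemma
  shows qlinear_qsym_comult: "qlinear qsym_comult"
    and qsym_comult_M: "qsym_comult (M_qsym \<alpha>)
      = (\<Sum>(\<beta>, \<gamma>) | comp_append \<beta> \<gamma> = \<alpha>. M_qsym \<beta> \<otimes> M_qsym \<gamma>)"
proof -
  let ?P = "\<lambda>\<Delta>. qlinear \<Delta>
    \<and> (\<forall>\<alpha>. \<Delta> (M_qsym \<alpha>) = (\<Sum>(\<beta>, \<gamma>) | comp_append \<beta> \<gamma> = \<alpha>. M_qsym \<beta> \<otimes> M_qsym \<gamma>))"
  have "?P qsym_comult"
    unfolding qsym_comult_def
  proof (rule theI[of ?P])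
    show "?P (M_extension (\<lambda>\<alpha>. \<Sum>(\<beta>, \<gamma>) | comp_append \<beta> \<gamma> = \<alpha>. M_qsym \<beta> \<otimes> M_qsym \<gamma>))"
      by (simp add: qlinear_M_extension)
    show "?P \<Delta> \<Longrightarrow> \<Delta> = M_extension (\<lambda>\<alpha>. \<Sum>(\<beta>, \<gamma>) | comp_append \<beta> \<gamma> = \<alpha>. M_qsym \<beta> \<otimes> M_qsym \<gamma>)" for \<Delta>
      by (rule ext, rule qsym_linear_eqI[of \<Delta>]) (simp_all add: qlinear_M_extension)
  qed
  then show "qlinear qsym_comult" "qsym_comult (M_qsym \<alpha>)
      = (\<Sum>(\<beta>, \<gamma>) | comp_append \<beta> \<gamma> = \<alpha>. M_qsym \<beta> \<otimes> M_qsym \<gamma>)"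
    by simp_all
qed

text \<open>The coefficient of x^a y^b when a tensor of two series is read as one series in two
  alphabets.\<close>

definition tensor_coeff :: "monomial \<Rightarrow> monomial \<Rightarrow> (qsym, qsym) tensor \<Rightarrow> rat"
  where "tensor_coeff a b = tensor_lift (\<lambda>f g. coeff_of f a * coeff_of g b)"

lemma qbilinear_coeff_mult: "qbilinear (\<lambda>f g. coeff_of f a * coeff_of g b)"
  unfolding qbilinear_iff by (simp add: coeff_of_simps algebra_simps scaleQ_rat_def)

lemma qlinear_tensor_coeff: "qlinear (tensor_coeff a b)"
  unfolding tensor_coeff_def by (rule qlinear_tensor_lift[OF qbilinear_coeff_mult])

lemma tensor_coeff_pure: "tensor_coeff a b (f \<otimes> g) = coeff_of f a * coeff_of g b"
  unfolding tensor_coeff_def by (rule tensor_lift_pure[OF qbilinear_coeff_mult])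

lemma qlinear_lookup: "qlinear (\<lambda>v. Poly_Mapping.lookup v k)"
  unfolding qlinear_iff by (simp add: lookup_add lookup_scaleQ)

text \<open>At packed monomials these functionals are the coordinates with respect to the tensors
  \<open>M_qsym \<alpha> \<otimes> M_qsym \<beta>\<close>: \<open>L\<close> collects the coordinates
  and \<open>R\<close> rebuilds the tensor from them.\<close>

lemma tensor_qsym_eqI:
  assumes "\<And>a b. tensor_coeff a b s = tensor_coeff a b t"
  shows "s = t"
proof -
  let ?c = "\<lambda>f g. linear_extension (\<lambda>\<alpha>. linear_extension (\<lambda>\<beta>. Poly_Mapping.single (\<alpha>, \<beta>) (1::rat))
    (M_coords g)) (M_coords f)"
  define L where "L = tensor_lift ?c"
  define R where "R = linear_extension (\<lambda>(\<alpha>, \<beta>). M_qsym \<alpha> \<otimes> M_qsym \<beta>)"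
  have c: "qbilinear ?c"
    by (rule qbilinear_comp[OF qbilinear_linear_extension qlinear_M_coords qlinear_M_coords])
  have linL: "qlinear L" unfolding L_def using c by (rule qlinear_tensor_lift)
  have L: "L (f \<otimes> g) = ?c f g" for f g unfolding L_def using c by (rule tensor_lift_pure)
  have linR: "qlinear R" unfolding R_def by (rule qlinear_linear_extension)
  have lookup: "Poly_Mapping.lookup (L u) (\<alpha>, \<beta>) = tensor_coeff (std_monomial \<alpha>) (std_monomial \<beta>) u"
    for u \<alpha> \<beta>
  proof (rule tensor_eqI[where t = u])
    show "Poly_Mapping.lookup (L (f \<otimes> g)) (\<alpha>, \<beta>)
        = tensor_coeff (std_monomial \<alpha>) (std_monomial \<beta>) (f \<otimes> g)" for f g
      unfolding L tensor_coeff_pure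
      by (rule qsym_bilinear_eqI[OF qlinear_qbilinear[OF qlinear_lookup c] qbilinear_coeff_mult])
        (auto simp: coeff_of_M_qsym lookup_single when_def)
  qed (rule qlinear_comp[OF qlinear_lookup linL] qlinear_tensor_coeff)+
  have "R (L u) = u" for u
  proof (rule tensor_eqI[where t = u])
    show "R (L (f \<otimes> g)) = f \<otimes> g" for f g
      unfolding L
      by (rule qsym_bilinear_eqI[OF qlinear_qbilinear[OF linR c] qbilinear_pure_tensor])
        (simp add: R_def)
  qed (rule qlinear_comp[OF linR linL] qlinear_id)+
  moreover have "L s = L t"
  proof (rule poly_mapping_eqI)
    show "Poly_Mapping.lookup (L s) p = Poly_Mapping.lookup (L t) p" for p
      using assms by (cases p) (simp add: lookup)
  qed
  ultimately show ?thesis by metis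
qed

section \<open>Two alphabets inside one ordered set of variables\<close>

definition glue :: "nat \<Rightarrow> monomial \<Rightarrow> monomial \<Rightarrow> monomial"
  where "glue N a b = a + relabel (\<lambda>i. i + N) b"

lemma lookup_shift:
  "Poly_Mapping.lookup (relabel (\<lambda>i. i + N) b) i = (if i < N then 0 else Poly_Mapping.lookup b (i - N))"
proof -
  have "Poly_Mapping.lookup (relabel (\<lambda>i. i + N) b) i
      = (\<Sum>k\<in>Poly_Mapping.keys b. if k + N = i then Poly_Mapping.lookup b k else 0)"
    by (simp add: relabel_def lookup_sum lookup_single when_def)
  also have "\<dots> = (\<Sum>k\<in>Poly_Mapping.keys b. if k = i - N \<and> N \<le> i then Poly_Mapping.lookup b k else 0)"
    by (intro sum.cong) auto
  also have "\<dots> = (if i < N then 0 else Poly_Mapping.lookup b (i - N))"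
    by (cases "N \<le> i") (auto simp: in_keys_iff)
  finally show ?thesis .
qed

lemma lookup_glue:
  assumes "Poly_Mapping.keys a \<subseteq> {..<N}"
  shows "Poly_Mapping.lookup (glue N a b) i
    = (if i < N then Poly_Mapping.lookup a i else Poly_Mapping.lookup b (i - N))"
  using assms by (auto simp: glue_def lookup_add lookup_shift in_keys_iff subset_iff)

lemma glue_add: "glue N (a + a') (b + b') = glue N a b + glue N a' b'"
  by (simp add: glue_def relabel_add add_ac)

text \<open>The shifted variables of \<open>b\<close> lie behind all variables of \<open>a\<close>,
  so the two exponent lists follow one another. Here substitution of two alphabets meets
  deconcatenation.\<close>

lemma comp_of_glue:
  assumes "Poly_Mapping.keys a \<subseteq> {..<N}"
  shows "comp_of (glue N a b) = comp_append (comp_of a) (comp_of b)"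
proof -
  let ?s = "\<lambda>m :: monomial. sorted_list_of_set (Poly_Mapping.keys m)"
  have keys: "Poly_Mapping.keys (glue N a b) = Poly_Mapping.keys a \<union> (\<lambda>i. i + N) ` Poly_Mapping.keys b"
  proof (intro set_eqI)
    fix i
    show "i \<in> Poly_Mapping.keys (glue N a b)
        \<longleftrightarrow> i \<in> Poly_Mapping.keys a \<union> (\<lambda>i. i + N) ` Poly_Mapping.keys b"
      using assms by (cases "i < N")
        (auto simp: in_keys_iff lookup_glue[OF assms] subset_iff intro!: image_eqI[of _ _ "i - N"])
  qed
  have "?s (glue N a b) = ?s a @ List.map (\<lambda>i. i + N) (?s b)"
  proof (rule strict_sorted_equal)
    show "sorted_wrt (<) (?s a @ List.map (\<lambda>i. i + N) (?s b))"
      using assms by (auto simp: sorted_wrt_append sorted_wrt_map subset_iff)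
  qed (auto simp: keys)
  then have "parts (comp_of (glue N a b)) = parts (comp_append (comp_of a) (comp_of b))"
    using assms by (auto simp: parts_comp_of comp_append.rep_eq lookup_glue subset_iff)
  then show ?thesis by (simp add: parts_inject)
qed

text \<open>The coproduct is the substitution \<open>f(x) \<mapsto> f(x, y)\<close>: its coefficient at \<open>x\<^sup>a y\<^sup>b\<close> is read off
  after placing the variables \<open>y\<close> behind all the variables that occur in \<open>x\<^sup>a\<close>.\<close>

lemma tensor_coeff_qsym_comult:
  assumes "Poly_Mapping.keys a \<subseteq> {..<N}"
  shows "tensor_coeff a b (qsym_comult f) = coeff_of f (glue N a b)"
proof (rule qsym_linear_eqI[where x = f])
  fix \<alpha>
  have "tensor_coeff a b (qsym_comult (M_qsym \<alpha>))
      = (\<Sum>p | comp_append (fst p) (snd p) = \<alpha>. if p = (comp_of a, comp_of b) then 1 else 0)"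
    by (auto simp: qsym_comult_M qlinearD(4)[OF qlinear_tensor_coeff] case_prod_unfold tensor_coeff_pure
        coeff_of_M_qsym intro!: sum.cong)
  also have "\<dots> = coeff_of (M_qsym \<alpha>) (glue N a b)"
    using finite_comp_append_factors[of \<alpha>]
    by (simp add: case_prod_unfold coeff_of_M_qsym comp_of_glue[OF assms])
  finally show "tensor_coeff a b (qsym_comult (M_qsym \<alpha>)) = coeff_of (M_qsym \<alpha>) (glue N a b)" .
qed (rule qlinear_comp[OF qlinear_tensor_coeff qlinear_qsym_comult] qlinear_coeff_of)+

text \<open>\<open>low_part N\<close> and \<open>high_part N\<close> undo \<open>glue N\<close>.
  Both are additive, so factorizations of a glued monomial correspond to pairs of
  factorizations.\<close>

lift_definition low_part :: "nat \<Rightarrow> monomial \<Rightarrow> monomial" is "\<lambda>N f i. if i < N then f i else 0"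
  by (erule rev_finite_subset) auto

lift_definition high_part :: "nat \<Rightarrow> monomial \<Rightarrow> monomial" is "\<lambda>N f i. f (i + N)"
proof -
  fix N and f :: "nat \<Rightarrow> nat" assume "finite {x. f x \<noteq> 0}"
  then have "finite ((\<lambda>i. i + N) -` {x. f x \<noteq> 0})" by (rule finite_vimageI) (simp add: inj_on_def)
  then show "finite {x. f (x + N) \<noteq> 0}" by (simp add: vimage_def)
qed

lemma keys_low_part: "Poly_Mapping.keys (low_part N m) \<subseteq> {..<N}"
  by (auto simp: in_keys_iff low_part.rep_eq split: if_splits)

lemma glue_low_high: "glue N (low_part N m) (high_part N m) = m"
  by (rule poly_mapping_eqI) (simp add: lookup_glue[OF keys_low_part] low_part.rep_eq high_part.rep_eq)

lemma
  assumes "Poly_Mapping.keys a \<subseteq> {..<N}"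
  shows low_part_glue: "low_part N (glue N a b) = a" and high_part_glue: "high_part N (glue N a b) = b"
  using assms by (auto intro!: poly_mapping_eqI
      simp: lookup_glue[OF assms] low_part.rep_eq high_part.rep_eq in_keys_iff subset_iff)

lemma low_part_add: "low_part N (m + m') = low_part N m + low_part N m'"
  and high_part_add: "high_part N (m + m') = high_part N m + high_part N m'"
  by (auto intro!: poly_mapping_eqI simp: lookup_add low_part.rep_eq high_part.rep_eq)

text \<open>The tensor algebra multiplies like series in two alphabets: the exponents of x and of y
  split independently.\<close>

lemma tensor_coeff_tensor_mult:
  "tensor_coeff a b (tensor_mult QSym s t)
    = (\<Sum>(a1, a2) | a1 + a2 = a. \<Sum>(b1, b2) | b1 + b2 = b. tensor_coeff a1 b1 s * tensor_coeff a2 b2 t)"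
proof (rule tensor_eqI2[where s = s and t = t])
  have bil: "qbilinear (mult QSym)" by (simp add: QSym_def qbilinear_qsym_mult)
  show "qbilinear (\<lambda>s t. tensor_coeff a b (tensor_mult QSym s t))"
    by (rule qlinear_qbilinear[OF qlinear_tensor_coeff qbilinear_tensor_mult[OF bil]])
  show "qbilinear (\<lambda>s t. \<Sum>(a1, a2) | a1 + a2 = a. \<Sum>(b1, b2) | b1 + b2 = b.
      tensor_coeff a1 b1 s * tensor_coeff a2 b2 t)"
    unfolding qbilinear_iff
    by (simp add: qlinearD(1,2)[OF qlinear_tensor_coeff] case_prod_unfold algebra_simps sum.distrib
        sum_distrib_left scaleQ_rat_def)
  fix f g f' g'
  show "tensor_coeff a b (tensor_mult QSym (f \<otimes> g) (f' \<otimes> g'))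
      = (\<Sum>(a1, a2) | a1 + a2 = a. \<Sum>(b1, b2) | b1 + b2 = b.
          tensor_coeff a1 b1 (f \<otimes> g) * tensor_coeff a2 b2 (f' \<otimes> g'))"
    unfolding tensor_mult_pure[OF bil] tensor_coeff_pure
    by (simp add: QSym_def qsym_mult.rep_eq sum_product case_prod_unfold mult_ac)
qed

lemma qsym_comult_mult:
  "qsym_comult (qsym_mult f g) = tensor_mult QSym (qsym_comult f) (qsym_comult g)"
proof (rule tensor_qsym_eqI)
  fix a b :: monomial
  obtain N where N: "Poly_Mapping.keys a \<subseteq> {..<N}"
    using finite_keys[of a] by (auto simp: finite_nat_set_iff_bounded)
  \<comment> \<open>Exponents are natural numbers and cannot cancel, so the same \<open>N\<close>
    serves for all factors of \<open>a\<close>.\<close>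
  have keys: "Poly_Mapping.keys a1 \<subseteq> {..<N}" "Poly_Mapping.keys a2 \<subseteq> {..<N}" if "a1 + a2 = a" for a1 a2
    using N unfolding that[symmetric] keys_plus_monomial by auto
  have "tensor_coeff a b (qsym_comult (qsym_mult f g))
      = (\<Sum>(m1, m2) | m1 + m2 = glue N a b. coeff_of f m1 * coeff_of g m2)"
    by (simp add: tensor_coeff_qsym_comult[OF N] qsym_mult.rep_eq)
  also have "\<dots> = (\<Sum>((a1, a2), (b1, b2)) \<in> {(a1, a2). a1 + a2 = a} \<times> {(b1, b2). b1 + b2 = b}.
      coeff_of f (glue N a1 b1) * coeff_of g (glue N a2 b2))"
    by (rule sum.reindex_bij_witness[where
          j = "\<lambda>(m1, m2). ((low_part N m1, low_part N m2), (high_part N m1, high_part N m2))"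
          and i = "\<lambda>((a1, a2), (b1, b2)). (glue N a1 b1, glue N a2 b2)"])
      (auto simp: glue_low_high low_part_glue high_part_glue keys low_part_glue[OF N] high_part_glue[OF N]
        simp flip: low_part_add high_part_add glue_add)
  also have "\<dots> = (\<Sum>(a1, a2) | a1 + a2 = a. \<Sum>(b1, b2) | b1 + b2 = b.
      coeff_of f (glue N a1 b1) * coeff_of g (glue N a2 b2))"
    by (simp add: sum.cartesian_product case_prod_unfold)
  also have "\<dots> = (\<Sum>(a1, a2) | a1 + a2 = a. \<Sum>(b1, b2) | b1 + b2 = b.
      tensor_coeff a1 b1 (qsym_comult f) * tensor_coeff a2 b2 (qsym_comult g))"
    using tensor_coeff_qsym_comult[OF keys(1)] tensor_coeff_qsym_comult[OF keys(2)]
    by (auto intro!: sum.cong)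
  also have "\<dots> = tensor_coeff a b (tensor_mult QSym (qsym_comult f) (qsym_comult g))"
    by (simp add: tensor_coeff_tensor_mult)
  finally show "tensor_coeff a b (qsym_comult (qsym_mult f g))
      = tensor_coeff a b (tensor_mult QSym (qsym_comult f) (qsym_comult g))" .
qed

lemma qsym_coassoc:
  "tensor_assoc (tensor_map qsym_comult id (qsym_comult f)) = tensor_map id qsym_comult (qsym_comult f)"
proof (rule qsym_linear_eqI[where x = f])
  note lin = qlinear_qsym_comult qlinear_id
  show "qlinear (\<lambda>f. tensor_assoc (tensor_map qsym_comult id (qsym_comult f)))"
    by (rule qlinear_comp[OF qlinear_tensor_assoc qlinear_comp[OF qlinear_tensor_map]]) (fact lin)+
  show "qlinear (\<lambda>f. tensor_map id qsym_comult (qsym_comult f))"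
    by (rule qlinear_comp[OF qlinear_tensor_map]) (fact lin)+
  fix \<alpha>
  let ?M = "\<lambda>a b c. M_qsym a \<otimes> (M_qsym b \<otimes> M_qsym c)"
  note bil = qlinearD(4)[OF qbilinear_left[OF qbilinear_pure_tensor]]
    qlinearD(4)[OF qbilinear_right[OF qbilinear_pure_tensor]]
  have "tensor_assoc (tensor_map qsym_comult id (qsym_comult (M_qsym \<alpha>)))
      = (\<Sum>(\<delta>, c) | comp_append \<delta> c = \<alpha>. \<Sum>(a, b) | comp_append a b = \<delta>. ?M a b c)"
    by (simp add: qsym_comult_M qlinearD(4)[OF qlinear_tensor_map[OF lin(1,2)]] case_prod_unfold
        tensor_map_pure lin qlinearD(4)[OF qlinear_tensor_assoc] bil tensor_assoc_pure)
  also have "\<dots> = (\<Sum>(a, \<delta>) | comp_append a \<delta> = \<alpha>. \<Sum>(b, c) | comp_append b c = \<delta>. ?M a b c)"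
    by (rule sum_factor_assoc[OF finite_comp_append_factors comp_append_assoc])
  also have "\<dots> = tensor_map id qsym_comult (qsym_comult (M_qsym \<alpha>))"
    by (simp add: qsym_comult_M qlinearD(4)[OF qlinear_tensor_map[OF lin(2,1)]] case_prod_unfold
        tensor_map_pure lin bil)
  finally show "tensor_assoc (tensor_map qsym_comult id (qsym_comult (M_qsym \<alpha>)))
      = tensor_map id qsym_comult (qsym_comult (M_qsym \<alpha>))" .
qed

section \<open>Counit, bialgebra axioms and antipode\<close>

lemma tensor_lift_qsym_comult_M:
  assumes "qbilinear b"
  shows "tensor_lift b (qsym_comult (M_qsym \<alpha>)) = (\<Sum>i\<le>length (parts \<alpha>).
    b (M_qsym (Composition (take i (parts \<alpha>)))) (M_qsym (Composition (drop i (parts \<alpha>)))))"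
  by (simp add: qsym_comult_M sum_comp_append qlinearD(4)[OF qlinear_tensor_lift[OF assms]]
      tensor_lift_pure[OF assms])

lemma coeff_of_M_qsym_zero: "coeff_of (M_qsym \<alpha>) 0 = (if parts \<alpha> = [] then 1 else 0)"
  by (auto simp: coeff_of_M_qsym parts_eq_Nil_iff)

lemma bialgebra_QSym: "bialgebra QSym"
proof (rule bialgebra.intro, simp_all add: QSym_def)
  have bl: "qbilinear (\<lambda>a b. coeff_of a 0 *\<^sub>Q (b :: qsym))"
    by (rule qbilinear_comp[OF qbilinear_scaleQ qlinear_coeff_of qlinear_id(2)])
  have br: "qbilinear (\<lambda>a b. coeff_of b 0 *\<^sub>Q (a :: qsym))"
    by (rule qbilinear_swap[OF bl])
  fix x
  show "tensor_lift (\<lambda>a b. coeff_of a 0 *\<^sub>Q b) (qsym_comult x) = x"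
  proof (rule qsym_linear_eqI[where x = x])
    fix \<alpha>
    \<comment> \<open>Only the empty composition has a constant term, so just the cut at the left
      end survives.\<close>
    have "tensor_lift (\<lambda>a b. coeff_of a 0 *\<^sub>Q b) (qsym_comult (M_qsym \<alpha>))
        = (\<Sum>i\<le>length (parts \<alpha>). if i = 0 then M_qsym \<alpha> else 0)"
      unfolding tensor_lift_qsym_comult_M[OF bl]
      by (intro sum.cong) (auto simp: coeff_of_M_qsym_zero parts_take_drop parts_inverse scaleQ_one)
    then show "tensor_lift (\<lambda>a b. coeff_of a 0 *\<^sub>Q b) (qsym_comult (M_qsym \<alpha>)) = M_qsym \<alpha>" by simp
  qed (rule qlinear_comp[OF qlinear_tensor_lift[OF bl] qlinear_qsym_comult] qlinear_id)+
  show "tensor_lift (\<lambda>a b. coeff_of b 0 *\<^sub>Q a) (qsym_comult x) = x"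
  proof (rule qsym_linear_eqI[where x = x])
    fix \<alpha>
    have "tensor_lift (\<lambda>a b. coeff_of b 0 *\<^sub>Q a) (qsym_comult (M_qsym \<alpha>))
        = (\<Sum>i\<le>length (parts \<alpha>). if i = length (parts \<alpha>) then M_qsym \<alpha> else 0)"
      unfolding tensor_lift_qsym_comult_M[OF br]
      by (intro sum.cong) (auto simp: coeff_of_M_qsym_zero parts_take_drop parts_inverse scaleQ_one)
    then show "tensor_lift (\<lambda>a b. coeff_of b 0 *\<^sub>Q a) (qsym_comult (M_qsym \<alpha>)) = M_qsym \<alpha>" by simp
  qed (rule qlinear_comp[OF qlinear_tensor_lift[OF br] qlinear_qsym_comult] qlinear_id)+
  have "{p. comp_append (fst p) (snd p) = Composition []} = {(Composition [], Composition [])}"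
    using comp_append_factors[of "Composition []"] parts_eq_Nil_iff[of "Composition []"]
    by (simp add: case_prod_unfold)
  then show "qsym_comult qsym_one = qsym_one \<otimes> qsym_one"
    by (simp add: qsym_one_eq qsym_comult_M case_prod_unfold)
  have "{p :: monomial \<times> monomial. fst p + snd p = 0} = {(0, 0)}"
    by (auto simp: poly_mapping_eq_iff lookup_add fun_eq_iff plus_poly_mapping.rep_eq)
  then show "coeff_of (qsym_mult f g) 0 = coeff_of f 0 * coeff_of g 0" for f g
    by (simp add: qsym_mult.rep_eq case_prod_unfold)
  show "coeff_of qsym_one 0 = 1" by (simp add: qsym_one.rep_eq)
qed (simp_all add: qbilinear_qsym_mult qsym_mult_assoc qsym_mult_one qsym_mult_one_right
    qlinear_qsym_comult qlinear_coeff_of qsym_coassoc qsym_comult_mult[unfolded QSym_def])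

text \<open>The equation for a left convolution inverse, solved for the cut at the right end, where
  the second factor is the unit. On lists of parts the recursion decreases the length.\<close>

function left_antipode :: "nat list \<Rightarrow> qsym" where
  "left_antipode \<alpha> = (if \<alpha> = [] then qsym_one
    else - (\<Sum>i<length \<alpha>. qsym_mult (left_antipode (take i \<alpha>)) (M_qsym (Composition (drop i \<alpha>)))))"
  by auto
termination by (relation "measure length") auto

text \<open>The mirror image: solved for the cut at 0, which leaves the cuts at
  \<open>Suc i\<close>.\<close>

function right_antipode :: "nat list \<Rightarrow> qsym" where
  "right_antipode \<alpha> = (if \<alpha> = [] then qsym_one
    else - (\<Sum>i<length \<alpha>. qsym_mult (M_qsym (Composition (take (Suc i) \<alpha>)))
      (right_antipode (drop (Suc i) \<alpha>))))"
  by auto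
termination by (relation "measure length") auto

declare left_antipode.simps [simp del] right_antipode.simps [simp del]

text \<open>Each recursion yields only one of the two antipode identities by construction.
  Convolution associativity identifies the two maps, so one map satisfies both.\<close>

lemma hopf_algebra_QSym: "hopf_algebra QSym"
proof -
  interpret bialgebra QSym by (rule bialgebra_QSym)
  define S where "S = M_extension (\<lambda>\<alpha>. left_antipode (parts \<alpha>))"
  define T where "T = M_extension (\<lambda>\<alpha>. right_antipode (parts \<alpha>))"
  have linS: "qlinear S" and linT: "qlinear T" by (simp_all add: S_def T_def qlinear_M_extension)
  have SM: "S (M_qsym \<alpha>) = left_antipode (parts \<alpha>)" and TM: "T (M_qsym \<alpha>) = right_antipode (parts \<alpha>)" for \<alpha>
    by (simp_all add: S_def T_def)
  have bS: "qbilinear (\<lambda>a b. qsym_mult (S a) b)" and bT: "qbilinear (\<lambda>a b. qsym_mult a (T b))"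
    by (rule qbilinear_comp[OF qbilinear_qsym_mult linS qlinear_id(2)],
        rule qbilinear_comp[OF qbilinear_qsym_mult qlinear_id(2) linT])
  have lin_counit: "qlinear (\<lambda>f. coeff_of f 0 *\<^sub>Q qsym_one)"
    by (rule qlinear_comp[OF qbilinear_left[OF qbilinear_scaleQ] qlinear_coeff_of])
  have "tensor_lift (\<lambda>a b. qsym_mult (S a) b) (qsym_comult f) = coeff_of f 0 *\<^sub>Q qsym_one" for f
  proof (rule qsym_linear_eqI[where x = f])
    fix \<alpha>
    show "tensor_lift (\<lambda>a b. qsym_mult (S a) b) (qsym_comult (M_qsym \<alpha>))
        = coeff_of (M_qsym \<alpha>) 0 *\<^sub>Q qsym_one"
      unfolding tensor_lift_qsym_comult_M[OF bS] SM parts_take_drop coeff_of_M_qsym_zero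
        lessThan_Suc_atMost[symmetric]
      by (cases "parts \<alpha> = []")
        (simp_all add: left_antipode.simps[of "parts \<alpha>"] left_antipode.simps[of "[]"]
          qsym_mult_one_right scaleQ_one flip: qsym_one_eq)
  qed (rule qlinear_comp[OF qlinear_tensor_lift[OF bS] qlinear_qsym_comult] lin_counit)+
  moreover have "tensor_lift (\<lambda>a b. qsym_mult a (T b)) (qsym_comult f) = coeff_of f 0 *\<^sub>Q qsym_one" for f
  proof (rule qsym_linear_eqI[where x = f])
    fix \<alpha>
    show "tensor_lift (\<lambda>a b. qsym_mult a (T b)) (qsym_comult (M_qsym \<alpha>))
        = coeff_of (M_qsym \<alpha>) 0 *\<^sub>Q qsym_one"
      unfolding tensor_lift_qsym_comult_M[OF bT] TM parts_take_drop coeff_of_M_qsym_zero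
        sum.atMost_shift
      by (cases "parts \<alpha> = []")
        (simp_all add: right_antipode.simps[of "parts \<alpha>"] right_antipode.simps[of "[]"]
          qsym_mult_one scaleQ_one flip: qsym_one_eq)
  qed (rule qlinear_comp[OF qlinear_tensor_lift[OF bT] qlinear_qsym_comult] lin_counit)+
  moreover from calculation have "S = T"
    using linS linT by (intro left_right_antipode_eq) (simp_all add: QSym_def)
  ultimately have "is_antipode QSym S"
    using linS by (simp add: is_antipode_def QSym_def)
  then show ?thesis by unfold_locales blast
qed

section \<open>Fundamental quasisymmetric functions\<close>

text \<open>The proper partial sums: the subset of {1, ..., n-1} that encodes a composition of n,
  and the positions where \<open>F_qsym\<close> demands a strict increase.\<close>

definition descents :: "nat list \<Rightarrow> nat set"
  where "descents as = {sum_list (take k as) | k. 1 \<le> k \<and> k < length as}"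

lemma descents_Nil [simp]: "descents [] = {}" and descents_single [simp]: "descents [a] = {}"
  by (auto simp: descents_def)

lemma descents_Cons: "as \<noteq> [] \<Longrightarrow> descents (a # as) = insert a ((+) a ` descents as)"
proof (intro set_eqI iffI)
  fix d assume "as \<noteq> []" "d \<in> descents (a # as)"
  then obtain k where k: "1 \<le> k" "k < length (a # as)" "d = sum_list (take k (a # as))"
    by (auto simp: descents_def)
  then obtain l where l: "k = Suc l" by (cases k) auto
  show "d \<in> insert a ((+) a ` descents as)"
  proof (cases "l = 0")
    case False
    then have "sum_list (take l as) \<in> descents as"
      using k l unfolding descents_def by (intro CollectI exI[of _ l]) simp
    then show ?thesis using k l by simp
  qed (use k l in simp)
next
  fix d assume as: "as \<noteq> []" and d: "d \<in> insert a ((+) a ` descents as)"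
  show "d \<in> descents (a # as)"
  proof (cases "d = a")
    case True
    then show ?thesis using as unfolding descents_def by (auto intro!: exI[of _ "1::nat"])
  next
    case False
    with d obtain k where "1 \<le> k" "k < length as" "d = a + sum_list (take k as)"
      by (auto simp: descents_def)
    then show ?thesis unfolding descents_def by (auto intro!: exI[of _ "Suc k"])
  qed
qed

lemma descents_bounds:
  "\<forall>a\<in>set as. 0 < a \<Longrightarrow> d \<in> descents as \<Longrightarrow> 0 < d \<and> d < sum_list as"
proof (induction as arbitrary: d)
  case (Cons a as)
  show ?case
  proof (cases "as = []")
    case False
    then have "0 < sum_list as" using Cons.prems(1) by (cases as) auto
    then show ?thesis using Cons False by (auto simp: descents_Cons)
  qed (use Cons in simp)
qed simp

lemma descents_append:
  "as \<noteq> [] \<Longrightarrow> bs \<noteq> [] \<Longrightarrow>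
    descents (as @ bs) = descents as \<union> insert (sum_list as) ((+) (sum_list as) ` descents bs)"
proof (induction as)
  case (Cons a as)
  then show ?case
    by (cases "as = []") (auto simp: descents_Cons image_Un image_image add.assoc)
qed simp

text \<open>The first part is the least descent. Once the first parts agree, the other descents are
  the shifted descents of the tails.\<close>

lemma descents_inject:
  assumes "\<forall>a\<in>set as. 0 < a" "\<forall>b\<in>set bs. 0 < b" "sum_list as = sum_list bs" "descents as = descents bs"
  shows "as = bs"
  using assms
proof (induction as arbitrary: bs)
  case Nil
  then show ?case by (cases bs) auto
next
  case (Cons a as)
  from Cons.prems obtain b bs' where bs: "bs = b # bs'" by (cases bs) auto
  show ?case
  proof (cases "as = [] \<or> bs' = []")
    case True
    then have "as = []" "bs' = []"
      using Cons.prems(4) descents_Cons[of as a] descents_Cons[of bs' b] unfolding bs by (metis descents_single insert_not_empty)+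
    then show ?thesis using Cons.prems(3) by (simp add: bs)
  next
    case False
    then have D: "insert a ((+) a ` descents as) = insert b ((+) b ` descents bs')"
      using Cons.prems(4) by (simp add: bs descents_Cons)
    have "a \<in> insert b ((+) b ` descents bs')" "b \<in> insert a ((+) a ` descents as)"
      using D by auto
    then have ab: "a = b" by auto
    have pos: "0 < d" if "d \<in> descents as \<or> d \<in> descents bs'" for d
      using that descents_bounds[of as d] descents_bounds[of bs' d] Cons.prems(1,2) by (auto simp: bs)
    \<comment> \<open>Positivity separates the shifted descents from the inserted \<open>a\<close>,
      so they can be recovered from the whole set.\<close>
    have iff: "d \<in> descents as \<longleftrightarrow> 0 < d \<and> a + d \<in> insert a ((+) a ` descents as)" for d
      using pos by auto
    have iff': "d \<in> descents bs' \<longleftrightarrow> 0 < d \<and> b + d \<in> insert b ((+) b ` descents bs')" for d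
      using pos by auto
    have "descents as = descents bs'"
      using D iff iff' unfolding ab by (metis subsetI subset_antisym)
    then have "as = bs'" using Cons.prems(1-3) by (intro Cons.IH) (simp_all add: bs ab)
    then show ?thesis by (simp add: bs ab)
  qed
qed

lemma composition_eqI:
  "sum_list (parts \<alpha>) = sum_list (parts \<beta>) \<Longrightarrow> descents (parts \<alpha>) = descents (parts \<beta>) \<Longrightarrow> \<alpha> = \<beta>"
  using descents_inject[of "parts \<alpha>" "parts \<beta>"] parts_pos by (auto simp: parts_inject)

section \<open>Weakly increasing words and their monomials\<close>

fun blocks :: "nat list \<Rightarrow> nat list \<Rightarrow> nat list" where
  "blocks (k # ks) (a # as) = replicate a k @ blocks ks as"
| "blocks _ _ = []"

lemma set_blocks_subset: "set (blocks ks as) \<subseteq> set ks"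
  by (induction ks as rule: blocks.induct) auto

lemma length_blocks: "length ks = length as \<Longrightarrow> length (blocks ks as) = sum_list as"
  by (induction ks as rule: blocks.induct) auto

lemma sorted_blocks: "sorted_wrt (<) ks \<Longrightarrow> sorted (blocks ks as)"
proof (induction ks as rule: blocks.induct)
  case (1 k ks a as)
  then show ?case using set_blocks_subset[of ks as] by (fastforce simp: sorted_append)
qed simp_all

lemma word_monomial_append: "word_monomial (xs @ ys) = word_monomial xs + word_monomial ys"
  by (simp add: word_monomial_def)

lemma word_monomial_replicate: "word_monomial (replicate a k) = Poly_Mapping.single k a"
  by (induction a) (simp_all add: word_monomial_def flip: single_add)

lemma word_monomial_blocks: "word_monomial (blocks ks as) = power_monomial ks as"
  by (induction ks as rule: blocks.induct)
    (simp_all add: word_monomial_append word_monomial_replicate, simp_all add: word_monomial_def)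

text \<open>The word is constant on each block and rises at the borders between blocks, which lie at
  the proper partial sums of the block lengths.\<close>

lemma nth_blocks_less_iff:
  assumes "sorted_wrt (<) ks" "length ks = length as" "\<forall>a\<in>set as. 0 < a"
    and "1 \<le> j" "j < sum_list as"
  shows "blocks ks as ! (j - 1) < blocks ks as ! j \<longleftrightarrow> j \<in> descents as"
  using assms
proof (induction ks as arbitrary: j rule: blocks.induct)
  case (1 k ks a as)
  have pos: "\<forall>a\<in>set as. 0 < a" using 1 by simp
  \<comment> \<open>The positions \<open>j - 1\<close> and \<open>j\<close> lie inside the first
    block, straddle its border, or lie behind it.\<close>
  consider "j < a" | "j = a" | "a < j" by linarith
  then show ?case
  proof cases
    case 1
    then have "j \<notin> descents (a # as)"
      by (cases "as = []") (auto simp: descents_Cons)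
    moreover have "j - 1 < a" using \<open>j < a\<close> by simp
    ultimately show ?thesis using \<open>j < a\<close> by (simp add: nth_append)
  next
    case 2
    then have as: "as \<noteq> []" using 1 by auto
    have "0 < length (blocks ks as)" using 1(3,6) 2 by (simp add: length_blocks)
    then have "blocks ks as ! 0 \<in> set ks"
      using set_blocks_subset[of ks as] nth_mem by blast
    then show ?thesis using 2 as 1 by (simp add: nth_append descents_Cons)
  next
    case 3
    then have as: "as \<noteq> []" using 1 by auto
    have "j - 1 - a = (j - a) - 1" "\<not> j - 1 < a" using 3 by auto
    then have "blocks (k # ks) (a # as) ! (j - 1) < blocks (k # ks) (a # as) ! j
        \<longleftrightarrow> blocks ks as ! ((j - a) - 1) < blocks ks as ! (j - a)"
      using 3 by (simp add: nth_append)
    also have "\<dots> \<longleftrightarrow> j - a \<in> descents as"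
      using 1 3 by (intro 1(1)) auto
    also have "\<dots> \<longleftrightarrow> j \<in> descents (a # as)"
      using 3 as by (auto simp: descents_Cons image_iff intro!: bexI[of _ "j - a"])
    finally show ?thesis .
  qed
qed simp_all

text \<open>The unique weakly increasing word with monomial \<open>m\<close>; its uniqueness makes
  every coefficient of a fundamental function 0 or 1.\<close>

definition word_of :: "monomial \<Rightarrow> nat list"
  where "word_of m = blocks (sorted_list_of_set (Poly_Mapping.keys m)) (parts (comp_of m))"

lemma length_word_of: "length (word_of m) = total_degree m"
  by (simp add: word_of_def length_blocks parts_comp_of total_degree_comp_of)

lemma sorted_word_of: "sorted (word_of m)"
  by (simp add: word_of_def sorted_blocks)

lemma word_monomial_word_of: "word_monomial (word_of m) = m"
  by (simp add: word_of_def word_monomial_blocks power_monomial_comp_of)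

lemma nth_word_of_less_iff:
  "1 \<le> j \<Longrightarrow> j < total_degree m
    \<Longrightarrow> word_of m ! (j - 1) < word_of m ! j \<longleftrightarrow> j \<in> descents (parts (comp_of m))"
  unfolding word_of_def total_degree_comp_of
  by (rule nth_blocks_less_iff) (auto simp: parts_pos, simp add: parts_comp_of)

text \<open>The head of a sorted word is the least variable of its monomial, so equal heads can be
  cancelled.\<close>

lemma word_monomial_inject:
  "sorted xs \<Longrightarrow> sorted ys \<Longrightarrow> word_monomial xs = word_monomial ys \<Longrightarrow> xs = ys"
proof (induction xs arbitrary: ys)
  case Nil
  then have "set ys = set []" by (metis keys_word_monomial)
  then show ?case by simp
next
  case (Cons x xs)
  have set: "set ys = set (x # xs)" using Cons.prems(3) by (metis keys_word_monomial)
  then obtain y ys' where ys: "ys = y # ys'" by (cases ys) auto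
  have "x \<in> set ys" "y \<in> set (x # xs)" using set by (auto simp: ys)
  then have "x = y" using Cons.prems(1,2) by (auto simp: ys intro: order_antisym)
  moreover have "xs = ys'"
    using Cons.prems \<open>x = y\<close> by (intro Cons.IH) (simp_all add: ys word_monomial_def)
  ultimately show ?case by (simp add: ys)
qed

lemma sorted_word_unique: "sorted is \<and> word_monomial is = m \<longleftrightarrow> is = word_of m"
  using word_monomial_inject[of "is" "word_of m"] sorted_word_of[of m] word_monomial_word_of[of m] by auto

text \<open>Only \<open>word_of m\<close> can be counted, and it rises strictly exactly at the
  descents of \<open>comp_of m\<close>. The strictness demands thus become an inclusion.\<close>

lemma coeff_of_F_qsym:
  "coeff_of (F_qsym \<alpha>) m
    = (if total_degree m = sum_list (parts \<alpha>) \<and> descents (parts \<alpha>) \<subseteq> descents (parts (comp_of m)) then 1 else 0)"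
proof -
  let ?W = "{is. length is = sum_list (parts \<alpha>) \<and> sorted is
        \<and> (\<forall>j \<in> {sum_list (take k (parts \<alpha>)) | k. 1 \<le> k \<and> k < length (parts \<alpha>)}. is ! (j - 1) < is ! j)
        \<and> word_monomial is = m}"
  have *: "(\<forall>j\<in>descents (parts \<alpha>). word_of m ! (j - 1) < word_of m ! j)
      \<longleftrightarrow> descents (parts \<alpha>) \<subseteq> descents (parts (comp_of m))"
    if "total_degree m = sum_list (parts \<alpha>)"
  proof -
    have "word_of m ! (j - 1) < word_of m ! j \<longleftrightarrow> j \<in> descents (parts (comp_of m))"
      if "j \<in> descents (parts \<alpha>)" for j
      using descents_bounds[of "parts \<alpha>" j] that parts_pos[of _ \<alpha>] \<open>total_degree m = _\<close>
      by (intro nth_word_of_less_iff) auto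
    then show ?thesis by blast
  qed
  have "?W = {is. length is = sum_list (parts \<alpha>) \<and> (\<forall>j \<in> descents (parts \<alpha>). is ! (j - 1) < is ! j)
      \<and> is = word_of m}"
    unfolding descents_def using sorted_word_unique[of _ m] by blast
  also have "\<dots> = (if total_degree m = sum_list (parts \<alpha>) \<and> descents (parts \<alpha>) \<subseteq> descents (parts (comp_of m))
      then {word_of m} else {})"
    using * by (auto simp: length_word_of)
  finally show ?thesis by (simp add: F_qsym.rep_eq)
qed

text \<open>A telescoping sum; sortedness keeps the truncated subtractions exact.\<close>

lemma sum_list_take_differences:
  "sorted_wrt (<) (c # ds) \<Longrightarrow> k \<le> length ds
    \<Longrightarrow> sum_list (take k (map2 (-) ds (c # ds))) = (c # ds) ! k - (c :: nat)"
proof (induction ds arbitrary: c k)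
  case (Cons d ds)
  show ?case
  proof (cases k)
    case (Suc l)
    have "sum_list (take l (map2 (-) ds (d # ds))) = (d # ds) ! l - d"
      using Cons.prems Suc by (intro Cons.IH) auto
    moreover have "d \<le> (d # ds) ! l"
      using Cons.prems Suc by (cases l) (auto simp: less_imp_le)
    moreover have "c < d" using Cons.prems by simp
    ultimately show ?thesis by (simp add: Suc)
  qed simp
qed simp

lemma Des_bounds: "Des \<pi> \<subseteq> {1..<len \<pi>}"
  by (auto simp: Des_def)

lemma finite_Des: "finite (Des \<pi>)"
  using Des_bounds by (rule finite_subset) simp

lemma
  shows sum_list_Comp: "sum_list (parts (Comp \<pi>)) = len \<pi>"
    and descents_Comp: "descents (parts (Comp \<pi>)) = Des \<pi>"
proof -
  show "sum_list (parts (Comp \<pi>)) = len \<pi>" "descents (parts (Comp \<pi>)) = Des \<pi>"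
  proof (atomize (full), cases "len \<pi> = 0")
    case True
    then show "sum_list (parts (Comp \<pi>)) = len \<pi> \<and> descents (parts (Comp \<pi>)) = Des \<pi>"
      by (auto simp: Comp.rep_eq Comp_parts_def Des_def)
  next
    case False
    let ?s = "sorted_list_of_set (Des \<pi>)" and ?ds = "sorted_list_of_set (Des \<pi>) @ [len \<pi>]"
    have parts: "parts (Comp \<pi>) = map2 (-) ?ds (0 # ?ds)"
      using False by (simp add: Comp.rep_eq Comp_parts_def Let_def)
    have len: "length (parts (Comp \<pi>)) = length ?ds" by (simp add: parts)
    have "sorted_wrt (<) (0 # ?ds)"
      using False Des_bounds[of \<pi>] finite_Des[of \<pi>] by (auto simp: sorted_wrt_append)
    then have take: "sum_list (take k (parts (Comp \<pi>))) = (0 # ?ds) ! k" if "k \<le> length ?ds" for k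
      using sum_list_take_differences[of 0 ?ds k] that by (simp add: parts)
    have "sum_list (parts (Comp \<pi>)) = len \<pi>"
      using take[of "length ?ds"] len by (simp add: nth_append)
    moreover have "descents (parts (Comp \<pi>)) = {(0 # ?ds) ! k | k. 1 \<le> k \<and> k < length ?ds}"
      unfolding descents_def len using take by (metis (no_types, lifting) less_imp_le)
    \<comment> \<open>The bound \<open>1 \<le> k\<close> drops the leading 0, and
      \<open>k < length ?ds\<close> drops the final entry \<open>len \<pi>\<close>.\<close>
    moreover have "\<dots> = {?s ! k | k. k < length ?s}"
    proof (intro set_eqI iffI)
      fix d assume "d \<in> {(0 # ?ds) ! k | k. 1 \<le> k \<and> k < length ?ds}"
      then obtain k where "1 \<le> k" "k < length ?ds" "d = (0 # ?ds) ! k" by auto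
      then show "d \<in> {?s ! k | k. k < length ?s}"
        by (auto simp: nth_append intro!: exI[of _ "k - 1"])
    next
      fix d assume "d \<in> {?s ! k | k. k < length ?s}"
      then obtain k where "k < length ?s" "d = ?s ! k" by auto
      then show "d \<in> {(0 # ?ds) ! k | k. 1 \<le> k \<and> k < length ?ds}"
        by (auto simp: nth_append intro!: exI[of _ "Suc k"])
    qed
    moreover have "\<dots> = Des \<pi>"
      using finite_Des[of \<pi>] unfolding set_conv_nth[symmetric] by simp
    ultimately show "sum_list (parts (Comp \<pi>)) = len \<pi> \<and> descents (parts (Comp \<pi>)) = Des \<pi>" by simp
  qed
qed

lemma coeff_of_F_Comp:
  "coeff_of (F_qsym (Comp \<pi>)) m
    = (if total_degree m = len \<pi> \<and> Des \<pi> \<subseteq> descents (parts (comp_of m)) then 1 else 0)"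
  by (simp add: coeff_of_F_qsym sum_list_Comp descents_Comp)

section \<open>Products of fundamental quasisymmetric functions\<close>

text \<open>A lexicographically increasing sequence of pairs is represented by the set of its entries.\<close>

definition biwords :: "permutation \<Rightarrow> (nat \<times> nat) set set"
  where "biwords \<pi> = {X. finite X \<and> List.map snd (sorted_list_of_set X) = letters \<pi>}"

definition biword_monomial :: "(nat \<times> nat) set \<Rightarrow> monomial"
  where "biword_monomial X = (\<Sum>p\<in>X. Poly_Mapping.single (fst p) 1)"

lemma biword_monomial_eq:
  "finite X \<Longrightarrow> biword_monomial X = word_monomial (List.map fst (sorted_list_of_set X))"
  by (simp add: biword_monomial_def word_monomial_def sum_list_distinct_conv_sum_set o_def)

lemma distinct_letters: "distinct (letters \<pi>)" and zero_notin_letters: "0 \<notin> set (letters \<pi>)"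
  using letters[of \<pi>] by auto

text \<open>A word \<open>i\<^sub>1 \<le> \<dots> \<le> i\<^sub>n\<close> that increases strictly at the descents of \<open>\<pi>\<close> is the same as a
  lexicographically increasing sequence of pairs \<open>(i\<^sub>k, \<pi>\<^sub>k)\<close>.\<close>

lemma sorted_zip_letters_iff:
  assumes "length is = len \<pi>"
  shows "sorted_wrt (<) (zip is (letters \<pi>)) \<longleftrightarrow> sorted is \<and> (\<forall>j\<in>Des \<pi>. is ! (j - 1) < is ! j)"
proof -
  have len: "length is = length (letters \<pi>)" using assms by (simp add: len_eq)
  have neq: "letters \<pi> ! i \<noteq> letters \<pi> ! Suc i" if "Suc i < length is" for i
    using distinct_letters[of \<pi>] that len by (simp add: nth_eq_iff_index_eq)
  have "sorted_wrt (<) (zip is (letters \<pi>))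
      \<longleftrightarrow> (\<forall>i. Suc i < length is \<longrightarrow> zip is (letters \<pi>) ! i < zip is (letters \<pi>) ! Suc i)"
    by (subst sorted_wrt_iff_nth_Suc_transp) (auto simp: len transp_on_def)
  also have "\<dots> \<longleftrightarrow> (\<forall>i. Suc i < length is \<longrightarrow> is ! i \<le> is ! Suc i)
      \<and> (\<forall>i. Suc i < length is \<longrightarrow> letters \<pi> ! i > letters \<pi> ! Suc i \<longrightarrow> is ! i < is ! Suc i)"
    using neq by (auto simp: len less_prod_def nat_less_le)
  also have "(\<forall>i. Suc i < length is \<longrightarrow> letters \<pi> ! i > letters \<pi> ! Suc i \<longrightarrow> is ! i < is ! Suc i)
      \<longleftrightarrow> (\<forall>j\<in>Des \<pi>. is ! (j - 1) < is ! j)"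
  proof (intro iffI ballI allI impI)
    fix j assume "\<forall>i. Suc i < length is \<longrightarrow> letters \<pi> ! i > letters \<pi> ! Suc i \<longrightarrow> is ! i < is ! Suc i"
      and "j \<in> Des \<pi>"
    then show "is ! (j - 1) < is ! j" using assms by (cases j) (auto simp: Des_def)
  next
    fix i assume "\<forall>j\<in>Des \<pi>. is ! (j - 1) < is ! j" "Suc i < length is" "letters \<pi> ! Suc i < letters \<pi> ! i"
    moreover from this have "Suc i \<in> Des \<pi>" using assms by (simp add: Des_def)
    ultimately show "is ! i < is ! Suc i" by fastforce
  qed
  finally show ?thesis by (simp add: sorted_iff_nth_Suc)
qed

text \<open>Zipping an admissible word with the letters of \<open>\<pi>\<close> gives a biword with
  the same monomial; projection to first components is the inverse.\<close>

lemma
  shows finite_biwords: "finite {X \<in> biwords \<pi>. biword_monomial X = m}"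
    and coeff_of_F_Comp_biwords:
      "coeff_of (F_qsym (Comp \<pi>)) m = of_nat (card {X \<in> biwords \<pi>. biword_monomial X = m})"
proof -
  let ?W = "{is. length is = len \<pi> \<and> sorted is \<and> (\<forall>j\<in>Des \<pi>. is ! (j - 1) < is ! j)
    \<and> word_monomial is = m}"
  let ?s = "sorted_list_of_set :: (nat \<times> nat) set \<Rightarrow> _"
  have bij: "bij_betw (\<lambda>is. set (zip is (letters \<pi>))) ?W {X \<in> biwords \<pi>. biword_monomial X = m}"
  proof (rule bij_betw_byWitness[where f' = "\<lambda>X. List.map fst (?s X)"])
    have s: "?s (set (zip is (letters \<pi>))) = zip is (letters \<pi>)" if "is \<in> ?W" for "is"
    proof -
      have "sorted_wrt (<) (zip is (letters \<pi>))"
        using that sorted_zip_letters_iff[of "is" \<pi>] by simp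
      then show ?thesis
        by (simp add: strict_sorted_iff sorted_list_of_set.idem_if_sorted_distinct)
    qed
    show "\<forall>is\<in>?W. List.map fst (?s (set (zip is (letters \<pi>)))) = is"
      using s by (simp add: len_eq)
    show "(\<lambda>is. set (zip is (letters \<pi>))) ` ?W \<subseteq> {X \<in> biwords \<pi>. biword_monomial X = m}"
      using s by (auto simp: biwords_def biword_monomial_eq len_eq)
    have zip: "zip (List.map fst (?s X)) (letters \<pi>) = ?s X" if "X \<in> biwords \<pi>" for X
      using that by (metis (mono_tags, lifting) biwords_def mem_Collect_eq zip_map_fst_snd)
    show "\<forall>X\<in>{X \<in> biwords \<pi>. biword_monomial X = m}. set (zip (List.map fst (?s X)) (letters \<pi>)) = X"
      using zip by (simp add: biwords_def)
    show "(\<lambda>X. List.map fst (?s X)) ` {X \<in> biwords \<pi>. biword_monomial X = m} \<subseteq> ?W"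
    proof clarify
      fix X assume X: "X \<in> biwords \<pi>"
      let ?w = "List.map fst (?s X)"
      have len: "length ?w = len \<pi>"
        using X by (simp add: biwords_def len_eq) (metis length_map length_sorted_list_of_set)
      have "sorted_wrt (<) (zip ?w (letters \<pi>))" using zip[OF X] by simp
      then show "length ?w = len \<pi> \<and> sorted ?w \<and> (\<forall>j\<in>Des \<pi>. ?w ! (j - 1) < ?w ! j)
          \<and> word_monomial ?w = biword_monomial X"
        using X len sorted_zip_letters_iff[OF len] by (simp add: biwords_def biword_monomial_eq)
    qed
  qed
  have "?W \<subseteq> {word_of m}" using sorted_word_unique[of _ m] by blast
  then have "finite ?W" by (rule finite_subset) simp
  then show "finite {X \<in> biwords \<pi>. biword_monomial X = m}" using bij_betw_finite[OF bij] by simp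
  have "coeff_of (F_qsym (Comp \<pi>)) m = of_nat (card ?W)"
    unfolding F_qsym.rep_eq descents_def[symmetric] descents_Comp sum_list_Comp ..
  then show "coeff_of (F_qsym (Comp \<pi>)) m = of_nat (card {X \<in> biwords \<pi>. biword_monomial X = m})"
    using bij_betw_same_card[OF bij] by simp
qed

section \<open>Shuffles as unions of biwords\<close>

lemma sorted_list_of_set_filter:
  assumes "finite A"
  shows "filter P (sorted_list_of_set A) = sorted_list_of_set {x \<in> A. P x}"
  by (rule strict_sorted_equal) (use assms in \<open>simp_all add: sorted_wrt_filter\<close>)

lemma
  assumes "X \<in> biwords \<pi>"
  shows biwords_finite: "finite X"
    and biwords_letters: "List.map snd (sorted_list_of_set X) = letters \<pi>"
    and biwords_snd_image: "snd ` X = set (letters \<pi>)"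
    and biwords_inj: "inj_on snd X"
    and biwords_card: "card X = len \<pi>"
proof -
  show fin: "finite X" and l: "List.map snd (sorted_list_of_set X) = letters \<pi>"
    using assms by (simp_all add: biwords_def)
  have "set (List.map snd (sorted_list_of_set X)) = set (letters \<pi>)" by (simp only: l)
  then show "snd ` X = set (letters \<pi>)" using fin by simp
  have "distinct (List.map snd (sorted_list_of_set X))" by (simp only: l distinct_letters)
  then show "inj_on snd X" using fin by (simp add: distinct_map)
  have "length (List.map snd (sorted_list_of_set X)) = len \<pi>" by (simp only: l len_eq)
  then show "card X = len \<pi>" by simp
qed

text \<open>By counting: the length of \<open>\<tau>\<close> leaves no room for letters outside the
  two permutations.\<close>

lemma shuffle_set_letters:
  assumes "disjoint_perms \<pi> \<sigma>" "\<tau> \<in> shuffle_set \<pi> \<sigma>"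
  shows "set (letters \<tau>) = set (letters \<pi>) \<union> set (letters \<sigma>)"
proof (rule sym, rule card_subset_eq)
  show "set (letters \<pi>) \<union> set (letters \<sigma>) \<subseteq> set (letters \<tau>)"
    using assms(2) by (auto simp: shuffle_set_def elim: list_emb_set)
  show "card (set (letters \<pi>) \<union> set (letters \<sigma>)) = card (set (letters \<tau>))"
    using assms by (simp add: card_Un_disjoint disjoint_perms_def distinct_card distinct_letters
        shuffle_set_def len_eq)
qed simp

text \<open>Filtering preserves the subsequence, and distinctness of the letters of
  \<open>\<tau>\<close> keeps the result from being longer.\<close>

lemma subseq_filter_letters:
  assumes "subseq (letters \<pi>) (letters \<tau>)"
  shows "filter (\<lambda>x. x \<in> set (letters \<pi>)) (letters \<tau>) = letters \<pi>"
proof (rule sym, rule subseq_same_length)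
  let ?P = "\<lambda>x. x \<in> set (letters \<pi>)"
  have "subseq (filter ?P (letters \<pi>)) (filter ?P (letters \<tau>))"
    using assms by (rule subseq_filter)
  moreover have "filter ?P (letters \<pi>) = letters \<pi>" by (simp add: filter_id_conv)
  ultimately show sub: "subseq (letters \<pi>) (filter ?P (letters \<tau>))" by simp
  have "length (filter ?P (letters \<tau>)) = card (set (filter ?P (letters \<tau>)))"
    by (simp add: distinct_card distinct_letters del: set_filter)
  also have "\<dots> \<le> card (set (letters \<pi>))"
    by (rule card_mono) auto
  also have "\<dots> = length (letters \<pi>)" by (simp add: distinct_card distinct_letters)
  finally show "length (letters \<pi>) = length (filter ?P (letters \<tau>))"
    using list_emb_length[OF sub] by simp
qed

lemma finite_shuffle_set:
  assumes "disjoint_perms \<pi> \<sigma>"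
  shows "finite (shuffle_set \<pi> \<sigma>)"
proof (rule finite_subset)
  let ?L = "{xs. set xs \<subseteq> set (letters \<pi>) \<union> set (letters \<sigma>) \<and> length xs = len \<pi> + len \<sigma>}"
  show "shuffle_set \<pi> \<sigma> \<subseteq> Perm ` ?L"
  proof
    fix \<tau> assume \<tau>: "\<tau> \<in> shuffle_set \<pi> \<sigma>"
    then have "letters \<tau> \<in> ?L"
      using shuffle_set_letters[OF assms \<tau>] by (simp add: shuffle_set_def len_eq)
    then show "\<tau> \<in> Perm ` ?L" by (intro image_eqI[of _ _ "letters \<tau>"]) (simp_all add: letters_inverse)
  qed
  show "finite (Perm ` ?L)" by (intro finite_imageI finite_lists_length_eq) simp
qed

lemma biword_monomial_Un:
  "finite X \<Longrightarrow> finite Y \<Longrightarrow> X \<inter> Y = {}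
    \<Longrightarrow> biword_monomial (X \<union> Y) = biword_monomial X + biword_monomial Y"
  by (simp add: biword_monomial_def sum.union_disjoint)

text \<open>Because biwords are sets, merging is union, and lexicographic order does the
  interleaving. Selecting pairs by their letter undoes the merge.\<close>

lemma bij_betw_biwords_Un:
  assumes disj: "disjoint_perms \<pi> \<sigma>"
  shows "bij_betw (\<lambda>(X, Y). X \<union> Y)
    {(X, Y). X \<in> biwords \<pi> \<and> Y \<in> biwords \<sigma> \<and> biword_monomial X + biword_monomial Y = m}
    (\<Union>\<tau>\<in>shuffle_set \<pi> \<sigma>. {Z \<in> biwords \<tau>. biword_monomial Z = m})" (is "bij_betw _ ?A ?B")
proof (rule bij_betw_byWitness[where
      f' = "\<lambda>Z. ({p \<in> Z. snd p \<in> set (letters \<pi>)}, {p \<in> Z. snd p \<in> set (letters \<sigma>)})"])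
  let ?p = "\<lambda>Z. {p \<in> Z. snd p \<in> set (letters \<pi>)}" and ?s = "\<lambda>Z. {p \<in> Z. snd p \<in> set (letters \<sigma>)}"
  have disj': "set (letters \<pi>) \<inter> set (letters \<sigma>) = {}" using disj by (simp add: disjoint_perms_def)
  have split: "?p (X \<union> Y) = X" "?s (X \<union> Y) = Y" "X \<inter> Y = {}" if "X \<in> biwords \<pi>" "Y \<in> biwords \<sigma>" for X Y
  proof -
    have "snd p \<in> set (letters \<pi>)" if "p \<in> X" for p
      using that biwords_snd_image[OF \<open>X \<in> _\<close>] by blast
    moreover have "snd p \<in> set (letters \<sigma>)" if "p \<in> Y" for p
      using that biwords_snd_image[OF \<open>Y \<in> _\<close>] by blast
    ultimately show "?p (X \<union> Y) = X" "?s (X \<union> Y) = Y" "X \<inter> Y = {}"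
      using disj' by blast+
  qed
  show "\<forall>a\<in>?A. (\<lambda>Z. (?p Z, ?s Z)) (case a of (X, Y) \<Rightarrow> X \<union> Y) = a"
    using split by auto
  have Z: "?p Z \<union> ?s Z = Z" if "\<tau> \<in> shuffle_set \<pi> \<sigma>" "Z \<in> biwords \<tau>" for \<tau> Z
    using biwords_snd_image[OF that(2)] shuffle_set_letters[OF disj that(1)] by blast
  then show "\<forall>Z\<in>?B. (case (?p Z, ?s Z) of (X, Y) \<Rightarrow> X \<union> Y) = Z" by auto
  show "(\<lambda>(X, Y). X \<union> Y) ` ?A \<subseteq> ?B"
  proof clarify
    fix X Y assume X: "X \<in> biwords \<pi>" and Y: "Y \<in> biwords \<sigma>" and m: "m = biword_monomial X + biword_monomial Y"
    note fin = biwords_finite[OF X] biwords_finite[OF Y]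
    \<comment> \<open>The shuffle is read off the merged biword: its second components in
      lexicographic order.\<close>
    let ?l = "List.map snd (sorted_list_of_set (X \<union> Y))"
    have set_l: "set ?l = set (letters \<pi>) \<union> set (letters \<sigma>)"
      using fin biwords_snd_image[OF X] biwords_snd_image[OF Y] by (simp add: image_Un)
    have "inj_on snd (X \<union> Y)"
      using biwords_inj[OF X] biwords_inj[OF Y] biwords_snd_image[OF X] biwords_snd_image[OF Y] disj'
      unfolding inj_on_Un by blast
    then have "distinct ?l" using fin by (simp add: distinct_map)
    moreover have "0 \<notin> set ?l" unfolding set_l by (simp add: zero_notin_letters)
    ultimately have l: "letters (Perm ?l) = ?l" by (intro Perm_inverse) simp
    have "subseq (letters \<rho>) ?l" if "{p \<in> X \<union> Y. snd p \<in> set (letters \<rho>)} = W" "W \<in> biwords \<rho>" for \<rho> W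
    proof -
      have "subseq (List.map snd (filter (\<lambda>p. snd p \<in> set (letters \<rho>)) (sorted_list_of_set (X \<union> Y)))) ?l"
        by (intro subseq_map subseq_filter_left)
      then show ?thesis
        using fin that by (simp add: sorted_list_of_set_filter biwords_letters)
    qed
    from this[OF split(1)[OF X Y] X] this[OF split(2)[OF X Y] Y]
    have "Perm ?l \<in> shuffle_set \<pi> \<sigma>"
      using fin split(3)[OF X Y]
      by (simp add: shuffle_set_def l len_eq[of "Perm ?l"] card_Un_disjoint biwords_card[OF X] biwords_card[OF Y])
    moreover have "X \<union> Y \<in> biwords (Perm ?l)" using fin by (simp add: biwords_def l)
    ultimately show "X \<union> Y \<in> (\<Union>\<tau>\<in>shuffle_set \<pi> \<sigma>.
        {Z \<in> biwords \<tau>. biword_monomial Z = biword_monomial X + biword_monomial Y})"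
      using fin split(3)[OF X Y] by (auto simp: biword_monomial_Un)
  qed
  show "(\<lambda>Z. (?p Z, ?s Z)) ` ?B \<subseteq> ?A"
  proof clarify
    fix \<tau> Z assume \<tau>: "\<tau> \<in> shuffle_set \<pi> \<sigma>" and Z': "Z \<in> biwords \<tau>"
    have fin: "finite Z" by (rule biwords_finite[OF Z'])
    have *: "{p \<in> Z. snd p \<in> set (letters \<rho>)} \<in> biwords \<rho>" if "subseq (letters \<rho>) (letters \<tau>)" for \<rho>
    proof -
      have "List.map snd (sorted_list_of_set {p \<in> Z. snd p \<in> set (letters \<rho>)})
          = filter (\<lambda>x. x \<in> set (letters \<rho>)) (List.map snd (sorted_list_of_set Z))"
        using fin by (simp add: filter_map o_def sorted_list_of_set_filter)
      also have "\<dots> = letters \<rho>"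
        using that by (simp add: biwords_letters[OF Z'] subseq_filter_letters)
      finally show ?thesis using fin by (simp add: biwords_def)
    qed
    have "?p Z \<in> biwords \<pi>" "?s Z \<in> biwords \<sigma>"
      using \<tau> * by (auto simp: shuffle_set_def)
    moreover have "biword_monomial (?p Z) + biword_monomial (?s Z) = biword_monomial Z"
      using fin disj' Z[OF \<tau> Z'] by (subst biword_monomial_Un[symmetric]) auto
    ultimately show "?p Z \<in> biwords \<pi> \<and> ?s Z \<in> biwords \<sigma>
        \<and> biword_monomial (?p Z) + biword_monomial (?s Z) = biword_monomial Z" by simp
  qed
qed

text \<open>Both coefficients count the same objects: pairs of biwords grouped by the factorization
  of \<open>m\<close>, and their unions grouped by the shuffle they spell.\<close>

lemma F_Comp_mult:
  assumes disj: "disjoint_perms \<pi> \<sigma>"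
  shows "qsym_mult (F_qsym (Comp \<pi>)) (F_qsym (Comp \<sigma>)) = (\<Sum>\<tau>\<in>shuffle_set \<pi> \<sigma>. F_qsym (Comp \<tau>))"
proof (rule qsym_eqI)
  fix m :: monomial
  let ?B = "\<lambda>\<pi> m. {X \<in> biwords \<pi>. biword_monomial X = m}"
  let ?S = "{(a, b). a + b = m}"
  have "coeff_of (qsym_mult (F_qsym (Comp \<pi>)) (F_qsym (Comp \<sigma>))) m
      = of_nat (\<Sum>p\<in>?S. card (?B \<pi> (fst p) \<times> ?B \<sigma> (snd p)))"
    by (simp add: qsym_mult.rep_eq coeff_of_F_Comp_biwords card_cartesian_product case_prod_unfold)
  also have "(\<Sum>p\<in>?S. card (?B \<pi> (fst p) \<times> ?B \<sigma> (snd p))) = card (\<Union>p\<in>?S. ?B \<pi> (fst p) \<times> ?B \<sigma> (snd p))"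
    by (rule card_UN_disjoint[symmetric])
      (use finite_monomial_sums finite_biwords in \<open>auto intro!: finite_cartesian_product\<close>)
  also have "(\<Union>p\<in>?S. ?B \<pi> (fst p) \<times> ?B \<sigma> (snd p))
      = {(X, Y). X \<in> biwords \<pi> \<and> Y \<in> biwords \<sigma> \<and> biword_monomial X + biword_monomial Y = m}"
    by auto
  also have "card \<dots> = card (\<Union>\<tau>\<in>shuffle_set \<pi> \<sigma>. ?B \<tau> m)"
    by (rule bij_betw_same_card[OF bij_betw_biwords_Un[OF disj]])
  also have "\<dots> = (\<Sum>\<tau>\<in>shuffle_set \<pi> \<sigma>. card (?B \<tau> m))"
  proof (rule card_UN_disjoint)
    show "\<forall>\<tau>\<in>shuffle_set \<pi> \<sigma>. \<forall>\<rho>\<in>shuffle_set \<pi> \<sigma>. \<tau> \<noteq> \<rho> \<longrightarrow> ?B \<tau> m \<inter> ?B \<rho> m = {}"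
      by (auto simp: biwords_def letters_inject)
  qed (use finite_shuffle_set[OF disj] finite_biwords in auto)
  finally show "coeff_of (qsym_mult (F_qsym (Comp \<pi>)) (F_qsym (Comp \<sigma>))) m
      = coeff_of (\<Sum>\<tau>\<in>shuffle_set \<pi> \<sigma>. F_qsym (Comp \<tau>)) m"
    by (simp add: coeff_of_simps coeff_of_F_Comp_biwords)
qed

section \<open>The isomorphism\<close>

lemma qlinear_Des_to_QSym: "qlinear Des_to_QSym"
  unfolding Des_to_QSym_def by (rule qlinear_linear_extension)

lemma Des_to_QSym_basis: "Des_to_QSym [\<pi>]\<^sub>D\<^sub>e\<^sub>s = F_qsym (Comp \<pi>)"
  by (simp add: Des_to_QSym_def Des_basis_def des_class_Comp.abs_eq)

lemma des_class_cases:
  obtains \<pi> where "c = abs_des_class \<pi>"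
  by (metis Quotient3_abs_rep[OF Quotient3_des_class])

lemma ex_permutation:
  assumes "S \<subseteq> {1..<n}"
  shows "\<exists>\<pi>. len \<pi> = n \<and> Des \<pi> = S"
proof -
  \<comment> \<open>Each descent drops into the next lower block of length \<open>n + 1\<close>; inside a block \<open>v\<close> increases.\<close>
  define v where "v i = (n - card (S \<inter> {..i})) * Suc n + Suc i" for i
  have fin: "finite S" using assms by (rule finite_subset) simp
  have le: "card (S \<inter> {..i}) \<le> n" for i
    using card_mono[of "{1..<n}" "S \<inter> {..i}"] assms by fastforce
  \<comment> \<open>The residue remembers the position, which makes the letters distinct.\<close>
  have v_mod: "v i mod Suc n = Suc i" if "i < n" for i
    unfolding v_def using that by (simp only: mod_mult_self3) simp
  have desc: "v i > v (Suc i) \<longleftrightarrow> Suc i \<in> S" if "Suc i < n" for i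
  proof (cases "Suc i \<in> S")
    case True
    then have "S \<inter> {..Suc i} = insert (Suc i) (S \<inter> {..i})" by (auto simp: le_Suc_eq)
    then have "card (S \<inter> {..Suc i}) = Suc (card (S \<inter> {..i}))" using fin by simp
    moreover from this have "n - card (S \<inter> {..i}) = Suc (n - card (S \<inter> {..Suc i}))"
      using le[of "Suc i"] by simp
    ultimately have "v i = v (Suc i) + n" by (simp add: v_def)
    then show ?thesis using True that by simp
  next
    case False
    then have "S \<inter> {..Suc i} = S \<inter> {..i}" by (auto simp: le_Suc_eq)
    then show ?thesis using False by (simp add: v_def)
  qed
  let ?xs = "List.map v [0..<n]"
  have "distinct ?xs"
    unfolding distinct_map by (auto intro!: inj_onI dest: arg_cong[of _ _ "\<lambda>x. x mod Suc n"] simp: v_mod)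
  moreover have "0 \<notin> set ?xs" by (auto simp: v_def)
  ultimately have l: "letters (Perm ?xs) = ?xs" by (intro Perm_inverse) simp
  have len: "len (Perm ?xs) = n" by (simp add: len_eq l)
  have "i \<in> Des (Perm ?xs) \<longleftrightarrow> i \<in> S" for i
  proof (cases "1 \<le> i \<and> i < n")
    case True
    then obtain j where "i = Suc j" by (cases i) auto
    then show ?thesis using True desc[of j] by (simp add: Des_def len l)
  next
    case False
    then show ?thesis using assms by (auto simp: Des_def len)
  qed
  then show ?thesis using len by (intro exI[of _ "Perm ?xs"]) auto
qed

lemma ex_Comp: "\<exists>\<pi>. Comp \<pi> = \<alpha>"
proof -
  have "descents (parts \<alpha>) \<subseteq> {1..<sum_list (parts \<alpha>)}"
    using descents_bounds[of "parts \<alpha>"] parts_pos by (auto simp: Suc_le_eq)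
  then obtain \<pi> where "len \<pi> = sum_list (parts \<alpha>)" "Des \<pi> = descents (parts \<alpha>)"
    using ex_permutation by blast
  then have "Comp \<pi> = \<alpha>" by (intro composition_eqI) (simp_all add: sum_list_Comp descents_Comp)
  then show ?thesis ..
qed

text \<open>At the packed monomial of \<open>Comp \<pi>\<close>, a class of the same length
  contributes only if its descent set lies in \<open>Des \<pi>\<close>. A class with fewest descents
  in the support of \<open>v\<close> is then the only contributor.\<close>

lemma inj_Des_to_QSym: "inj Des_to_QSym"
proof -
  have "v = 0" if v: "Des_to_QSym v = 0" for v
  proof (rule ccontr)
    assume "v \<noteq> 0"
    define d where "d c = card (descents (parts (des_class_Comp c)))" for c
    from \<open>v \<noteq> 0\<close> have "Poly_Mapping.keys v \<noteq> {}" by simp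
    then obtain c where c: "c \<in> Poly_Mapping.keys v" "\<And>c'. c' \<in> Poly_Mapping.keys v \<Longrightarrow> d c \<le> d c'"
      using ex_is_arg_min_if_finite[of "Poly_Mapping.keys v" d] by (auto simp: is_arg_min_linorder)
    obtain \<pi> where \<pi>: "c = abs_des_class \<pi>" by (rule des_class_cases)
    let ?m = "std_monomial (Comp \<pi>)"
    have coeff: "coeff_of (F_qsym (des_class_Comp c')) ?m = (if c' = c then 1 else 0)"
      if c': "c' \<in> Poly_Mapping.keys v" for c'
    proof -
      obtain \<rho> where \<rho>: "c' = abs_des_class \<rho>" by (rule des_class_cases)
      have "card (Des \<pi>) \<le> card (Des \<rho>)"
        using c(2)[OF c'] by (simp add: d_def \<pi> \<rho> des_class_Comp.abs_eq descents_Comp)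
      then have "Des \<rho> \<subseteq> Des \<pi> \<longleftrightarrow> Des \<rho> = Des \<pi>"
        using card_seteq[OF finite_Des] by blast
      then show ?thesis
        by (auto simp: \<pi> \<rho> des_class_Comp.abs_eq coeff_of_F_Comp total_degree_comp_of descents_Comp
            sum_list_Comp des_class.abs_eq_iff Des_equiv_def)
    qed
    have "0 = coeff_of (Des_to_QSym v) ?m" by (simp add: v coeff_of_simps)
    also have "\<dots> = (\<Sum>c'\<in>Poly_Mapping.keys v. Poly_Mapping.lookup v c' * (if c' = c then 1 else 0))"
      by (simp add: Des_to_QSym_def linear_extension_def coeff_of_simps coeff)
    also have "\<dots> = Poly_Mapping.lookup v c" using c(1) by (simp add: if_distrib[of "\<lambda>x. _ * x"] cong: if_cong)
    finally show False using c(1) by (simp add: in_keys_iff)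
  qed
  then show ?thesis
    by (intro injI) (metis eq_iff_diff_eq_0 qlinearD(5)[OF qlinear_Des_to_QSym])
qed

text \<open>The compositions summed over are the refinements of \<open>\<alpha>\<close>, with
  \<open>\<alpha>\<close> itself as the coarsest.\<close>

lemma F_qsym_eq_sum_M:
  "F_qsym \<alpha> = (\<Sum>\<beta> | sum_list (parts \<beta>) = sum_list (parts \<alpha>) \<and> descents (parts \<alpha>) \<subseteq> descents (parts \<beta>).
    M_qsym \<beta>)" (is "_ = (\<Sum>\<beta> | ?P \<beta>. _)")
proof (rule qsym_eqI)
  fix m
  have "finite {\<beta>. ?P \<beta>}"
    by (rule finite_subset[OF _ finite_bounded_compositions[of "sum_list (parts \<alpha>)"]]) auto
  then show "coeff_of (F_qsym \<alpha>) m = coeff_of (\<Sum>\<beta> | ?P \<beta>. M_qsym \<beta>) m"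
    by (simp add: coeff_of_simps coeff_of_F_qsym coeff_of_M_qsym total_degree_comp_of)
qed

text \<open>The unitriangular expansion is solved for its coarsest term. The other terms are proper
  refinements with more descents, whose number is bounded by the degree, so the measure
  drops.\<close>

lemma M_qsym_in_range: "M_qsym \<alpha> \<in> range Des_to_QSym"
proof (induction "sum_list (parts \<alpha>) - card (descents (parts \<alpha>))" arbitrary: \<alpha> rule: less_induct)
  case less
  let ?Q = "\<lambda>\<beta>. sum_list (parts \<beta>) = sum_list (parts \<alpha>) \<and> descents (parts \<alpha>) \<subset> descents (parts \<beta>)"
  have fin: "finite {\<beta>. ?Q \<beta>}"
    by (rule finite_subset[OF _ finite_bounded_compositions[of "sum_list (parts \<alpha>)"]]) auto
  have eq: "{\<beta>. sum_list (parts \<beta>) = sum_list (parts \<alpha>) \<and> descents (parts \<alpha>) \<subseteq> descents (parts \<beta>)}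
      = insert \<alpha> {\<beta>. ?Q \<beta>}"
    using composition_eqI[of _ \<alpha>] by (auto simp: psubset_eq)
  have "M_qsym \<beta> \<in> range Des_to_QSym" if "?Q \<beta>" for \<beta>
  proof (rule less)
    have sub: "descents (parts \<beta>) \<subseteq> {1..<sum_list (parts \<beta>)}"
      using descents_bounds[of "parts \<beta>"] parts_pos by (auto simp: Suc_le_eq)
    then have "finite (descents (parts \<beta>))" by (rule finite_subset) simp
    then have "card (descents (parts \<alpha>)) < card (descents (parts \<beta>))"
      using that by (intro psubset_card_mono) auto
    moreover have "card (descents (parts \<beta>)) \<le> sum_list (parts \<beta>)"
      using card_mono[OF _ sub] by simp
    ultimately show "sum_list (parts \<beta>) - card (descents (parts \<beta>))
        < sum_list (parts \<alpha>) - card (descents (parts \<alpha>))" using that by simp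
  qed
  then have "\<forall>\<beta>. \<exists>u. ?Q \<beta> \<longrightarrow> M_qsym \<beta> = Des_to_QSym u" by blast
  from choice[OF this] obtain u where u: "\<And>\<beta>. ?Q \<beta> \<Longrightarrow> M_qsym \<beta> = Des_to_QSym (u \<beta>)" by blast
  obtain \<pi> where \<pi>: "Comp \<pi> = \<alpha>" using ex_Comp by blast
  have "Des_to_QSym [\<pi>]\<^sub>D\<^sub>e\<^sub>s = M_qsym \<alpha> + (\<Sum>\<beta> | ?Q \<beta>. M_qsym \<beta>)"
    unfolding Des_to_QSym_basis \<pi> F_qsym_eq_sum_M eq using fin by (subst sum.insert) auto
  also have "(\<Sum>\<beta> | ?Q \<beta>. M_qsym \<beta>) = Des_to_QSym (\<Sum>\<beta> | ?Q \<beta>. u \<beta>)"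
    by (simp add: u qlinearD(4)[OF qlinear_Des_to_QSym])
  finally have "M_qsym \<alpha> = Des_to_QSym ([\<pi>]\<^sub>D\<^sub>e\<^sub>s - (\<Sum>\<beta> | ?Q \<beta>. u \<beta>))"
    by (simp only: qlinearD(5)[OF qlinear_Des_to_QSym]) simp
  then show ?case by blast
qed

lemma surj_Des_to_QSym: "surj Des_to_QSym"
proof -
  have "\<forall>\<alpha>. \<exists>u. M_qsym \<alpha> = Des_to_QSym u" using M_qsym_in_range by blast
  from choice[OF this] obtain u where u: "\<And>\<alpha>. M_qsym \<alpha> = Des_to_QSym (u \<alpha>)" by blast
  have "Des_to_QSym (linear_extension u (M_coords f)) = f" for f
    by (simp add: linear_linear_extension[OF qlinear_Des_to_QSym] linear_extension_M_coords flip: u)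
  then show ?thesis by (rule surjI)
qed

text \<open>Adding a constant beyond all letters of \<open>\<pi>\<close> preserves every comparison
  among the letters of \<open>\<sigma>\<close>.\<close>

lemma ex_disjoint_representative:
  "\<exists>\<sigma>'. abs_des_class \<sigma>' = abs_des_class \<sigma> \<and> disjoint_perms \<pi> \<sigma>'"
proof -
  obtain N where N: "\<And>x. x \<in> set (letters \<pi>) \<Longrightarrow> x < N"
    using finite_nat_set_iff_bounded[of "set (letters \<pi>)"] by auto
  let ?xs = "List.map (\<lambda>x. x + N) (letters \<sigma>)"
  have "distinct ?xs" "0 \<notin> set ?xs"
    using distinct_letters[of \<sigma>] zero_notin_letters[of \<sigma>] by (auto simp: distinct_map)
  then have l: "letters (Perm ?xs) = ?xs" by (intro Perm_inverse) simp
  have "Des_equiv (Perm ?xs) \<sigma>" by (auto simp: Des_equiv_def Des_def len_eq l)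
  moreover have "disjoint_perms \<pi> (Perm ?xs)" using N by (force simp: disjoint_perms_def l)
  ultimately show ?thesis by (auto simp: des_class.abs_eq_iff)
qed

lemma Des_to_QSym_des_class_mult:
  "Des_to_QSym (des_class_mult c d) = qsym_mult (F_qsym (des_class_Comp c)) (F_qsym (des_class_Comp d))"
proof -
  let ?s = "\<lambda>\<pi> \<sigma>. \<Sum>\<tau>\<in>shuffle_set \<pi> \<sigma>. [\<tau>]\<^sub>D\<^sub>e\<^sub>s"
  let ?P = "\<lambda>v. \<forall>\<pi> \<sigma>. abs_des_class \<pi> = c \<longrightarrow> abs_des_class \<sigma> = d \<longrightarrow> disjoint_perms \<pi> \<sigma> \<longrightarrow> v = ?s \<pi> \<sigma>"
  have s: "Des_to_QSym (?s \<pi> \<sigma>) = qsym_mult (F_qsym (des_class_Comp c)) (F_qsym (des_class_Comp d))"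
    if "abs_des_class \<pi> = c" "abs_des_class \<sigma> = d" "disjoint_perms \<pi> \<sigma>" for \<pi> \<sigma>
    using F_Comp_mult[OF that(3)]
    by (simp add: qlinearD(4)[OF qlinear_Des_to_QSym] Des_to_QSym_basis des_class_Comp.abs_eq
        flip: that(1,2))
  obtain \<pi> where \<pi>: "abs_des_class \<pi> = c" by (metis des_class_cases)
  obtain \<sigma> where \<sigma>: "abs_des_class \<sigma> = d" "disjoint_perms \<pi> \<sigma>"
    by (metis des_class_cases ex_disjoint_representative)
  have "des_class_mult c d = ?s \<pi> \<sigma>"
    unfolding des_class_mult_def
  proof (rule the_equality)
    \<comment> \<open>Shuffle-compatibility: by \<open>s\<close> all disjoint representatives give
      sums with the same image, and injectivity makes the sums equal.\<close>
    show "?P (?s \<pi> \<sigma>)"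
      using s \<pi> \<sigma> inj_Des_to_QSym by (metis injD)
    show "?P v \<Longrightarrow> v = ?s \<pi> \<sigma>" for v using \<pi> \<sigma> by blast
  qed
  then show ?thesis using s[OF \<pi> \<sigma>] by simp
qed

text \<open>The degree of \<open>a\<close> singles out one cut. Descents before it are tested
  against \<open>a\<close>, those behind it against \<open>b\<close>; a descent at the cut itself is
  always permitted, since the word of the glued monomial rises there.\<close>

lemma coeff_of_F_Comp_glue:
  assumes "Poly_Mapping.keys a \<subseteq> {..<N}"
  shows "coeff_of (F_qsym (Comp \<pi>)) (glue N a b)
    = (\<Sum>i\<le>len \<pi>. coeff_of (F_qsym (Comp (prefix_perm i \<pi>))) a * coeff_of (F_qsym (Comp (suffix_perm i \<pi>))) b)"
proof -
  let ?a = "parts (comp_of a)" and ?b = "parts (comp_of b)"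
  let ?C = "total_degree a + total_degree b = len \<pi> \<and> Des \<pi> \<subseteq> descents (?a @ ?b)"
  have parts: "parts (comp_of (glue N a b)) = ?a @ ?b"
    by (simp add: comp_of_glue[OF assms] comp_append.rep_eq)
  have len: "len (prefix_perm i \<pi>) = i" "len (suffix_perm i \<pi>) = len \<pi> - i" if "i \<le> len \<pi>" for i
    using that by (simp_all add: len_eq letters_prefix_perm letters_suffix_perm)
  have iff: "(Des \<pi> \<subseteq> descents (?a @ ?b)) \<longleftrightarrow> {j \<in> Des \<pi>. j < i} \<subseteq> descents ?a
      \<and> {j. 1 \<le> j \<and> i + j \<in> Des \<pi>} \<subseteq> descents ?b"
    if i: "i = sum_list ?a" "i + sum_list ?b = len \<pi>" for i
  proof -
    have bounds: "0 < j \<and> j < i" if "j \<in> descents ?a" for j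
      using descents_bounds[OF _ that] parts_pos i by auto
    have bounds': "0 < j \<and> j < sum_list ?b" if "j \<in> descents ?b" for j
      using descents_bounds[OF _ that] parts_pos i by auto
    have D: "0 < j \<and> j < len \<pi>" if "j \<in> Des \<pi>" for j
      using that Des_bounds[of \<pi>] by auto
    \<comment> \<open>If a factor is empty, the cut is at \<open>0\<close> or
      \<open>len \<pi>\<close>, where there is neither a border nor a descent.\<close>
    consider "?a = []" | "?b = []" | "?a \<noteq> []" "?b \<noteq> []" by blast
    then show ?thesis
    proof cases
      case 1
      then have "i = 0" using i by simp
      then show ?thesis using 1 D by force
    next
      case 2
      then have "i = len \<pi>" using i by simp
      then show ?thesis using 2 D by force
    next
      case 3
      have "j \<in> descents (?a @ ?b) \<longleftrightarrow> (if j < i then j \<in> descents ?a else j = i \<or> j - i \<in> descents ?b)" for j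
        unfolding descents_append[OF 3] i(1)[symmetric]
        using bounds[of j] by (auto simp: image_iff intro!: bexI[of _ "j - i"] dest: bounds')
      then show ?thesis
        using D by (auto simp: subset_iff) (metis Suc_leI add_diff_cancel_left' le_add_diff_inverse
            linorder_not_less nat_less_le zero_less_diff One_nat_def not_less_iff_gr_or_eq)+
    qed
  qed
  have "coeff_of (F_qsym (Comp (prefix_perm i \<pi>))) a * coeff_of (F_qsym (Comp (suffix_perm i \<pi>))) b
      = (if i = total_degree a then if ?C then 1 else 0 else 0)" if "i \<le> len \<pi>" for i
  proof (cases "i = total_degree a \<and> total_degree b = len \<pi> - i")
    case True
    then have "i = sum_list ?a" "i + sum_list ?b = len \<pi>"
      using that by (simp_all add: total_degree_comp_of)
    from iff[OF this] show ?thesis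
      using that True by (auto simp: coeff_of_F_Comp len Des_prefix_perm Des_suffix_perm)
  next
    case False
    then show ?thesis using that by (auto simp: coeff_of_F_Comp len)
  qed
  then have "(\<Sum>i\<le>len \<pi>. coeff_of (F_qsym (Comp (prefix_perm i \<pi>))) a * coeff_of (F_qsym (Comp (suffix_perm i \<pi>))) b)
      = (\<Sum>i\<le>len \<pi>. if i = total_degree a then if ?C then 1 else 0 else 0)"
    by (intro sum.cong) auto
  also have "\<dots> = (if ?C then 1 else 0)" by auto
  also have "\<dots> = coeff_of (F_qsym (Comp \<pi>)) (glue N a b)"
    by (simp add: coeff_of_F_Comp parts total_degree_comp_of)
  finally show ?thesis ..
qed

lemma qsym_comult_F_Comp:
  "qsym_comult (F_qsym (Comp \<pi>))
    = (\<Sum>i\<le>len \<pi>. F_qsym (Comp (prefix_perm i \<pi>)) \<otimes> F_qsym (Comp (suffix_perm i \<pi>)))"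
proof (rule tensor_qsym_eqI)
  fix a b :: monomial
  obtain N where N: "Poly_Mapping.keys a \<subseteq> {..<N}"
    using finite_keys[of a] by (auto simp: finite_nat_set_iff_bounded)
  show "tensor_coeff a b (qsym_comult (F_qsym (Comp \<pi>)))
      = tensor_coeff a b (\<Sum>i\<le>len \<pi>. F_qsym (Comp (prefix_perm i \<pi>)) \<otimes> F_qsym (Comp (suffix_perm i \<pi>)))"
    by (simp add: tensor_coeff_qsym_comult[OF N] coeff_of_F_Comp_glue[OF N]
        qlinearD(4)[OF qlinear_tensor_coeff] tensor_coeff_pure)
qed

lemma len_empty_perm [simp]: "len empty_perm = 0"
  by transfer simp

lemma coeff_of_F_Comp_zero: "coeff_of (F_qsym (Comp \<pi>)) 0 = (if abs_des_class \<pi> = abs_des_class empty_perm then 1 else 0)"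
  using Des_bounds[of \<pi>] Des_bounds[of empty_perm]
  by (auto simp: coeff_of_F_Comp des_class.abs_eq_iff Des_equiv_def)

lemma F_Comp_empty: "F_qsym (Comp empty_perm) = qsym_one"
proof (rule qsym_eqI)
  fix m
  have "total_degree m = 0 \<longleftrightarrow> m = 0"
    using length_word_of[of m] word_monomial_word_of[of m] by (auto simp: word_monomial_def)
  then show "coeff_of (F_qsym (Comp empty_perm)) m = coeff_of qsym_one m"
    using Des_bounds[of empty_perm] by (simp add: coeff_of_F_Comp qsym_one.rep_eq)
qed

lemma hopf_algebra_iso_Des_to_QSym: "hopf_algebra_iso H_Des QSym Des_to_QSym"
proof (rule hopf_algebra_isoI[OF hopf_algebra_QSym qlinear_Des_to_QSym])
  let ?\<phi> = Des_to_QSym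
  note lin = qlinear_Des_to_QSym
  show "bij ?\<phi>" using inj_Des_to_QSym surj_Des_to_QSym by (rule bijI)
  fix x y
  have "?\<phi> (linear_extension (\<lambda>c. linear_extension (des_class_mult c) y) x) = qsym_mult (?\<phi> x) (?\<phi> y)"
  \<comment> \<open>Reducing the first argument to a basis class suffices: the second remains a
    linear extension on both sides, with equal values on basis classes.\<close>
  proof (rule free_linear_eqI[where v = x])
    show "qlinear (\<lambda>x. ?\<phi> (linear_extension (\<lambda>c. linear_extension (des_class_mult c) y) x))"
      by (rule qlinear_comp[OF lin qlinear_linear_extension])
    show "qlinear (\<lambda>x. qsym_mult (?\<phi> x) (?\<phi> y))"
      by (rule qlinear_comp[OF qbilinear_left[OF qbilinear_qsym_mult] lin])
    show "?\<phi> (linear_extension (\<lambda>c. linear_extension (des_class_mult c) y) (Poly_Mapping.single c 1))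
        = qsym_mult (?\<phi> (Poly_Mapping.single c 1)) (?\<phi> y)" for c
      by (simp add: linear_linear_extension[OF lin] Des_to_QSym_des_class_mult)
        (simp add: Des_to_QSym_def linear_linear_extension[OF qbilinear_right[OF qbilinear_qsym_mult]])
  qed
  then show "?\<phi> (mult H_Des x y) = mult QSym (?\<phi> x) (?\<phi> y)"
    by (simp add: H_Des_def QSym_def)
  show "?\<phi> (unit H_Des) = unit QSym"
    by (simp add: H_Des_def QSym_def Des_to_QSym_basis F_Comp_empty)
  have lin2: "qlinear (tensor_map ?\<phi> ?\<phi>)" using lin lin by (rule qlinear_tensor_map)
  have "qsym_comult (?\<phi> x) = tensor_map ?\<phi> ?\<phi> (linear_extension des_class_comult x)"
  proof (rule free_linear_eqI[where v = x])
    show "qlinear (\<lambda>x. qsym_comult (?\<phi> x))"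
      by (rule qlinear_comp[OF qlinear_qsym_comult lin])
    show "qlinear (\<lambda>x. tensor_map ?\<phi> ?\<phi> (linear_extension des_class_comult x))"
      by (rule qlinear_comp[OF lin2 qlinear_linear_extension])
    fix c
    obtain \<pi> where c: "c = abs_des_class \<pi>" by (rule des_class_cases)
    have "?\<phi> (Poly_Mapping.single c 1) = F_qsym (Comp \<pi>)"
      using Des_to_QSym_basis[of \<pi>] by (simp add: c Des_basis_def)
    then show "qsym_comult (?\<phi> (Poly_Mapping.single c 1))
        = tensor_map ?\<phi> ?\<phi> (linear_extension des_class_comult (Poly_Mapping.single c 1))"
      by (simp add: c des_class_comult.abs_eq qlinearD(4)[OF lin2] tensor_map_pure[OF lin lin]
          Des_to_QSym_basis qsym_comult_F_Comp)
  qed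
  then show "comult QSym (?\<phi> x) = tensor_map ?\<phi> ?\<phi> (comult H_Des x)"
    by (simp add: H_Des_def QSym_def)
  have "coeff_of (?\<phi> x) 0 = linear_extension (\<lambda>c. if c = abs_des_class empty_perm then 1 else 0) x"
  proof (rule free_linear_eqI[where v = x])
    fix c
    obtain \<pi> where c: "c = abs_des_class \<pi>" by (rule des_class_cases)
    then show "coeff_of (?\<phi> (Poly_Mapping.single c 1)) 0
        = linear_extension (\<lambda>c. if c = abs_des_class empty_perm then 1 else 0) (Poly_Mapping.single c 1)"
      using Des_to_QSym_basis[of \<pi>] by (simp add: Des_basis_def coeff_of_F_Comp_zero)
  qed (rule qlinear_comp[OF qlinear_coeff_of lin] qlinear_linear_extension)+
  then show "counit QSym (?\<phi> x) = counit H_Des x"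
    by (simp add: H_Des_def QSym_def)
qed

theorem proposition3p18:
  shows "(\<forall>\<pi>. Des_to_QSym [\<pi>]\<^sub>D\<^sub>e\<^sub>s = F_qsym (Comp \<pi>)) \<and> hopf_algebra_iso H_Des QSym Des_to_QSym"
  using Des_to_QSym_basis hopf_algebra_iso_Des_to_QSym by simp

end
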